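(* Let $1\le l\le q$. Then $f_{l,1}=h^l$, $f_{l,2}=h^lg^{lq}$, and for every $\nu\ge2$, \[ f_{l,\nu}=\left(\frac{g^q}{h^{q-1}}\,f_{1,\nu-1}^{\,q}-\frac{[\nu-2]^{q^2}}{h^{q-1}}\,f_{1,\nu-2}^{\,q^2}\right)^l . \]
   Context: $q$ prime power, $A=\mathbb{F}_q[\theta]$, $A_+$ its monic elements, $\mathbb{C}_\infty$ and $\Omega=\mathbb{C}_\infty\setminus K_\infty$ as usual. $\tilde\pi A$ is the Carlitz period lattice with exponential $e_{\tilde\pi A}$, $u_c(z)=1/e_{\tilde\pi A}(\tilde\pi cz)$. The Drinfeld modular forms $g$ and $h$ are $g=1-(\theta^q-\theta)\sum_{c\in A_+}u_c^{q-1}$ and $h=\sum_{c\in A_+}c^qu_c$. For integers $\nu\ge0$ and $1\le l\le q$, $f_{l,\nu}=\sum_{c\in A_+}c^{lq^\nu}u_c^l$ (so $f_{1,0}$ is Gekeler's false Eisenstein series $E=\sum_{c\in A_+}cu_c$). For $n\ge0$, $[n]=\theta^{q^n}-\theta$. *)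

theory Defs
  imports
    "HOL-Analysis.Analysis"
    "HOL-Computational_Algebra.Formal_Laurent_Series"
begin

section \<open>Fields with a non-archimedean absolute value\<close>

text \<open>The absolute value of \<open>x\<close> is \<open>dist x 0\<close>.\<close>

class valued_field = field + metric_space +
  assumes dist_add_right: "dist (x + z) (y + z) = dist x y"
    and dist_mult_0: "dist (x * y) 0 = dist x 0 * dist y 0"
    and dist_ultra: "dist x z \<le> max (dist x y) (dist y z)"

text \<open>The operations are continuous for the metric topology; the instance makes the
  library's facts about infinite sums available.\<close>

instance valued_field \<subseteq> topological_ab_group_add
proof
  fix a b :: 'a
  have d: "dist (x + y) (a + b) \<le> dist x a + dist y b" for x y :: 'a
  proof -
    have "dist (x + y) (a + b) \<le> dist (x + y) (a + y) + dist (a + y) (a + b)"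
      by (rule dist_triangle)
    also have "dist (a + y) (a + b) = dist y b"
      using dist_add_right[of y a b] by (simp add: add.commute)
    finally show ?thesis by (simp add: dist_add_right)
  qed
  show "((\<lambda>x. fst x + snd x) \<longlongrightarrow> a + b) (nhds a \<times>\<^sub>F nhds b)"
    unfolding nhds_prod[symmetric]
  proof (rule metric_tendsto_imp_tendsto)
    show "((\<lambda>x. dist (fst x) a + dist (snd x) b) \<longlongrightarrow> 0) (nhds (a, b))"
      by (rule tendsto_eq_intros filterlim_ident | simp)+
  next
    show "\<forall>\<^sub>F x in nhds (a, b).
        dist (fst x + snd x) (a + b) \<le> dist (dist (fst x) a + dist (snd x) b) 0"
      using d by (intro always_eventually) (simp add: dist_real_def)
  qed
next
  fix a :: 'a
  have "dist (- x) (- a) = dist x a" for x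
    using dist_add_right[of "- x" "x + a" "- a"] by (simp add: dist_commute)
  then show "(uminus \<longlongrightarrow> - a) (nhds a)"
    by (intro metric_tendsto_imp_tendsto[OF filterlim_ident]) (simp add: always_eventually)
qed


section \<open>The field \<open>C\<^sub>\<infinity>\<close>\<close>

text \<open>Here \<open>'f\<close> is the finite field with \<open>q = CARD('f)\<close> elements and \<open>K\<^sub>\<infinity>\<close>, the field of
  Laurent series over \<open>'f\<close> in \<open>1/\<theta>\<close>, is the type \<open>'f fls\<close>: the indeterminate \<open>fls_X\<close> is
  \<open>1/\<theta>\<close>, so \<open>\<theta>\<close> is \<open>fls_X_inv\<close> and has absolute value \<open>q\<close>.

  The locale says that \<open>\<iota>\<close> exhibits \<open>'c\<close> as a completion of an algebraic closure of \<open>K\<^sub>\<infinity>\<close>: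
  \<open>'c\<close> is complete and algebraically closed, \<open>\<iota>\<close> is an isometric field embedding, and the
  elements algebraic over \<open>K\<^sub>\<infinity>\<close> are dense. This determines \<open>'c\<close> up to isometric isomorphism
  over \<open>K\<^sub>\<infinity>\<close>.\<close>

locale C_infinity =
  fixes \<iota> :: "'f::{finite,field} fls \<Rightarrow> 'c::{valued_field,alg_closed_field,complete_space}"
  assumes hom_one: "\<iota> 1 = 1"
    and hom_add: "\<iota> (x + y) = \<iota> x + \<iota> y"
    and hom_mult: "\<iota> (x * y) = \<iota> x * \<iota> y"
    and dist_hom: "x \<noteq> 0 \<Longrightarrow> dist (\<iota> x) 0 = real CARD('f) powi (- fls_subdegree x)"
    and algebraic_dense: "closure {x. \<exists>p. p \<noteq> 0 \<and> poly (map_poly \<iota> p) x = 0} = UNIV"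

definition Omega :: "('f::{finite,field} fls \<Rightarrow> 'c::valued_field) \<Rightarrow> 'c set" where
  "Omega \<iota> = UNIV - range \<iota>"

definition theta :: "('f::{finite,field} fls \<Rightarrow> 'c::valued_field) \<Rightarrow> 'c" where
  "theta \<iota> = \<iota> fls_X_inv"

text \<open>The image in \<open>C\<^sub>\<infinity>\<close> of an element of \<open>A\<close>, which is given as a polynomial in \<open>\<theta>\<close>.\<close>

definition of_A :: "('f::{finite,field} fls \<Rightarrow> 'c::valued_field) \<Rightarrow> 'f poly \<Rightarrow> 'c" where
  "of_A \<iota> a = \<iota> (poly (map_poly fls_const a) fls_X_inv)"

definition A_plus :: "'f::{finite,field} poly set" where
  "A_plus = {a. lead_coeff a = 1}"

definition bracket :: "('f::{finite,field} fls \<Rightarrow> 'c::valued_field) \<Rightarrow> nat \<Rightarrow> 'c" where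
  "bracket \<iota> n = theta \<iota> ^ (CARD('f) ^ n) - theta \<iota>"


section \<open>The Carlitz period lattice\<close>

text \<open>The exponential of the Carlitz module \<open>C\<^sub>\<theta>(X) = \<theta>X + X\<^sup>q\<close>, that is the series
  \<open>z + \<dots>\<close> satisfying \<open>exp\<^sub>C(\<theta>z) = \<theta>exp\<^sub>C(z) + exp\<^sub>C(z)\<^sup>q\<close>.\<close>

definition carlitz_D :: "('f::{finite,field} fls \<Rightarrow> 'c::valued_field) \<Rightarrow> nat \<Rightarrow> 'c" where
  "carlitz_D \<iota> n = (\<Prod>i<n. theta \<iota> ^ (CARD('f) ^ n) - theta \<iota> ^ (CARD('f) ^ i))"

definition carlitz_exp :: "('f::{finite,field} fls \<Rightarrow> 'c::valued_field) \<Rightarrow> 'c \<Rightarrow> 'c" where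
  "carlitz_exp \<iota> z = (\<Sum>n. z ^ (CARD('f) ^ n) / carlitz_D \<iota> n)"

definition lattice :: "('f::{finite,field} fls \<Rightarrow> 'c::valued_field) \<Rightarrow> 'c \<Rightarrow> 'c set" where
  "lattice \<iota> \<omega> = range (\<lambda>a. \<omega> * of_A \<iota> a)"

text \<open>\<open>\<omega>\<close> is a choice of \<open>\<pi>\<close>-tilde: a generator over \<open>A\<close> of the lattice of periods (zeros) of the
  Carlitz exponential. It is unique up to a nonzero factor in \<open>\<F>\<^sub>q\<close>.\<close>

definition carlitz_period :: "('f::{finite,field} fls \<Rightarrow> 'c::valued_field) \<Rightarrow> 'c \<Rightarrow> bool" where
  "carlitz_period \<iota> \<omega> \<longleftrightarrow> {z. carlitz_exp \<iota> z = 0} = lattice \<iota> \<omega>"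

text \<open>The exponential \<open>z \<Prod> (1 - z/x)\<close>, over the nonzero \<open>x \<in> \<Lambda>\<close>, of a lattice \<open>\<Lambda>\<close>; as with
  \<^const>\<open>infsum\<close>, the infinite product is the limit over the finite sets of nonzero \<open>x\<close>.\<close>

definition lattice_exp :: "'c::valued_field set \<Rightarrow> 'c \<Rightarrow> 'c" where
  "lattice_exp \<Lambda> z = z * Lim (finite_subsets_at_top (\<Lambda> - {0})) (\<lambda>F. \<Prod>x\<in>F. 1 - z / x)"


section \<open>The functions on \<open>\<Omega>\<close>\<close>

definition u :: "('f::{finite,field} fls \<Rightarrow> 'c::valued_field) \<Rightarrow> 'c \<Rightarrow> 'f poly \<Rightarrow> 'c \<Rightarrow> 'c" where
  "u \<iota> \<omega> c z = 1 / lattice_exp (lattice \<iota> \<omega>) (\<omega> * of_A \<iota> c * z)"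

definition g_form :: "('f::{finite,field} fls \<Rightarrow> 'c::valued_field) \<Rightarrow> 'c \<Rightarrow> 'c \<Rightarrow> 'c" where
  "g_form \<iota> \<omega> z =
     1 - (theta \<iota> ^ CARD('f) - theta \<iota>) * (\<Sum>\<^sub>\<infinity>c\<in>A_plus. u \<iota> \<omega> c z ^ (CARD('f) - 1))"

definition h_form :: "('f::{finite,field} fls \<Rightarrow> 'c::valued_field) \<Rightarrow> 'c \<Rightarrow> 'c \<Rightarrow> 'c" where
  "h_form \<iota> \<omega> z = (\<Sum>\<^sub>\<infinity>c\<in>A_plus. of_A \<iota> c ^ CARD('f) * u \<iota> \<omega> c z)"

definition f_form ::
    "('f::{finite,field} fls \<Rightarrow> 'c::valued_field) \<Rightarrow> 'c \<Rightarrow> nat \<Rightarrow> nat \<Rightarrow> 'c \<Rightarrow> 'c" where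
  "f_form \<iota> \<omega> l \<nu> z =
     (\<Sum>\<^sub>\<infinity>c\<in>A_plus. of_A \<iota> c ^ (l * CARD('f) ^ \<nu>) * u \<iota> \<omega> c z ^ l)"

end

theory Submission
  imports Defs
begin

text \<open>
  Write \<open>e\<close> for the exponential of the period lattice, fix \<open>z \<in> \<Omega>\<close>, and put
  \<open>V(c) = e(\<omega>cz)\<close>. This map is \<open>\<F>\<^sub>q\<close>-linear with \<open>V(\<theta>c) = \<theta>V(c) + V(c)\<^sup>q\<close>, and the forms are
  sums over monic \<open>c\<close> of expressions in \<open>V(c)\<close> and an \<open>\<F>\<^sub>q\<close>-linear function \<open>\<eta>(c) = c\<^bsup>q^\<nu>\<^esup>\<close>. On the
  finite-dimensional space of all \<open>V(c)\<close> with \<open>deg c < n\<close>, let \<open>e\<^sub>n\<close> be the \<open>\<F>\<^sub>q\<close>-linear polynomial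
  with these zeros and linear coefficient \<open>1\<close>, and \<open>F\<^sub>n\<close> the \<open>\<F>\<^sub>q\<close>-linear polynomial of degree \<open>< q\<^sup>n\<close>
  interpolating \<open>\<eta>\<close>. Partial fractions of \<open>(F\<^sub>n / e\<^sub>n)\<^sup>l\<close> give
  \<open>\<Sum> (\<eta>(c) / V(c))\<^sup>l = (\<Sum> \<eta>(c) / V(c))\<^sup>l\<close> for \<open>1 \<le> l \<le> q\<close>, so only \<open>l = 1\<close> matters, where the sum is the linear
  coefficient of \<open>F\<^sub>n\<close>.

  Multiplication by \<open>\<theta>\<close> induces \<open>e\<^sub>n\<^sub>+\<^sub>1(\<theta>X + X\<^sup>q) = \<phi>\<^sub>n(e\<^sub>n(X))\<close> with
  \<open>\<phi>\<^sub>n = \<theta>Y + g\<^sub>n Y\<^sup>q + D\<^sub>n Y\<^bsup>q^2\<^esup>\<close>, the finite level version of the Drinfeld module of the lattice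
  \<open>\<omega>(Az + A)\<close>. As \<open>F\<^sub>n\<^sub>+\<^sub>1(\<theta>X + X\<^sup>q) - \<theta>\<^bsup>q^\<nu>\<^esup>F\<^sub>n(X)\<close> vanishes on the lattice, it equals
  \<open>a\<^sub>n e\<^sub>n + b\<^sub>n e\<^sub>n\<^sup>q\<close>, and the difference of the interpolation polynomial of \<open>\<eta>\<^sup>q\<close> and \<open>F\<^sub>n\<^sup>q\<close> is a multiple of
  \<open>e\<^sub>n\<close>. Comparing coefficients yields the recurrence with \<open>- D\<^sub>n\<close> in place of \<open>h\<^sup>q\<^sup>-\<^sup>1\<close>; for \<open>\<nu> = 1\<close> it also
  yields \<open>D\<^sub>n = - (\<Sum> c\<^sup>q / V(c))\<^sup>q\<^sup>-\<^sup>1\<close> (sum over monic \<open>c\<close> of degree \<open>\<le> n\<close>). All identities are exact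
  for finite \<open>n\<close>, where they are proved by induction, and the theorem is their limit.
\<close>

section \<open>Finite fields\<close>

lemma card_ge_2: "CARD('f::{finite,field}) \<ge> 2"
proof -
  have "card {0, 1::'f} \<le> CARD('f)"
    by (rule card_mono) auto
  then show ?thesis by simp
qed

text \<open>Multiplication by \<open>x\<close> permutes the nonzero elements, so it leaves their
  product unchanged.\<close>

lemma power_card_minus_one:
  fixes x :: "'f::{finite,field}"
  assumes "x \<noteq> 0"
  shows "x ^ (CARD('f) - 1) = 1"
proof -
  have "(\<Prod>y\<in>UNIV-{0}. x * y) = (\<Prod>y\<in>UNIV-{0}. y)"
    by (rule prod.reindex_bij_witness[of _ "\<lambda>y. y / x" "\<lambda>y. x * y"]) (use assms in auto)
  moreover have "(\<Prod>y\<in>UNIV-{0}. x * y) = x ^ (CARD('f) - 1) * (\<Prod>y\<in>UNIV-{0}. y)"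
    by (simp add: prod.distrib)
  ultimately show ?thesis
    by simp
qed

lemma power_card_eq:
  fixes x :: "'f::{finite,field}"
  shows "x ^ CARD('f) = x"
proof (cases "x = 0")
  case False
  have "x ^ CARD('f) = x * x ^ (CARD('f) - 1)"
    using card_ge_2[where 'f='f] by (metis Suc_diff_1 less_le_trans pos2 power_Suc)
  then show ?thesis
    using power_card_minus_one[OF False] by simp
qed (use card_ge_2[where 'f='f] in auto)

text \<open>Translation by \<open>1\<close> permutes the field but adds \<open>CARD('f)\<close>
  times \<open>1\<close> to the sum of its elements.\<close>

lemma of_nat_card_eq_0: "of_nat (CARD('f)) = (0 :: 'f::{finite,field})"
proof -
  have "(\<Sum>x\<in>(UNIV::'f set). x + 1) = (\<Sum>x\<in>UNIV. x)"
    by (rule sum.reindex_bij_witness[of _ "\<lambda>x. x - 1" "\<lambda>x. x + 1"]) auto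
  then show ?thesis
    by (simp add: sum.distrib)
qed

text \<open>Since x^q = x, the polynomial (x + 1)^q - x^q - 1 has q zeros in the field. Its degree
  is below q, so its coefficients vanish.\<close>

lemma of_nat_card_choose_eq_0:
  assumes "0 < k" "k < CARD('f)"
  shows "of_nat (CARD('f) choose k) = (0 :: 'f::{finite,field})"
proof -
  let ?q = "CARD('f)"
  define P :: "'f poly" where "P = (\<Sum>k\<in>{0<..<?q}. monom (of_nat (?q choose k)) k)"
  have q: "?q \<ge> 2" by (rule card_ge_2)
  have "poly P x = 0" for x
  proof -
    have split: "{..?q} = insert 0 (insert ?q {0<..<?q})"
      using q by auto
    have "x + 1 = (x + 1) ^ ?q"
      by (simp add: power_card_eq)
    also have "\<dots> = (\<Sum>k\<le>?q. of_nat (?q choose k) * x ^ k)"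
      using binomial_ring[of x 1 ?q] by simp
    also have "\<dots> = 1 + (x ^ ?q + poly P x)"
      unfolding split using q by (simp add: P_def poly_sum poly_monom)
    finally show ?thesis
      by (simp add: power_card_eq)
  qed
  then have roots: "{x. poly P x = 0} = UNIV"
    by auto
  have deg: "degree P \<le> ?q - 1"
    unfolding P_def by (intro degree_sum_le) (auto intro: order.trans[OF degree_monom_le])
  have "P = 0"
  proof (rule ccontr)
    assume "P \<noteq> 0"
    then have "card {x. poly P x = 0} \<le> degree P"
      by (rule card_poly_roots_bound)
    with roots deg q show False
      by simp
  qed
  then have "coeff P k = 0"
    by simp
  moreover have "coeff P k = of_nat (?q choose k)"
    using assms by (simp add: P_def coeff_sum sum.delta if_distrib[of of_nat])
  ultimately show ?thesis
    by simp
qed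

text \<open>Scaling by a nonzero \<open>a\<close> permutes the field and multiplies the sum by
  \<open>a ^ m\<close>. For m > 0, counting the zeros of X^m - 1 yields some \<open>a\<close> with
  \<open>a ^ m \<noteq> 1\<close>. For m = 0 the sum is q = 0.\<close>

lemma sum_powers_eq_0:
  assumes "m < CARD('f) - 1"
  shows "(\<Sum>x\<in>UNIV. x ^ m :: 'f::{finite,field}) = 0"
proof (cases "m = 0")
  case True
  then show ?thesis
    by (simp add: of_nat_card_eq_0)
next
  case False
  have "\<exists>a::'f. a \<noteq> 0 \<and> a ^ m \<noteq> 1"
  proof (rule ccontr)
    assume "\<not> ?thesis"
    then have sub: "UNIV - {0::'f} \<subseteq> {x. poly (monom 1 m - 1) x = 0}"
      by (auto simp: poly_monom)
    have deg: "degree (monom 1 m - 1 :: 'f poly) \<le> m"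
      by (intro degree_diff_le degree_monom_le) auto
    have nz: "monom 1 m - 1 \<noteq> (0 :: 'f poly)"
      using False by (metis degree_1 degree_monom_eq eq_iff_diff_eq_0 zero_neq_one)
    have "card (UNIV - {0::'f}) \<le> card {x::'f. poly (monom 1 m - 1) x = 0}"
      by (rule card_mono[OF _ sub]) simp
    also have "\<dots> \<le> m"
      using card_poly_roots_bound[OF nz] deg by simp
    finally show False
      using assms by simp
  qed
  then obtain a :: 'f where a: "a \<noteq> 0" "a ^ m \<noteq> 1"
    by blast
  have "(\<Sum>x\<in>(UNIV::'f set). (a * x) ^ m) = (\<Sum>x\<in>UNIV. x ^ m)"
    by (rule sum.reindex_bij_witness[of _ "\<lambda>y. y / a" "\<lambda>y. a * y"]) (use a in auto)
  then have "(a ^ m - 1) * (\<Sum>x\<in>(UNIV::'f set). x ^ m) = 0"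
    by (simp add: power_mult_distrib left_diff_distrib flip: sum_distrib_left)
  with a show ?thesis
    by simp
qed

lemma sum_powers_card_minus_one:
  "(\<Sum>x\<in>UNIV. x ^ (CARD('f) - 1) :: 'f::{finite,field}) = -1"
proof -
  have "(\<Sum>x\<in>(UNIV::'f set). x ^ (CARD('f) - 1)) = (\<Sum>x\<in>UNIV - {0::'f}. 1)"
    by (intro sum.mono_neutral_cong_right)
      (use card_ge_2[where 'f='f] in \<open>auto simp: power_card_minus_one[simplified]\<close>)
  also have "\<dots> = of_nat (CARD('f)) - 1"
    using card_ge_2[where 'f='f] by (simp add: of_nat_diff)
  finally show ?thesis
    by (simp add: of_nat_card_eq_0)
qed

section \<open>Fields containing F_q: Frobenius, and sums and products over F_q\<close>

locale fq_embedding =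
  fixes emb :: "'f::{finite,field} \<Rightarrow> 'c::field" and q :: nat
  assumes q_eq: "q = CARD('f)"
    and emb_one: "emb 1 = 1"
    and emb_add: "emb (x + y) = emb x + emb y"
    and emb_mult: "emb (x * y) = emb x * emb y"
begin

lemma q_ge_2: "q \<ge> 2"
  unfolding q_eq by (rule card_ge_2)

lemma q_pos: "q > 0"
  using q_ge_2 by simp

lemma emb_zero: "emb 0 = 0"
  using emb_add[of 0 0] by (metis add.right_neutral add_left_cancel)

lemma emb_minus: "emb (- x) = - emb x"
  using emb_add[of x "- x"] by (simp add: emb_zero eq_neg_iff_add_eq_0 add.commute)

lemma emb_eq_0_iff: "emb x = 0 \<longleftrightarrow> x = 0"
proof
  assume "emb x = 0"
  then have "emb (x * inverse x) = 0"
    by (simp add: emb_mult)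
  then show "x = 0"
    by (metis emb_one right_inverse zero_neq_one)
qed (simp add: emb_zero)

lemma emb_eq_iff: "emb x = emb y \<longleftrightarrow> x = y"
proof -
  have "emb x - emb y = emb (x - y)"
    using emb_add[of x "- y"] by (simp add: emb_minus)
  then show ?thesis
    by (metis emb_eq_0_iff right_minus_eq)
qed

lemma emb_power: "emb (x ^ n) = emb x ^ n"
  by (induction n) (simp_all add: emb_one emb_mult)

lemma emb_sum: "emb (sum f A) = (\<Sum>x\<in>A. emb (f x))"
  by (induction A rule: infinite_finite_induct) (simp_all add: emb_zero emb_add)

lemma emb_of_nat: "emb (of_nat n) = of_nat n"
  by (induction n) (simp_all add: emb_zero emb_one emb_add)

lemma emb_power_q: "emb x ^ q = emb x"
  by (metis emb_power power_card_eq q_eq)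

lemma of_nat_q: "of_nat q = (0 :: 'c)"
  by (metis emb_of_nat emb_zero of_nat_card_eq_0 q_eq)

text \<open>The inner binomial coefficients vanish in F_q, and \<open>emb\<close> carries this over
  to the larger field.\<close>

lemma frob_add: "(x + y :: 'c) ^ q = x ^ q + y ^ q"
proof -
  have "of_nat (q choose k) = (0 :: 'c)" if "0 < k" "k < q" for k
    using of_nat_card_choose_eq_0[of k, where 'f='f] that by (metis emb_of_nat emb_zero q_eq)
  then have "(x + y) ^ q = (\<Sum>k\<in>{0, q}. of_nat (q choose k) * x ^ k * y ^ (q - k))"
    unfolding binomial_ring by (intro sum.mono_neutral_right) auto
  then show ?thesis
    using q_pos by (simp add: add.commute)
qed

lemma frob_minus: "(- x :: 'c) ^ q = - (x ^ q)"
  using frob_add[of x "- x"] q_pos by (simp add: eq_neg_iff_add_eq_0 add.commute zero_power)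

lemma frob_diff: "(x - y :: 'c) ^ q = x ^ q - y ^ q"
  using frob_add[of x "- y"] by (simp add: frob_minus)

text \<open>As -1 is a nonzero element of F_q, no distinction between odd and even \<open>q\<close>
  is needed.\<close>

lemma minus_one_power: "(-1 :: 'c) ^ (q - 1) = 1"
proof -
  have "emb ((-1) ^ (q - 1)) = 1"
    by (simp add: power_card_minus_one[simplified] emb_one q_eq)
  then show ?thesis
    by (simp add: emb_power emb_minus emb_one)
qed

lemma power_q_Suc: "x * x ^ (q - 1) = (x ^ q :: 'c)"
  using q_pos by (metis Suc_diff_1 power_Suc)

lemma power_q_minus_one: "x ^ q = (x ^ (q - 1) * x :: 'c)"
  by (metis power_q_Suc mult.commute)

text \<open>Both sides are monic of degree \<open>q\<close> and vanish on F_q, so their difference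
  has too many zeros for its degree.\<close>

lemma prod_fq_poly: "(\<Prod>\<epsilon>\<in>UNIV. [:emb \<epsilon>, 1:]) = monom 1 q - monom 1 1"
proof -
  define P :: "'c poly" where "P = (\<Prod>\<epsilon>\<in>UNIV. [:emb \<epsilon>, 1:])"
  define D :: "'c poly" where "D = P - (monom 1 q - monom 1 1)"
  have degP: "degree P = q"
    unfolding P_def by (subst degree_prod_sum_eq) (auto simp: q_eq)
  have lcP: "coeff P q = 1"
    using lead_coeff_prod[of "\<lambda>\<epsilon>. [:emb \<epsilon>, 1:]" UNIV] by (simp add: degP flip: P_def)
  have "degree D \<le> q"
    unfolding D_def using degP q_pos
    by (intro degree_diff_le) (auto intro: order.trans[OF degree_monom_le])
  moreover have "coeff D q = 0"
    using q_ge_2 by (simp add: D_def lcP)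
  ultimately have degD: "degree D < q"
    using q_pos by (metis coeff_eq_0 degree_0 le_neq_implies_less leading_coeff_0_iff)
  have root: "poly D (emb x) = 0" for x
  proof -
    have "poly P (emb x) = 0"
      unfolding P_def poly_prod
      by (rule prod_zero) (auto intro!: exI[of _ "- x"] simp: emb_minus)
    then show ?thesis
      by (simp add: D_def poly_monom emb_power_q)
  qed
  have "D = 0"
  proof (rule ccontr)
    assume D: "D \<noteq> 0"
    have "q = card (range emb)"
      by (subst card_image) (auto simp: inj_on_def emb_eq_iff q_eq)
    also have "\<dots> \<le> card {x. poly D x = 0}"
      by (rule card_mono) (auto simp: root poly_roots_finite[OF D])
    also have "\<dots> \<le> degree D"
      by (rule card_poly_roots_bound[OF D])
    finally show False
      using degD by simp
  qed
  then show ?thesis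
    by (simp add: D_def P_def)
qed

text \<open>Homogeneous form of \<open>prod_fq_poly\<close>, with zeros on the line spanned by
  \<open>r\<close>. It gives the passage from one lattice polynomial to the next.\<close>

lemma prod_fq: "(\<Prod>\<epsilon>\<in>UNIV. Y + emb \<epsilon> * r) = Y ^ q - r ^ (q - 1) * Y"
proof (cases "r = 0")
  case True
  then show ?thesis
    using q_ge_2 by (simp add: zero_power flip: q_eq)
next
  case r: False
  have "poly (\<Prod>\<epsilon>\<in>UNIV. [:emb \<epsilon>, 1:]) (Y / r) = (Y / r) ^ q - Y / r"
    unfolding prod_fq_poly by (simp add: poly_monom)
  then have prod: "(\<Prod>\<epsilon>\<in>UNIV. emb \<epsilon> + Y / r) = (Y / r) ^ q - Y / r"
    by (simp add: poly_prod)
  have "(\<Prod>\<epsilon>\<in>UNIV. Y + emb \<epsilon> * r) = (\<Prod>\<epsilon>\<in>(UNIV::'f set). r * (emb \<epsilon> + Y / r))"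
    using r by (intro prod.cong) (auto simp: field_simps)
  also have "\<dots> = r ^ q * ((Y / r) ^ q - Y / r)"
    by (simp add: prod.distrib prod q_eq)
  also have "\<dots> = Y ^ q - r ^ (q - 1) * Y"
    using r power_q_minus_one[of r] by (simp add: field_simps power_divide)
  finally show ?thesis .
qed

text \<open>Wilson's theorem for F_q, read off from the coefficient of X in
  \<open>prod_fq_poly\<close>.\<close>

lemma prod_fq_nonzero: "(\<Prod>\<epsilon>\<in>UNIV - {0}. emb \<epsilon>) = -1"
proof -
  let ?Q = "\<Prod>\<epsilon>\<in>UNIV - {0}. [:emb \<epsilon>, 1:]"
  have "(\<Prod>\<epsilon>\<in>UNIV. [:emb \<epsilon>, 1:]) = [:0, 1:] * ?Q"
    by (subst prod.remove[of UNIV 0]) (auto simp: emb_zero)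
  then have "coeff ([:0, 1:] * ?Q) 1 = coeff (monom 1 q - monom 1 1) 1"
    by (simp only: prod_fq_poly)
  also have "\<dots> = -1"
    using q_ge_2 by simp
  finally have "coeff ([:0, 1:] * ?Q) 1 = -1" .
  moreover have "coeff ([:0, 1:] * ?Q) 1 = poly ?Q 0"
    by (simp add: poly_0_coeff_0)
  moreover have "poly ?Q 0 = (\<Prod>\<epsilon>\<in>UNIV - {0}. emb \<epsilon>)"
    by (simp add: poly_prod)
  ultimately show ?thesis
    by simp
qed

lemma prod_fq_normalized:
  assumes "r \<noteq> 0"
  shows "Y * (\<Prod>\<epsilon>\<in>UNIV - {0}. (Y + emb \<epsilon> * r) / (emb \<epsilon> * r)) = Y - Y ^ q / r ^ (q - 1)"
proof -
  have "(\<Prod>\<epsilon>\<in>UNIV - {0::'f}. emb \<epsilon> * r) = - (r ^ (q - 1))"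
    by (simp add: prod.distrib prod_fq_nonzero q_eq)
  moreover have "Y * (\<Prod>\<epsilon>\<in>UNIV - {0}. Y + emb \<epsilon> * r) = Y ^ q - r ^ (q - 1) * Y"
    unfolding prod_fq[symmetric] by (subst prod.remove[of UNIV 0]) (auto simp: emb_zero)
  ultimately show ?thesis
    using assms unfolding prod_dividef by (simp add: diff_divide_distrib)
qed

text \<open>Binomial expansion leaves only power sums over F_q of exponent below
  \<open>q - 1\<close>, all of which vanish.\<close>

lemma sum_fq_powers:
  assumes "m < q - 1"
  shows "(\<Sum>\<epsilon>\<in>UNIV. (Y + emb \<epsilon> * r) ^ m) = (0 :: 'c)"
proof -
  have z: "(\<Sum>\<epsilon>\<in>UNIV. emb \<epsilon> ^ k) = (0 :: 'c)" if "k \<le> m" for k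
    using sum_powers_eq_0[of k, where 'f='f] that assms q_eq by (metis (mono_tags, lifting) emb_power emb_sum emb_zero le_less_trans sum.cong)
  have "(\<Sum>\<epsilon>\<in>(UNIV::'f set). (Y + emb \<epsilon> * r) ^ m)
      = (\<Sum>\<epsilon>\<in>(UNIV::'f set). \<Sum>k\<le>m. of_nat (m choose k) * (emb \<epsilon> * r) ^ k * Y ^ (m - k))"
    by (subst add.commute, subst binomial_ring) simp
  also have "\<dots> = (\<Sum>k\<le>m. of_nat (m choose k) * r ^ k * Y ^ (m - k) * (\<Sum>\<epsilon>\<in>(UNIV::'f set). emb \<epsilon> ^ k))"
    by (subst sum.swap) (simp add: sum_distrib_left sum_distrib_right power_mult_distrib mult_ac)
  also have "\<dots> = 0"
    by (simp add: z)
  finally show ?thesis .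
qed

text \<open>Of the binomial expansion only the term in \<epsilon>^(q-1) survives the summation over
  F_q.\<close>

lemma sum_fq_power_q_minus_one: "(\<Sum>\<epsilon>\<in>UNIV. (Y + emb \<epsilon> * r) ^ (q - 1)) = - (r ^ (q - 1) :: 'c)"
proof -
  have z: "(\<Sum>\<epsilon>\<in>UNIV. emb \<epsilon> ^ k) = (if k = q - 1 then -1 else 0 :: 'c)" if "k \<le> q - 1" for k
  proof (cases "k = q - 1")
    case True
    then show ?thesis
      using sum_powers_card_minus_one[where 'f='f] q_eq by (metis (mono_tags, lifting) emb_minus emb_one emb_power emb_sum sum.cong)
  next
    case False
    then show ?thesis
      using sum_fq_powers[of k 0 1] that by simp
  qed
  have "(\<Sum>\<epsilon>\<in>(UNIV::'f set). (Y + emb \<epsilon> * r) ^ (q - 1))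
      = (\<Sum>\<epsilon>\<in>(UNIV::'f set). \<Sum>k\<le>q - 1. of_nat (q - 1 choose k) * (emb \<epsilon> * r) ^ k * Y ^ (q - 1 - k))"
    by (subst add.commute, subst binomial_ring) simp
  also have "\<dots> = (\<Sum>k\<le>q - 1. of_nat (q - 1 choose k) * r ^ k * Y ^ (q - 1 - k) * (\<Sum>\<epsilon>\<in>(UNIV::'f set). emb \<epsilon> ^ k))"
    by (subst sum.swap) (simp add: sum_distrib_left sum_distrib_right power_mult_distrib mult_ac)
  also have "\<dots> = (\<Sum>k\<le>q - 1. if k = q - 1 then - (r ^ (q - 1)) else 0)"
    by (intro sum.cong) (auto simp: z)
  finally show ?thesis
    by simp
qed

text \<open>With \<open>y = Y + \<epsilon> r\<close>, the value \<open>N\<close> of \<open>y\<^sup>q - r\<^sup>q\<^sup>-\<^sup>1 y\<close> does not depend on \<open>\<epsilon>\<close>, so that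
  \<open>N / y\<^sup>l = y\<^sup>q\<^sup>-\<^sup>l - r\<^sup>q\<^sup>-\<^sup>1 / y\<^sup>l\<^sup>-\<^sup>1\<close> gives a recursion in \<open>l\<close>.\<close>

lemma sum_fq_inverse_powers:
  assumes "1 \<le> l" "l \<le> q" "r \<noteq> 0" and nz: "\<And>\<epsilon>. Y + emb \<epsilon> * r \<noteq> 0"
  shows "(\<Sum>\<epsilon>\<in>UNIV. 1 / (Y + emb \<epsilon> * r) ^ l) = (1 / (Y - Y ^ q / r ^ (q - 1))) ^ l"
proof -
  define N where "N = Y ^ q - r ^ (q - 1) * Y"
  define p where "p = (\<lambda>l. \<Sum>\<epsilon>\<in>(UNIV::'f set). 1 / (Y + emb \<epsilon> * r) ^ l)"
  have N: "N \<noteq> 0"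
    unfolding N_def prod_fq[symmetric] using nz by simp
  have Ny: "N = (Y + emb \<epsilon> * r) ^ q - r ^ (q - 1) * (Y + emb \<epsilon> * r)" for \<epsilon>
    using power_q_minus_one[of r] by (simp add: N_def frob_add power_mult_distrib emb_power_q algebra_simps)
  have step: "N * p (Suc l) = (\<Sum>\<epsilon>\<in>(UNIV::'f set). (Y + emb \<epsilon> * r) ^ (q - Suc l)) - r ^ (q - 1) * p l"
    if "Suc l \<le> q" for l
  proof -
    have "N / (Y + emb \<epsilon> * r) ^ Suc l
        = (Y + emb \<epsilon> * r) ^ (q - Suc l) - r ^ (q - 1) * (1 / (Y + emb \<epsilon> * r) ^ l)" for \<epsilon>
    proof -
      have "(y ^ q - R * y) / y ^ Suc l = y ^ (q - Suc l) - R * (1 / y ^ l)" if "y \<noteq> 0" for y R :: 'c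
      proof -
        have "y ^ q = y ^ (q - Suc l) * y ^ Suc l"
          using \<open>Suc l \<le> q\<close> by (metis le_add_diff_inverse2 power_add)
        with that show ?thesis
          by (simp add: field_simps)
      qed
      from this[OF nz] show ?thesis
        by (subst Ny[of \<epsilon>]) simp
    qed
    then show ?thesis
      by (simp add: p_def sum_distrib_left sum_subtractf)
  qed
  \<comment> \<open>The induction starts at 1: the formula fails for \<open>l = 0\<close>, where the
    sum is q = 0. This zero removes the last term of \<open>step\<close> for the base case, and from
    then on the power sums vanish.\<close>
  have "p l = (- (r ^ (q - 1)) / N) ^ l"
    using assms(1,2)
  proof (induction l rule: dec_induct)
    case base
    have "N * p (Suc 0) = - (r ^ (q - 1))"
      using step[of 0] q_pos sum_fq_power_q_minus_one[of Y r] of_nat_q by (simp add: p_def q_eq)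
    then show ?case
      using N by (simp add: field_simps)
  next
    case (step l)
    have "N * p (Suc l) = - (r ^ (q - 1)) * p l"
      using \<open>Suc l \<le> q\<close> \<open>1 \<le> l\<close> by (subst \<open>\<And>l. Suc l \<le> q \<Longrightarrow> _\<close>) (simp_all add: sum_fq_powers)
    then show ?case
      using N step by (simp add: field_simps)
  qed
  moreover have "- (r ^ (q - 1)) / N = 1 / (Y - Y ^ q / r ^ (q - 1))"
    using N \<open>r \<noteq> 0\<close> by (simp add: N_def divide_simps) (auto simp: algebra_simps)
  ultimately show ?thesis
    by (simp add: p_def)
qed

end

section \<open>Finite-dimensional lattices\<close>

text \<open>Defined by coefficients rather than by degree, so that the zero polynomial belongs to it
  even for \<open>n = 0\<close>.\<close>

definition polys_below :: "nat \<Rightarrow> 'f::{finite,field} poly set" where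
  "polys_below n = {c. \<forall>i\<ge>n. coeff c i = 0}"

lemma polys_below_0: "polys_below 0 = {0}"
  by (auto simp: polys_below_def poly_eq_iff)

text \<open>Splitting off the coefficient of \<theta>^n presents the larger space as
  \<open>q\<close> translates of the smaller one. This decomposition drives the inductions over sums
  and products.\<close>

lemma polys_below_Suc:
  "bij_betw (\<lambda>(\<epsilon>, c). c + monom \<epsilon> n) (UNIV \<times> polys_below n) (polys_below (Suc n))"
  by (rule bij_betw_byWitness[where f' = "\<lambda>c. (coeff c n, c - monom (coeff c n) n)"])
    (auto simp: polys_below_def le_Suc_eq intro: not_less_eq_eq[THEN iffD1])

lemma finite_polys_below: "finite (polys_below n)"
proof (induction n)
  case (Suc n)
  then show ?case
    by (metis bij_betw_finite finite_SigmaI finite_class.finite_UNIV polys_below_Suc)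
qed (simp add: polys_below_0)

lemma sum_polys_below_Suc:
  "(\<Sum>c\<in>polys_below (Suc n). f c) = (\<Sum>\<epsilon>\<in>UNIV. \<Sum>c\<in>polys_below n. f (c + monom \<epsilon> n))"
  by (simp add: sum.cartesian_product case_prod_unfold
      flip: sum.reindex_bij_betw[OF polys_below_Suc])

lemma prod_polys_below_Suc:
  "(\<Prod>c\<in>polys_below (Suc n). f c) = (\<Prod>\<epsilon>\<in>UNIV. \<Prod>c\<in>polys_below n. f (c + monom \<epsilon> n))"
  by (simp add: prod.cartesian_product case_prod_unfold
      flip: prod.reindex_bij_betw[OF polys_below_Suc])

lemma polys_below_degree: "polys_below n = {c. c = 0 \<or> degree c < n}"
proof safe
  fix c :: "'a poly"
  assume "c \<in> polys_below n" "\<not> degree c < n"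
  then have "lead_coeff c = 0"
    by (simp add: polys_below_def)
  then show "c = 0"
    by simp
qed (auto simp: polys_below_def intro: coeff_eq_0)

lemma polys_below_mono: "m \<le> n \<Longrightarrow> polys_below m \<subseteq> polys_below n"
  by (auto simp: polys_below_def)

lemma zero_in_polys_below: "0 \<in> polys_below n"
  by (simp add: polys_below_def)

lemma card_polys_below: "card (polys_below n :: 'f::{finite,field} poly set) = CARD('f) ^ n"
proof (induction n)
  case (Suc n)
  have "bij_betw (\<lambda>(\<epsilon>, c). c + monom \<epsilon> n) (UNIV \<times> polys_below n) (polys_below (Suc n) :: 'f poly set)"
    by (rule polys_below_Suc)
  from bij_betw_same_card[OF this] Suc show ?case
    by (simp add: card_cartesian_product)
qed (simp add: polys_below_0)

lemma monom_add_below: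
  assumes "c \<in> polys_below n"
  shows "degree (monom 1 n + c) = n" "lead_coeff (monom 1 n + c) = 1"
proof -
  have "degree (monom 1 n + c) \<le> n"
    using assms by (intro degree_le) (auto simp: polys_below_def)
  moreover have "coeff (monom 1 n + c) n = 1"
    using assms by (simp add: polys_below_def)
  ultimately show "degree (monom 1 n + c) = n" "lead_coeff (monom 1 n + c) = 1"
    using le_degree[of "monom 1 n + c" n] by (auto simp: order.antisym)
qed

text \<open>The monic polynomials of degree \<open>n\<close> are a translate of a full vector space,
  so sums over them come within reach of partial fractions.\<close>

lemma bij_monom_add_below:
  "bij_betw (\<lambda>c. monom 1 n + c) (polys_below n) {a \<in> A_plus. degree a = n}"
proof (rule bij_betw_byWitness[where f' = "\<lambda>a. a - monom 1 n"])
  show "(\<lambda>c. monom 1 n + c) ` polys_below n \<subseteq> {a \<in> A_plus. degree a = n}"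
    unfolding A_plus_def using monom_add_below by blast
  show "(\<lambda>a. a - monom 1 n) ` {a \<in> A_plus. degree a = n} \<subseteq> polys_below n"
    by (auto simp: A_plus_def polys_below_def le_less coeff_eq_0)
qed auto

definition monic_below :: "nat \<Rightarrow> 'f::{finite,field} poly set" where
  "monic_below n = {a \<in> A_plus. degree a < n}"

lemma finite_monic_below: "finite (monic_below n)"
  by (rule finite_subset[OF _ finite_polys_below[of n]]) (auto simp: monic_below_def polys_below_degree)

lemma sum_monic_below_Suc:
  "(\<Sum>a\<in>monic_below (Suc n). f a) = (\<Sum>a\<in>monic_below n. f a) + (\<Sum>c\<in>polys_below n. f (monom 1 n + c))"
proof -
  have split: "monic_below (Suc n) = monic_below n \<union> {a \<in> A_plus. degree a = n}"
    by (auto simp: monic_below_def)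
  have "finite {a \<in> A_plus. degree a = n}"
    using bij_betw_finite[OF bij_monom_add_below] finite_polys_below by blast
  with finite_monic_below have "(\<Sum>a\<in>monic_below (Suc n). f a) = (\<Sum>a\<in>monic_below n. f a) + (\<Sum>a\<in>{a \<in> A_plus. degree a = n}. f a)"
    unfolding split by (intro sum.union_disjoint) (auto simp: monic_below_def)
  then show ?thesis
    by (simp add: sum.reindex_bij_betw[OF bij_monom_add_below])
qed

lemma monic_below_0: "monic_below 0 = {}"
  by (simp add: monic_below_def)

context fq_embedding
begin

definition fq_linear :: "('f poly \<Rightarrow> 'c) \<Rightarrow> bool" where
  "fq_linear \<eta> \<longleftrightarrow> (\<forall>a b. \<eta> (a + b) = \<eta> a + \<eta> b) \<and> (\<forall>x a. \<eta> (smult x a) = emb x * \<eta> a)"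

lemma fq_linear_zero_fun: "fq_linear (\<lambda>_. 0)"
  by (simp add: fq_linear_def)

lemma fq_linear_add: "fq_linear \<eta> \<Longrightarrow> \<eta> (a + b) = \<eta> a + \<eta> b"
  by (simp add: fq_linear_def)

lemma fq_linear_zero: "fq_linear \<eta> \<Longrightarrow> \<eta> 0 = 0"
  using fq_linear_add[of \<eta> 0 0] by (metis add.right_neutral add_left_cancel)

lemma fq_linear_monom: "fq_linear \<eta> \<Longrightarrow> \<eta> (monom x n) = emb x * \<eta> (monom 1 n)"
  unfolding fq_linear_def by (metis mult.right_neutral smult_monom)

end

section \<open>The linear polynomials attached to a finite-dimensional lattice\<close>

locale fq_lattice = fq_embedding emb q for emb :: "'f::{finite,field} \<Rightarrow> 'c::field" and q +
  fixes V :: "'f poly \<Rightarrow> 'c"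
  assumes V_linear: "fq_linear V"
    and V_nonzero: "a \<noteq> 0 \<Longrightarrow> V a \<noteq> 0"
begin

text \<open>In the notation above, \<open>fq_exp n\<close> is \<open>e\<^sub>n\<close> with leading coefficient \<open>lc n\<close>, and \<open>interp \<eta> n\<close> is
  \<open>F\<^sub>n\<close> with linear coefficient \<open>alpha \<eta> n\<close>; \<open>S n\<close> is minus the coefficient of \<open>X\<^sup>q\<close> in \<open>e\<^sub>n\<close>.\<close>

abbreviation v :: "nat \<Rightarrow> 'c" where "v n \<equiv> V (monom 1 n)"

primrec fq_exp :: "nat \<Rightarrow> 'c \<Rightarrow> 'c" where
  "fq_exp 0 = (\<lambda>X. X)"
| "fq_exp (Suc n) = (\<lambda>X. fq_exp n X - fq_exp n X ^ q / fq_exp n (v n) ^ (q - 1))"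

abbreviation r :: "nat \<Rightarrow> 'c" where "r n \<equiv> fq_exp n (v n)"

primrec lc :: "nat \<Rightarrow> 'c" where
  "lc 0 = 1"
| "lc (Suc n) = - (lc n ^ q / r n ^ (q - 1))"

primrec interp :: "('f poly \<Rightarrow> 'c) \<Rightarrow> nat \<Rightarrow> 'c \<Rightarrow> 'c" where
  "interp \<eta> 0 = (\<lambda>X. 0)"
| "interp \<eta> (Suc n) = (\<lambda>X. interp \<eta> n X + (\<eta> (monom 1 n) - interp \<eta> n (v n)) / r n * fq_exp n X)"

text \<open>The coefficient of the n-th step of Newton interpolation: \<open>fq_exp n\<close>
  vanishes at the earlier lattice points, so adding a multiple of it only adjusts the value at the
  new one, \<open>v n\<close>. As \<open>fq_exp n\<close> has linear coefficient 1, the sum of these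
  numbers is the linear coefficient of the interpolation polynomial.\<close>

definition kap :: "('f poly \<Rightarrow> 'c) \<Rightarrow> nat \<Rightarrow> 'c" where
  "kap \<eta> n = (\<eta> (monom 1 n) - interp \<eta> n (v n)) / r n"

definition alpha :: "('f poly \<Rightarrow> 'c) \<Rightarrow> nat \<Rightarrow> 'c" where
  "alpha \<eta> n = (\<Sum>k<n. kap \<eta> k)"

definition S :: "nat \<Rightarrow> 'c" where
  "S n = (\<Sum>k<n. 1 / r k ^ (q - 1))"

lemma interp_Suc: "interp \<eta> (Suc n) X = interp \<eta> n X + kap \<eta> n * fq_exp n X"
  by (simp add: kap_def)

lemma alpha_0: "alpha \<eta> 0 = 0"
  by (simp add: alpha_def)

lemma alpha_Suc: "alpha \<eta> (Suc n) = alpha \<eta> n + kap \<eta> n"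
  by (simp add: alpha_def)

lemma S_Suc: "S (Suc n) = S n + 1 / r n ^ (q - 1)"
  by (simp add: S_def)

lemma fq_exp_add: "fq_exp n (X + Y) = fq_exp n X + fq_exp n Y"
  by (induction n arbitrary: X Y) (simp_all add: frob_add add_divide_distrib)

lemma fq_exp_scale: "fq_exp n (emb x * X) = emb x * fq_exp n X"
  by (induction n arbitrary: X) (simp_all add: power_mult_distrib emb_power_q algebra_simps)

lemma interp_add: "interp \<eta> n (X + Y) = interp \<eta> n X + interp \<eta> n Y"
  by (induction n arbitrary: X Y) (simp_all add: interp_Suc fq_exp_add algebra_simps del: interp.simps(2))

lemma interp_scale: "interp \<eta> n (emb x * X) = emb x * interp \<eta> n X"
  by (induction n arbitrary: X) (simp_all add: interp_Suc fq_exp_scale distrib_left mult.left_commute del: interp.simps(2))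

lemma V_add: "V (a + b) = V a + V b"
  using V_linear by (rule fq_linear_add)

lemma V_monom_add_nonzero:
  assumes "c \<in> polys_below n"
  shows "V (monom 1 n + c) \<noteq> 0"
  using monom_add_below(2)[OF assms] by (intro V_nonzero) (metis leading_coeff_0_iff zero_neq_one)

text \<open>By \<open>prod_fq\<close>, the recursion multiplies the polynomials of the
  \<open>q\<close> translates of the smaller space. Both claims are proved together because the
  division by \<open>r n ^ (q - 1)\<close> needs \<open>r n \<noteq> 0\<close>, which follows from
  the product formula and \<open>lc n \<noteq> 0\<close>.\<close>

lemma fq_exp_prod_aux:
  "lc n \<noteq> 0 \<and> (\<forall>X. fq_exp n X = lc n * (\<Prod>c\<in>polys_below n. X + V c))"
proof (induction n)
  case 0
  then show ?case
    by (simp add: polys_below_0 fq_linear_zero[OF V_linear])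
next
  case (Suc n)
  have r: "r n \<noteq> 0"
    using Suc V_monom_add_nonzero by (auto simp: finite_polys_below simp flip: V_add)
  have "fq_exp (Suc n) X = lc (Suc n) * (\<Prod>c\<in>polys_below (Suc n). X + V c)" for X
  proof -
    have "fq_exp n X + emb \<epsilon> * r n = lc n * (\<Prod>c\<in>polys_below n. X + V (c + monom \<epsilon> n))" for \<epsilon>
    proof -
      have "fq_exp n X + emb \<epsilon> * r n = fq_exp n (X + V (monom \<epsilon> n))"
        by (simp add: fq_exp_add fq_exp_scale fq_linear_monom[OF V_linear, of \<epsilon>])
      also have "\<dots> = lc n * (\<Prod>c\<in>polys_below n. X + V (c + monom \<epsilon> n))"
        using Suc by (simp add: V_add algebra_simps)
      finally show ?thesis .
    qed
    then have "fq_exp n X ^ q - r n ^ (q - 1) * fq_exp n X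
        = (\<Prod>\<epsilon>\<in>UNIV. lc n * (\<Prod>c\<in>polys_below n. X + V (c + monom \<epsilon> n)))"
      unfolding prod_fq[symmetric] by simp
    also have "\<dots> = lc n ^ q * (\<Prod>c\<in>polys_below (Suc n). X + V c)"
      by (simp add: prod.distrib q_eq prod_polys_below_Suc)
    finally have "lc n ^ q * (\<Prod>c\<in>polys_below (Suc n). X + V c)
        = fq_exp n X ^ q - r n ^ (q - 1) * fq_exp n X" ..
    then show ?thesis
      using r by (simp add: diff_divide_distrib)
  qed
  moreover have "lc (Suc n) \<noteq> 0"
    using r Suc by simp
  ultimately show ?case
    by blast
qed

lemma lc_nonzero: "lc n \<noteq> 0"
  using fq_exp_prod_aux by blast

lemma fq_exp_prod: "fq_exp n X = lc n * (\<Prod>c\<in>polys_below n. X + V c)"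
  using fq_exp_prod_aux by blast

lemma r_nonzero: "r n \<noteq> 0"
  using V_monom_add_nonzero
  by (auto simp: fq_exp_prod finite_polys_below lc_nonzero simp flip: V_add)

lemma fq_exp_nonzero:
  assumes "\<And>c. c \<in> polys_below n \<Longrightarrow> X + V c \<noteq> 0"
  shows "fq_exp n X \<noteq> 0"
  using assms by (simp add: fq_exp_prod lc_nonzero finite_polys_below)

text \<open>The factor for \<open>c = 0\<close> is \<open>1\<close>, since \<open>X / 0 = 0\<close>.\<close>

lemma fq_exp_prod_normalized: "fq_exp n X = X * (\<Prod>c\<in>polys_below n. 1 + X / V c)"
proof (induction n)
  case 0
  then show ?case
    by (simp add: polys_below_0 fq_linear_zero[OF V_linear])
next
  case (Suc n)
  let ?w = "\<lambda>\<epsilon>. emb \<epsilon> * v n"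
  have V: "V (c + monom \<epsilon> n) = V c + ?w \<epsilon>" for c \<epsilon>
    using fq_linear_monom[OF V_linear, of \<epsilon> n] by (simp add: V_add)
  have factor: "(\<Prod>c\<in>polys_below n. 1 + X / V (c + monom \<epsilon> n))
      = (fq_exp n X + emb \<epsilon> * r n) / (emb \<epsilon> * r n)" if "\<epsilon> \<noteq> 0" for \<epsilon>
  proof -
    have "V (c + monom \<epsilon> n) \<noteq> 0" if "c \<in> polys_below n" for c
    proof (rule V_nonzero)
      have "coeff (c + monom \<epsilon> n) n = \<epsilon>"
        using that by (simp add: polys_below_def)
      then show "c + monom \<epsilon> n \<noteq> 0"
        using \<open>\<epsilon> \<noteq> 0\<close> by (metis coeff_0)
    qed
    then have "(\<Prod>c\<in>polys_below n. 1 + X / V (c + monom \<epsilon> n))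
        = (\<Prod>c\<in>polys_below n. (X + ?w \<epsilon> + V c) / (?w \<epsilon> + V c))"
      by (intro prod.cong) (simp_all add: V field_simps)
    also have "\<dots> = fq_exp n (X + ?w \<epsilon>) / fq_exp n (?w \<epsilon>)"
      by (simp add: prod_dividef fq_exp_prod lc_nonzero)
    finally show ?thesis
      by (simp add: fq_exp_add fq_exp_scale)
  qed
  have "X * (\<Prod>c\<in>polys_below (Suc n). 1 + X / V c)
      = fq_exp n X * (\<Prod>\<epsilon>\<in>UNIV - {0}. \<Prod>c\<in>polys_below n. 1 + X / V (c + monom \<epsilon> n))"
    unfolding prod_polys_below_Suc by (subst prod.remove[of UNIV 0]) (simp_all add: Suc mult.assoc)
  also have "\<dots> = fq_exp (Suc n) X"
    using prod_fq_normalized[OF r_nonzero, of "fq_exp n X"] by (simp add: factor)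
  finally show ?case ..
qed

text \<open>\<open>power_sum_fq\<close> is the case of a one-dimensional space, to which the induction
  step of \<open>power_sum\<close> reduces.\<close>

lemma power_sum_fq:
  assumes "1 \<le> l" "l \<le> q" "\<rho> \<noteq> 0" and nz: "\<And>\<epsilon>. Y + emb \<epsilon> * \<rho> \<noteq> 0"
  shows "(\<Sum>\<epsilon>\<in>UNIV. ((B + emb \<epsilon> * k) / (Y + emb \<epsilon> * \<rho>)) ^ l)
    = (k / \<rho> + (B - k / \<rho> * Y) / (Y - Y ^ q / \<rho> ^ (q - 1))) ^ l - (k / \<rho>) ^ l"
proof -
  define s where "s = k / \<rho>"
  define p where "p = 1 / (Y - Y ^ q / \<rho> ^ (q - 1))"
  \<comment> \<open>For \<open>j = 0\<close> the sum is q = 0 instead of \<open>p ^ 0\<close>. This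
    exception is the source of the subtracted l-th power.\<close>
  have p: "(\<Sum>\<epsilon>\<in>UNIV. 1 / (Y + emb \<epsilon> * \<rho>) ^ j) = (if j = 0 then 0 else p ^ j)" if "j \<le> l" for j
    using sum_fq_inverse_powers[of j \<rho> Y] assms that of_nat_q by (auto simp: p_def q_eq)
  have "((B + emb \<epsilon> * k) / (Y + emb \<epsilon> * \<rho>)) ^ l
      = (\<Sum>j\<le>l. of_nat (l choose j) * (B - s * Y) ^ j * s ^ (l - j) * (1 / (Y + emb \<epsilon> * \<rho>) ^ j))" for \<epsilon>
  proof -
    \<comment> \<open>Splitting off the constant \<open>s\<close> frees the numerator of
      \<epsilon>.\<close>
    have "(B + emb \<epsilon> * k) / (Y + emb \<epsilon> * \<rho>) = (B - s * Y) / (Y + emb \<epsilon> * \<rho>) + s"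
    proof -
      have "B + emb \<epsilon> * k = (B - s * Y) + s * (Y + emb \<epsilon> * \<rho>)"
        using \<open>\<rho> \<noteq> 0\<close> by (simp add: s_def field_simps)
      then have "(B + emb \<epsilon> * k) / (Y + emb \<epsilon> * \<rho>)
          = (B - s * Y) / (Y + emb \<epsilon> * \<rho>) + s * (Y + emb \<epsilon> * \<rho>) / (Y + emb \<epsilon> * \<rho>)"
        by (simp only: add_divide_distrib)
      then show ?thesis
        using nz[of \<epsilon>] by simp
    qed
    then show ?thesis
      by (simp add: binomial_ring power_divide)
  qed
  then have "(\<Sum>\<epsilon>\<in>UNIV. ((B + emb \<epsilon> * k) / (Y + emb \<epsilon> * \<rho>)) ^ l)
      = (\<Sum>j\<le>l. of_nat (l choose j) * (B - s * Y) ^ j * s ^ (l - j) * (\<Sum>\<epsilon>\<in>UNIV. 1 / (Y + emb \<epsilon> * \<rho>) ^ j))"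
    by (simp add: sum_distrib_left sum.swap[of _ "{..l}"])
  also have "\<dots> = (\<Sum>j\<le>l. of_nat (l choose j) * ((B - s * Y) * p) ^ j * s ^ (l - j) - (if j = 0 then s ^ l else 0))"
    by (intro sum.cong) (auto simp: p power_mult_distrib)
  also have "\<dots> = ((B - s * Y) * p + s) ^ l - s ^ l"
    by (simp add: binomial_ring sum_subtractf)
  finally show ?thesis
    by (simp add: s_def p_def add.commute)
qed

text \<open>Partial fractions of a shifted interpolation polynomial over \<open>fq_exp n\<close>.
  The free constant \<open>H\<close> lets the induction absorb the value of \<eta> at the new basis
  element. It also makes one formula serve the sums of \<eta>/V and, with \<eta> = 0 and H = 1, the
  sums of inverse powers.\<close>

lemma power_sum:
  assumes l: "1 \<le> l" "l \<le> q" and \<eta>: "fq_linear \<eta>"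
    and nz: "\<And>c. c \<in> polys_below n \<Longrightarrow> X + V c \<noteq> 0"
  shows "(\<Sum>c\<in>polys_below n. ((H + \<eta> c) / (X + V c)) ^ l)
    = (alpha \<eta> n + (H - interp \<eta> n X) / fq_exp n X) ^ l - alpha \<eta> n ^ l"
  using nz
proof (induction n arbitrary: H X)
  case 0
  then show ?case
    using l by (simp add: polys_below_0 fq_linear_zero[OF \<eta>] fq_linear_zero[OF V_linear] alpha_0 zero_power)
next
  case (Suc n)
  let ?Y = "fq_exp n X" and ?a = "alpha \<eta> n" and ?w = "\<lambda>\<epsilon>. emb \<epsilon> * v n"
  have below: "c + monom \<epsilon> n \<in> polys_below (Suc n)" if "c \<in> polys_below n" for c \<epsilon>
    using that by (auto simp: polys_below_def)
  have nz': "X + ?w \<epsilon> + V c \<noteq> 0" if "c \<in> polys_below n" for c \<epsilon>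
    using Suc.prems[OF below[OF that, of \<epsilon>]]
    by (simp add: V_add fq_linear_monom[OF V_linear, of \<epsilon> n] add_ac)
  have split: "\<eta> (c + monom \<epsilon> n) = \<eta> c + emb \<epsilon> * \<eta> (monom 1 n)" "V (c + monom \<epsilon> n) = V c + ?w \<epsilon>" for c \<epsilon>
    using fq_linear_monom[OF V_linear, of \<epsilon> n] fq_linear_monom[OF \<eta>, of \<epsilon> n]
    by (simp_all add: V_add fq_linear_add[OF \<eta>])
  have Y: "?Y + emb \<epsilon> * r n \<noteq> 0" for \<epsilon>
    using fq_exp_nonzero[OF nz', of n \<epsilon>] by (simp add: fq_exp_add fq_exp_scale)
  have a: "?a = alpha \<eta> (Suc n) - kap \<eta> n"
    by (simp add: alpha_Suc)
  \<comment> \<open>\<open>k\<close> and \<open>B\<close> bring the result of the induction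
    hypothesis into the shape that \<open>power_sum_fq\<close> sums; \<open>k / r n\<close> is the
    new \<open>alpha\<close>.\<close>
  define k where "k = alpha \<eta> (Suc n) * r n"
  define B where "B = ?a * ?Y + H - interp \<eta> n X"
  have k: "k = ?a * r n + \<eta> (monom 1 n) - interp \<eta> n (v n)"
    using r_nonzero by (simp add: k_def alpha_Suc kap_def field_simps)
  have step: "?a + (H + emb \<epsilon> * \<eta> (monom 1 n) - interp \<eta> n (X + ?w \<epsilon>)) / fq_exp n (X + ?w \<epsilon>)
      = (B + emb \<epsilon> * k) / (?Y + emb \<epsilon> * r n)" for \<epsilon>
  proof -
    have "B + emb \<epsilon> * k = ?a * (?Y + emb \<epsilon> * r n)
        + (H + emb \<epsilon> * \<eta> (monom 1 n) - (interp \<eta> n X + emb \<epsilon> * interp \<eta> n (v n)))"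
      by (simp add: B_def k algebra_simps)
    then show ?thesis
      using Y[of \<epsilon>] by (simp add: fq_exp_add fq_exp_scale interp_add interp_scale add_divide_distrib)
  qed
  have "(\<Sum>c\<in>polys_below (Suc n). ((H + \<eta> c) / (X + V c)) ^ l)
      = (\<Sum>\<epsilon>\<in>UNIV. \<Sum>c\<in>polys_below n.
          (((H + emb \<epsilon> * \<eta> (monom 1 n)) + \<eta> c) / ((X + ?w \<epsilon>) + V c)) ^ l)"
    by (simp add: sum_polys_below_Suc split add_ac)
  also have "\<dots> = (\<Sum>\<epsilon>\<in>UNIV. ((B + emb \<epsilon> * k) / (?Y + emb \<epsilon> * r n)) ^ l - ?a ^ l)"
    by (simp add: Suc.IH[OF nz'] step)
  \<comment> \<open>The constant \<open>?a ^ l\<close> is subtracted \<open>q\<close> times, which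
    is zero.\<close>
  also have "\<dots> = (\<Sum>\<epsilon>\<in>UNIV. ((B + emb \<epsilon> * k) / (?Y + emb \<epsilon> * r n)) ^ l)"
    using of_nat_q by (simp add: sum_subtractf q_eq)
  also have "\<dots> = (k / r n + (B - k / r n * ?Y) / fq_exp (Suc n) X) ^ l - (k / r n) ^ l"
    using power_sum_fq[OF l r_nonzero Y] by simp
  also have "k / r n = alpha \<eta> (Suc n)"
    using r_nonzero by (simp add: k_def)
  also have "B - alpha \<eta> (Suc n) * ?Y = H - interp \<eta> (Suc n) X"
    by (simp only: interp_Suc B_def alpha_Suc) (simp add: algebra_simps)
  finally show ?case .
qed

text \<open>The sum telescopes: in \<open>power_sum\<close> with \<open>X = v n\<close> and
  \<open>H = \<eta> (monom 1 n)\<close> the fraction is \<open>kap \<eta> n\<close>, so degree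
  \<open>n\<close> contributes the difference of consecutive powers of \<open>alpha\<close>.\<close>

lemma sum_monic_powers:
  assumes l: "1 \<le> l" "l \<le> q" and \<eta>: "fq_linear \<eta>"
  shows "(\<Sum>a\<in>monic_below n. (\<eta> a / V a) ^ l) = alpha \<eta> n ^ l"
proof (induction n)
  case 0
  then show ?case
    using l by (simp add: monic_below_0 alpha_0 zero_power)
next
  case (Suc n)
  have "v n + V c \<noteq> 0" if "c \<in> polys_below n" for c
    using V_monom_add_nonzero[OF that] by (simp add: V_add)
  from power_sum[OF l \<eta> this, of n "\<eta> (monom 1 n)"] Suc show ?case
    by (simp add: sum_monic_below_Suc V_add fq_linear_add[OF \<eta>] alpha_Suc kap_def)
qed

lemma interp_zero_fun: "interp (\<lambda>_. 0) n X = 0"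
  by (induction n arbitrary: X) auto

lemma alpha_zero_fun: "alpha (\<lambda>_. 0) n = 0"
  by (simp add: alpha_def kap_def interp_zero_fun)

text \<open>The case \<eta> = 0, H = 1 of \<open>power_sum\<close>; it links \<open>S\<close> to the
  sum that defines g.\<close>

lemma sum_monic_inverse_powers: "(\<Sum>a\<in>monic_below n. (1 / V a) ^ (q - 1)) = S n"
proof (induction n)
  case 0
  then show ?case
    by (simp add: monic_below_0 S_def)
next
  case (Suc n)
  have "v n + V c \<noteq> 0" if "c \<in> polys_below n" for c
    using V_monom_add_nonzero[OF that] by (simp add: V_add)
  from power_sum[OF _ _ fq_linear_zero_fun this, where H = 1 and l = "q - 1"] Suc show ?case
    using q_ge_2
    by (simp add: sum_monic_below_Suc V_add S_Suc alpha_zero_fun interp_zero_fun power_divide zero_power)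
qed

end

section \<open>Lattices stable under a module structure\<close>

text \<open>Two values of \<gamma> occur: 0 for the period lattice, where \<theta> acts by
  multiplication, and 1 for the values of the exponential, where \<theta> acts through the Carlitz
  module.\<close>

locale fq_module_lattice = fq_lattice emb q V
  for emb :: "'f::{finite,field} \<Rightarrow> 'c::field" and q and V +
  fixes \<theta> \<gamma> :: 'c
  assumes V_shift: "V (monom 1 (Suc n)) = \<theta> * v n + \<gamma> * v n ^ q"
begin

definition \<rho> :: "nat \<Rightarrow> 'c" where "\<rho> n = r n ^ (q - 1)"

text \<open>The value forced by the coefficient of X^q in \<open>fq_exp_shift\<close>.\<close>

definition g_coeff :: "nat \<Rightarrow> 'c" where
  "g_coeff n = \<gamma> - \<theta> ^ q * S (Suc n) + \<theta> * S n"

text \<open>The recursion compares the coefficients of Y^(q^3) in the induction step of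
  \<open>fq_exp_shift\<close>.\<close>

primrec D_coeff :: "nat \<Rightarrow> 'c" where
  "D_coeff 0 = - (\<gamma> ^ q / \<rho> 0)"
| "D_coeff (Suc n) = D_coeff n ^ q * (\<rho> n ^ q) ^ q / \<rho> (Suc n)"

declare fq_exp.simps(2) [simp del] interp.simps(2) [simp del] lc.simps(2) [simp del] D_coeff.simps(2) [simp del]

definition phi :: "nat \<Rightarrow> 'c \<Rightarrow> 'c" where
  "phi n Y = \<theta> * Y + g_coeff n * Y ^ q + D_coeff n * (Y ^ q) ^ q"

lemma rho_nonzero: "\<rho> n \<noteq> 0"
  using r_nonzero by (simp add: \<rho>_def)

lemma r_power_q: "r n ^ q = \<rho> n * r n"
  unfolding \<rho>_def by (rule power_q_minus_one)

lemma S_Suc_rho: "S (Suc n) = S n + 1 / \<rho> n"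
  by (simp add: S_Suc \<rho>_def)

lemma fq_exp_Suc: "fq_exp (Suc n) X = fq_exp n X - fq_exp n X ^ q / \<rho> n"
  by (simp add: fq_exp.simps(2) \<rho>_def)

lemma g_coeff_Suc: "g_coeff (Suc n) = g_coeff n - \<theta> ^ q / \<rho> (Suc n) + \<theta> / \<rho> n"
  by (simp add: g_coeff_def S_Suc_rho algebra_simps)

lemmas frob_simps = frob_add frob_diff frob_minus power_mult_distrib power_divide

text \<open>The coefficients are defined so that in the induction step both sides can differ only by
  a multiple \<open>E\<close> of Y^(q^2). One nonzero point where both sides vanish then forces
  \<open>E = 0\<close>.\<close>

lemma fq_exp_shift: "fq_exp (Suc n) (\<theta> * X + \<gamma> * X ^ q) = phi n (fq_exp n X)"
proof (induction n arbitrary: X)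
  case 0
  have "S (Suc 0) = 1 / \<rho> 0" "S 0 = 0"
    by (simp_all add: S_Suc_rho) (simp_all add: S_def)
  then show ?case
    by (simp add: phi_def g_coeff_def fq_exp_Suc frob_simps) (simp add: algebra_simps add_divide_distrib)
next
  case (Suc n)
  define E where "E = D_coeff n - g_coeff n ^ q / \<rho> (Suc n) - D_coeff (Suc n) + g_coeff (Suc n) / \<rho> n ^ q"
  have expand: "phi n Y - phi n Y ^ q / \<rho> (Suc n) = phi (Suc n) (Y - Y ^ q / \<rho> n) + E * (Y ^ q) ^ q" for Y
  proof -
    have D: "D_coeff (Suc n) / (\<rho> n ^ q) ^ q = D_coeff n ^ q / \<rho> (Suc n)"
      using rho_nonzero[of n] by (simp add: D_coeff.simps(2))
    have L: "phi n Y - phi n Y ^ q / \<rho> (Suc n) = \<theta> * Y + (g_coeff n - \<theta> ^ q / \<rho> (Suc n)) * Y ^ q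
        + (D_coeff n - g_coeff n ^ q / \<rho> (Suc n)) * (Y ^ q) ^ q
        - D_coeff n ^ q / \<rho> (Suc n) * ((Y ^ q) ^ q) ^ q"
      unfolding phi_def frob_simps by (simp add: algebra_simps add_divide_distrib)
    have R: "phi (Suc n) (Y - Y ^ q / \<rho> n) = \<theta> * Y + (g_coeff (Suc n) - \<theta> / \<rho> n) * Y ^ q
        + (D_coeff (Suc n) - g_coeff (Suc n) / \<rho> n ^ q) * (Y ^ q) ^ q
        - D_coeff (Suc n) / (\<rho> n ^ q) ^ q * ((Y ^ q) ^ q) ^ q"
      unfolding phi_def frob_simps by (simp add: algebra_simps)
    show ?thesis
      unfolding L R D E_def by (simp add: g_coeff_Suc algebra_simps)
  qed
  have phi_r: "phi n (r n) = r (Suc n)"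
    unfolding V_shift[of n] by (rule Suc.IH[symmetric])
  \<comment> \<open>The point is \<open>Y = r n\<close>: it is a zero of Y - Y^q / \<rho> n, and
    \<open>phi n\<close> maps it to \<open>r (Suc n)\<close>, a zero of the corresponding polynomial
    of the next level.\<close>
  have "r n - r n ^ q / \<rho> n = 0" "r (Suc n) - r (Suc n) ^ q / \<rho> (Suc n) = 0"
    using rho_nonzero r_power_q by simp_all
  moreover have "phi (Suc n) 0 = 0"
    using q_pos by (simp add: phi_def zero_power)
  ultimately have "E * (r n ^ q) ^ q = 0"
    using expand[of "r n"] unfolding phi_r by simp
  then have "E = 0"
    using r_nonzero by simp
  have "fq_exp (Suc (Suc n)) (\<theta> * X + \<gamma> * X ^ q) = phi n (fq_exp n X) - phi n (fq_exp n X) ^ q / \<rho> (Suc n)"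
    by (simp only: fq_exp_Suc[of "Suc n"] Suc.IH)
  also have "\<dots> = phi (Suc n) (fq_exp (Suc n) X)"
    unfolding expand \<open>E = 0\<close> by (simp add: fq_exp_Suc)
  finally show ?case .
qed

lemma r_Suc: "r (Suc n) = phi n (r n)"
  unfolding V_shift[of n] by (rule fq_exp_shift)

lemma D_coeff_Suc: "D_coeff (Suc n) * \<rho> (Suc n) = D_coeff n ^ q * (\<rho> n ^ q) ^ q"
  using rho_nonzero[of "Suc n"] by (simp add: D_coeff.simps(2))

text \<open>Meant for the period lattice, where \<open>phi n\<close> thus has only its terms in Y
  and Y^q.\<close>

lemma D_coeff_eq_0:
  assumes "\<gamma> = 0"
  shows "D_coeff n = 0"
proof (induction n)
  case 0
  have "\<gamma> ^ q = 0"
    using assms q_pos by (simp only: zero_power)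
  then show ?case
    by (simp only: D_coeff.simps(1)) simp
next
  case (Suc n)
  then show ?case
    using q_pos by (simp add: D_coeff.simps(2) zero_power)
qed

end

section \<open>Interpolation on a lattice with Carlitz action\<close>

locale carlitz_lattice = fq_module_lattice emb q V \<theta> 1
  for emb :: "'f::{finite,field} \<Rightarrow> 'c::field" and q V \<theta>
begin

text \<open>The linear coefficient of the shifted interpolation polynomial minus \<open>t\<close>
  times the unshifted one.\<close>

definition a_coeff :: "('f poly \<Rightarrow> 'c) \<Rightarrow> 'c \<Rightarrow> nat \<Rightarrow> 'c" where
  "a_coeff \<eta> t n = \<theta> * alpha \<eta> (Suc n) - t * alpha \<eta> n"

text \<open>The recursion is the comparison of the coefficients of (e_n)^q in the induction step of
  \<open>interp_shift_and_b\<close>.\<close>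

primrec b_coeff :: "('f poly \<Rightarrow> 'c) \<Rightarrow> 'c \<Rightarrow> nat \<Rightarrow> 'c" where
  "b_coeff \<eta> t 0 = kap \<eta> 0"
| "b_coeff \<eta> t (Suc n) = b_coeff \<eta> t n + kap \<eta> (Suc n) * g_coeff n + a_coeff \<eta> t (Suc n) / \<rho> n"

declare b_coeff.simps(2) [simp del]

lemma interp_v:
  "interp \<eta> (Suc n) (v n) = \<eta> (monom 1 n)"
  using r_nonzero[of n] by (simp add: interp_Suc kap_def)

text \<open>As in \<open>fq_exp_shift\<close>, the induction step leaves one unknown coefficient
  \<open>E\<close>, of (e_n)^(q^2), which is shown to vanish by evaluation at a point. Written out,
  \<open>E = 0\<close> is the closed form of \<open>b_coeff\<close>, so both claims come from the
  same argument.\<close>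

lemma interp_shift_and_b:
  assumes \<eta>: "\<And>n. \<eta> (monom 1 (Suc n)) = t * \<eta> (monom 1 n)"
  shows "interp \<eta> (Suc n) (\<theta> * X + X ^ q) = t * interp \<eta> n X + a_coeff \<eta> t n * fq_exp n X + b_coeff \<eta> t n * fq_exp n X ^ q"
    and "b_coeff \<eta> t (Suc n) = - (kap \<eta> (Suc n) * D_coeff n * \<rho> n ^ q)"
proof -
  let ?a = "a_coeff \<eta> t" and ?b = "b_coeff \<eta> t" and ?k = "kap \<eta>"
  have shift: "fq_exp (Suc n) (\<theta> * X + X ^ q) = phi n (fq_exp n X)" for n X
    using fq_exp_shift[of n X] by simp
  have vs: "v (Suc n) = \<theta> * v n + v n ^ q" for n
    using V_shift[of n] by simp
  have b: "?b (Suc n) = - (?k (Suc n) * D_coeff n * \<rho> n ^ q)"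
    and IS: "interp \<eta> (Suc (Suc n)) (\<theta> * X + X ^ q)
      = t * interp \<eta> (Suc n) X + ?a (Suc n) * fq_exp (Suc n) X + ?b (Suc n) * fq_exp (Suc n) X ^ q"
    if IH: "\<And>X. interp \<eta> (Suc n) (\<theta> * X + X ^ q) = t * interp \<eta> n X + ?a n * fq_exp n X + ?b n * fq_exp n X ^ q"
    for n X
  proof -
    define E where "E = ?k (Suc n) * D_coeff n + ?b (Suc n) / \<rho> n ^ q"
    have expand: "interp \<eta> (Suc (Suc n)) (\<theta> * X + X ^ q)
      = t * interp \<eta> (Suc n) X + ?a (Suc n) * fq_exp (Suc n) X + ?b (Suc n) * fq_exp (Suc n) X ^ q
        + E * (fq_exp n X ^ q) ^ q" for X
    proof -
      let ?Y = "fq_exp n X"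
      have a: "?a (Suc n) = ?a n + ?k (Suc n) * \<theta> - t * ?k n"
        by (simp add: a_coeff_def alpha_Suc algebra_simps)
      have L: "interp \<eta> (Suc (Suc n)) (\<theta> * X + X ^ q)
          = t * interp \<eta> n X + ?a n * ?Y + ?b n * ?Y ^ q + ?k (Suc n) * phi n ?Y"
        unfolding interp_Suc[of \<eta> "Suc n"] IH shift by simp
      have R: "t * interp \<eta> (Suc n) X + ?a (Suc n) * fq_exp (Suc n) X + ?b (Suc n) * fq_exp (Suc n) X ^ q
          = t * (interp \<eta> n X + ?k n * ?Y) + ?a (Suc n) * ?Y - ?a (Suc n) / \<rho> n * ?Y ^ q
            + ?b (Suc n) * ?Y ^ q - ?b (Suc n) / \<rho> n ^ q * (?Y ^ q) ^ q"
        unfolding interp_Suc fq_exp_Suc frob_simps by (simp add: algebra_simps)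
      have a': "?a (Suc n) / \<rho> n = ?b (Suc n) - ?b n - ?k (Suc n) * g_coeff n"
        by (simp add: b_coeff.simps(2))
      show ?thesis
        unfolding L R a' unfolding E_def phi_def a by (simp add: algebra_simps)
    qed
    \<comment> \<open>At \<open>v n\<close> the interpolated values match by the assumption on
      \<eta>, and \<open>fq_exp (Suc n)\<close> vanishes, so only the term with \<open>E\<close>
      remains.\<close>
    have "interp \<eta> (Suc (Suc n)) (v (Suc n)) = t * interp \<eta> (Suc n) (v n)"
      unfolding interp_v by (rule \<eta>)
    moreover have "fq_exp (Suc n) (v n) = 0"
      using r_power_q[of n] rho_nonzero[of n] by (simp add: fq_exp_Suc)
    ultimately have "E * (r n ^ q) ^ q = 0"
      using expand[of "v n"] q_pos unfolding vs[symmetric] by (simp add: zero_power)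
    then have E: "E = 0"
      using r_nonzero by simp
    then show "?b (Suc n) = - (?k (Suc n) * D_coeff n * \<rho> n ^ q)"
      using rho_nonzero[of n] unfolding E_def by (simp add: field_simps eq_neg_iff_add_eq_0)
    show "interp \<eta> (Suc (Suc n)) (\<theta> * X + X ^ q)
      = t * interp \<eta> (Suc n) X + ?a (Suc n) * fq_exp (Suc n) X + ?b (Suc n) * fq_exp (Suc n) X ^ q"
      using expand[of X] E by simp
  qed
  have all: "interp \<eta> (Suc n) (\<theta> * X + X ^ q) = t * interp \<eta> n X + ?a n * fq_exp n X + ?b n * fq_exp n X ^ q" for n X
  proof (induction n arbitrary: X)
    case 0
    then show ?case
      by (simp add: interp_Suc a_coeff_def alpha_def kap_def algebra_simps)
  next
    case (Suc n)
    show ?case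
      by (rule IS[OF Suc])
  qed
  then show "interp \<eta> (Suc n) (\<theta> * X + X ^ q) = t * interp \<eta> n X + ?a n * fq_exp n X + ?b n * fq_exp n X ^ q"
    by blast
  show "?b (Suc n) = - (?k (Suc n) * D_coeff n * \<rho> n ^ q)"
    by (rule b[OF all])
qed

lemmas b_coeff_Suc = interp_shift_and_b(2)

text \<open>Both \<open>interp (\<eta>\<^sup>q)\<close> and \<open>(interp \<eta>)\<^sup>q\<close> take the values \<open>\<eta>\<^sup>q\<close>, so their difference is a multiple
  of \<open>fq_exp\<close>.\<close>

lemma interp_frob:
  "interp (\<lambda>c. \<eta> c ^ q) n X - interp \<eta> n X ^ q = alpha (\<lambda>c. \<eta> c ^ q) n * fq_exp n X"
  "alpha (\<lambda>c. \<eta> c ^ q) (Suc n) = kap \<eta> n ^ q * \<rho> n"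
proof -
  let ?\<eta> = "\<lambda>c. \<eta> c ^ q"
  \<comment> \<open>The first claim at the point \<open>v n\<close> yields the second for the same
    \<open>n\<close>, which in turn is used in the induction step of the first.\<close>
  have key: "alpha ?\<eta> (Suc n) = kap \<eta> n ^ q * \<rho> n"
    if IH: "\<And>X. interp ?\<eta> n X - interp \<eta> n X ^ q = alpha ?\<eta> n * fq_exp n X" for n
  proof -
    have "kap \<eta> n * r n = \<eta> (monom 1 n) - interp \<eta> n (v n)"
      "kap ?\<eta> n * r n = \<eta> (monom 1 n) ^ q - interp ?\<eta> n (v n)"
      using r_nonzero[of n] by (simp_all add: kap_def)
    moreover from this(1) have "(kap \<eta> n * r n) ^ q = \<eta> (monom 1 n) ^ q - interp \<eta> n (v n) ^ q"
      by (simp only: frob_diff)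
    ultimately have "(kap \<eta> n * r n) ^ q = (kap ?\<eta> n + alpha ?\<eta> n) * r n"
      using IH[of "v n", symmetric] by (simp add: distrib_right)
    then have "(kap \<eta> n ^ q * \<rho> n) * r n = alpha ?\<eta> (Suc n) * r n"
      by (simp only: power_mult_distrib r_power_q alpha_Suc) (simp add: algebra_simps)
    then show ?thesis
      using r_nonzero[of n] by simp
  qed
  have all: "interp ?\<eta> n X - interp \<eta> n X ^ q = alpha ?\<eta> n * fq_exp n X" for n X
  proof (induction n arbitrary: X)
    case 0
    then show ?case
      using q_pos by (simp add: alpha_0 zero_power)
  next
    case (Suc n)
    have "alpha ?\<eta> (Suc n) / \<rho> n = kap \<eta> n ^ q"
      using key[OF Suc] rho_nonzero[of n] by simp
    then have R: "alpha ?\<eta> (Suc n) * fq_exp (Suc n) X = alpha ?\<eta> (Suc n) * fq_exp n X - kap \<eta> n ^ q * fq_exp n X ^ q"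
      by (simp add: fq_exp_Suc right_diff_distrib flip: times_divide_eq_left)
    have L: "interp ?\<eta> (Suc n) X - interp \<eta> (Suc n) X ^ q
        = (interp ?\<eta> n X - interp \<eta> n X ^ q) + kap ?\<eta> n * fq_exp n X - kap \<eta> n ^ q * fq_exp n X ^ q"
      unfolding interp_Suc frob_simps by (simp add: algebra_simps)
    show ?case
      unfolding L R Suc by (simp add: alpha_Suc algebra_simps)
  qed
  then show "interp ?\<eta> n X - interp \<eta> n X ^ q = alpha ?\<eta> n * fq_exp n X"
    by blast
  show "alpha ?\<eta> (Suc n) = kap \<eta> n ^ q * \<rho> n"
    by (rule key[OF all])
qed

lemmas alpha_frob_Suc = interp_frob(2)

text \<open>In terms of \<open>interp_frob\<close> this says that the coefficient of (e_n)^(q^2)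
  vanishes in the shift formula for \<eta>^q. It is derived from the closed form of
  \<open>b_coeff\<close> and the recursion of \<open>D_coeff\<close>.\<close>

lemma b_coeff_frob:
  assumes \<eta>: "\<And>n. \<eta> (monom 1 (Suc n)) = t * \<eta> (monom 1 n)"
  shows "b_coeff \<eta> t n ^ q = - (alpha (\<lambda>c. \<eta> c ^ q) (Suc n) * D_coeff n)"
proof (cases n)
  case 0
  then show ?thesis
    using rho_nonzero[of 0] by (simp add: alpha_frob_Suc)
next
  case (Suc m)
  have "b_coeff \<eta> t (Suc m) ^ q = - (kap \<eta> (Suc m) ^ q * (D_coeff m ^ q * (\<rho> m ^ q) ^ q))"
    unfolding b_coeff_Suc[OF \<eta>] frob_simps by (simp add: mult_ac)
  also have "\<dots> = - (alpha (\<lambda>c. \<eta> c ^ q) (Suc (Suc m)) * D_coeff (Suc m))"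
    unfolding alpha_frob_Suc D_coeff_Suc[symmetric] by (simp add: mult_ac)
  finally show ?thesis
    by (simp add: Suc)
qed

text \<open>The companion of \<open>b_coeff_frob\<close> for the coefficient of (e_n)^q: the
  contributions are \<open>g_coeff\<close> from \<open>phi n\<close> and the q-th power of
  \<open>a_coeff\<close> from the Frobenius twist.\<close>

lemma b_coeff_frob_eq:
  assumes \<eta>: "\<And>n. \<eta> (monom 1 (Suc n)) = t * \<eta> (monom 1 n)"
    and \<eta>0: "\<eta> (monom 1 0) = 1"
  shows "b_coeff (\<lambda>c. \<eta> c ^ q) (t ^ q) n
    = alpha (\<lambda>c. \<eta> c ^ q) (Suc n) * g_coeff n + a_coeff \<eta> t n ^ q"
proof (induction n)
  case 0
  have "v 0 ^ q = \<rho> 0 * v 0" "v 0 \<noteq> 0" "S 0 = 0"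
    using r_power_q[of 0] r_nonzero[of 0] by (simp_all add: S_def)
  then show ?case
    using \<eta>0 rho_nonzero[of 0]
    by (simp add: kap_def alpha_def g_coeff_def S_Suc_rho a_coeff_def frob_simps field_simps)
next
  case (Suc n)
  let ?\<eta> = "\<lambda>c. \<eta> c ^ q"
  have "a_coeff \<eta> t (Suc n) = a_coeff \<eta> t n + \<theta> * kap \<eta> (Suc n) - t * kap \<eta> n"
    by (simp add: a_coeff_def alpha_Suc algebra_simps)
  then have "a_coeff \<eta> t (Suc n) ^ q = a_coeff \<eta> t n ^ q + \<theta> ^ q * kap \<eta> (Suc n) ^ q - t ^ q * kap \<eta> n ^ q"
    by (simp add: frob_simps)
  moreover have "kap \<eta> (Suc n) ^ q = alpha ?\<eta> (Suc (Suc n)) / \<rho> (Suc n)"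
    "kap \<eta> n ^ q = alpha ?\<eta> (Suc n) / \<rho> n"
    using rho_nonzero by (simp_all add: alpha_frob_Suc)
  moreover have "kap ?\<eta> (Suc n) = alpha ?\<eta> (Suc (Suc n)) - alpha ?\<eta> (Suc n)"
    by (simp add: alpha_Suc)
  ultimately have
    a: "a_coeff \<eta> t (Suc n) ^ q = a_coeff \<eta> t n ^ q + \<theta> ^ q * (alpha ?\<eta> (Suc (Suc n)) / \<rho> (Suc n))
      - t ^ q * (alpha ?\<eta> (Suc n) / \<rho> n)"
    and k: "kap ?\<eta> (Suc n) = alpha ?\<eta> (Suc (Suc n)) - alpha ?\<eta> (Suc n)"
    by simp_all
  show ?case
    unfolding b_coeff.simps Suc a k g_coeff_Suc
    by (simp add: a_coeff_def[of "\<lambda>c. \<eta> c ^ q"] algebra_simps diff_divide_distrib)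
qed

text \<open>The q-th power of \<open>b_coeff\<close> for \<eta>^q is computed in two ways, by
  \<open>b_coeff_frob\<close> and by \<open>b_coeff_frob_eq\<close>.\<close>

lemma recurrence:
  assumes \<eta>: "\<And>n. \<eta> (monom 1 (Suc n)) = t * \<eta> (monom 1 n)"
    and \<eta>0: "\<eta> (monom 1 0) = 1"
  shows "- (alpha (\<lambda>c. (\<eta> c ^ q) ^ q) (Suc n) * D_coeff n)
    = alpha (\<lambda>c. \<eta> c ^ q) (Suc n) ^ q * g_coeff n ^ q
      + ((\<theta> * alpha \<eta> (Suc n) - t * alpha \<eta> n) ^ q) ^ q"
proof -
  have \<eta>': "\<eta> (monom 1 (Suc n)) ^ q = t ^ q * \<eta> (monom 1 n) ^ q" for n
    by (simp add: \<eta> power_mult_distrib)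
  have "- (alpha (\<lambda>c. (\<eta> c ^ q) ^ q) (Suc n) * D_coeff n) = b_coeff (\<lambda>c. \<eta> c ^ q) (t ^ q) n ^ q"
    using b_coeff_frob[of "\<lambda>c. \<eta> c ^ q", OF \<eta>'] by simp
  then show ?thesis
    unfolding b_coeff_frob_eq[OF assms] frob_simps a_coeff_def by simp
qed

text \<open>A second closed form, to be equated with the one of \<open>interp_shift_and_b\<close>.
  When \<open>alpha\<close> tends to h, its limit is hg.\<close>

lemma b_coeff_theta_q:
  assumes "\<eta> (monom 1 0) = 1"
  shows "b_coeff \<eta> (\<theta> ^ q) n = alpha \<eta> (Suc n) * (1 - (\<theta> ^ q - \<theta>) * S n)"
proof (induction n)
  case 0
  then show ?case
    by (simp add: alpha_def S_def)
next
  case (Suc n)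
  have k: "kap \<eta> (Suc n) = alpha \<eta> (Suc (Suc n)) - alpha \<eta> (Suc n)"
    by (simp add: alpha_Suc)
  have \<rho>: "1 / \<rho> n = S (Suc n) - S n"
    by (simp add: S_Suc_rho)
  have "a_coeff \<eta> (\<theta> ^ q) (Suc n) / \<rho> n = a_coeff \<eta> (\<theta> ^ q) (Suc n) * (1 / \<rho> n)"
    by simp
  then show ?case
    unfolding b_coeff.simps Suc k \<rho> g_coeff_def a_coeff_def by (simp add: algebra_simps)
qed

text \<open>For \<open>t = \<theta>\<^sup>q\<close> the numbers \<open>alpha \<eta> n\<close> converge to \<open>h\<close>, so that this is the identity
  \<open>\<Delta> = - h\<^sup>q\<^sup>-\<^sup>1\<close> for the top coefficient \<open>\<Delta>\<close> of the Drinfeld module.\<close>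

lemma D_coeff_eq:
  assumes \<eta>: "\<And>n. \<eta> (monom 1 (Suc n)) = \<theta> ^ q * \<eta> (monom 1 n)"
    and \<eta>0: "\<eta> (monom 1 0) = 1"
  shows "D_coeff n = - (alpha \<eta> (Suc n) ^ (q - 1))"
    and "alpha \<eta> (Suc (Suc n)) * (1 - (1 - (\<theta> ^ q - \<theta>) * S (Suc n)) * lc (Suc n) ^ (q - 1)) = alpha \<eta> (Suc n)"
    and "alpha \<eta> (Suc n) \<noteq> 0"
proof -
  let ?G = "\<lambda>n. 1 - (\<theta> ^ q - \<theta>) * S (Suc n)"
  let ?P = "\<lambda>n. D_coeff n * \<rho> n ^ q"
  \<comment> \<open>The two closed forms of \<open>b_coeff\<close> at \<open>Suc n\<close> are
    equated.\<close>
  have eq1: "alpha \<eta> (Suc (Suc n)) * ?G n = - (alpha \<eta> (Suc (Suc n)) - alpha \<eta> (Suc n)) * ?P n" for n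
    using b_coeff_theta_q[of \<eta>, OF \<eta>0, of "Suc n"] b_coeff_Suc[OF \<eta>, of n] by (simp add: alpha_Suc[of _ "Suc n"] mult_ac)
  have eq1': "alpha \<eta> (Suc (Suc n)) * (?G n + ?P n) = alpha \<eta> (Suc n) * ?P n" for n
    using eq1[of n] by (simp add: algebra_simps)
  have G: "?G n = g_coeff n + \<theta> / \<rho> n" for n
    by (simp add: g_coeff_def S_Suc_rho algebra_simps diff_divide_distrib)
  have r: "r (Suc n) = r n ^ q * (?G n + ?P n)" for n
    unfolding r_Suc phi_def G using rho_nonzero[of n] r_power_q[of n]
    by (simp add: field_simps power_mult_distrib)
  \<comment> \<open>The factor \<open>?G n + ?P n\<close> occurs both in \<open>eq1'\<close> and in
    \<open>r (Suc n)\<close>. Eliminating it leaves a relation without \<open>S\<close>.\<close>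
  have step: "alpha \<eta> (Suc (Suc n)) * r (Suc n) = alpha \<eta> (Suc n) * D_coeff n * (r n ^ q) ^ q" for n
  proof -
    have "(r n ^ q) ^ q = \<rho> n ^ q * r n ^ q"
      by (simp add: r_power_q power_mult_distrib)
    moreover have "alpha \<eta> (Suc (Suc n)) * r (Suc n) = r n ^ q * (alpha \<eta> (Suc (Suc n)) * (?G n + ?P n))"
      unfolding r by (simp only: mult.left_commute)
    ultimately show ?thesis
      unfolding eq1' by (simp only: mult_ac)
  qed
  \<comment> \<open>The power \<open>q - 1\<close> of \<open>step\<close> has the same form as the
    recursion of \<open>D_coeff\<close>, the sign being harmless by
    \<open>minus_one_power\<close>.\<close>
  have main: "D_coeff n = - (alpha \<eta> (Suc n) ^ (q - 1)) \<and> alpha \<eta> (Suc n) \<noteq> 0" for n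
  proof (induction n)
    case 0
    then show ?case
      using r_nonzero[of 0] \<eta>0 by (simp add: alpha_def kap_def power_divide \<rho>_def)
  next
    case (Suc n)
    let ?h = "alpha \<eta> (Suc n)" and ?h' = "alpha \<eta> (Suc (Suc n))"
    have "?h * ?h ^ (q - 1) = ?h ^ q"
      by (rule power_q_Suc)
    then have eq: "?h' * r (Suc n) = - (?h ^ q * (r n ^ q) ^ q)"
      using step[of n] by (simp only: Suc[THEN conjunct1] mult_minus_right mult_minus_left)
    then have nz: "?h' \<noteq> 0"
      using Suc r_nonzero[of n] q_pos by auto
    have "D_coeff (Suc n) * \<rho> (Suc n) = D_coeff n ^ q * (\<rho> n ^ q) ^ q"
      by (rule D_coeff_Suc)
    also have "\<dots> = - ((?h ^ q * (r n ^ q) ^ q) ^ (q - 1))"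
      using Suc by (simp add: \<rho>_def frob_minus power_mult_distrib mult_ac flip: power_mult)
    also have "\<dots> = - ((-1) ^ (q - 1) * (?h' * r (Suc n)) ^ (q - 1))"
      unfolding eq by (metis minus_mult_minus mult_1 power_mult_distrib)
    also have "\<dots> = - (?h' ^ (q - 1)) * \<rho> (Suc n)"
      by (simp add: minus_one_power power_mult_distrib \<rho>_def del: One_nat_def)
    finally show ?case
      using nz rho_nonzero[of "Suc n"] by (metis mult_right_cancel)
  qed
  then show "D_coeff n = - (alpha \<eta> (Suc n) ^ (q - 1))" "alpha \<eta> (Suc n) \<noteq> 0"
    by blast+
  \<comment> \<open>This identifies the inverse of \<open>?P n\<close>, so that division of
    \<open>eq1'\<close> by \<open>?P n\<close> produces the second claim.\<close>
  have lcP: "- (lc (Suc n) ^ (q - 1)) * ?P n = 1" for n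
  proof (induction n)
    case 0
    have "lc (Suc 0) ^ (q - 1) * \<rho> 0 ^ (q - 1) = (lc (Suc 0) * \<rho> 0) ^ (q - 1)"
      by (simp add: power_mult_distrib)
    also have "lc (Suc 0) * \<rho> 0 = -1"
      using rho_nonzero[of 0] by (simp add: lc.simps \<rho>_def)
    finally have *: "lc (Suc 0) ^ (q - 1) * \<rho> 0 ^ (q - 1) = 1"
      by (simp only: minus_one_power)
    have "?P 0 = - (\<rho> 0 ^ (q - 1))"
      using rho_nonzero[of 0] power_q_minus_one[of "\<rho> 0"] by simp
    with * show ?case
      by simp
  next
    case (Suc n)
    have "lc (Suc (Suc n)) * \<rho> (Suc n) = - (lc (Suc n) ^ q)"
      using rho_nonzero[of "Suc n"] by (simp add: lc.simps(2)[of "Suc n"] \<rho>_def)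
    then have "lc (Suc (Suc n)) ^ (q - 1) * \<rho> (Suc n) ^ (q - 1) = (-1) ^ (q - 1) * (lc (Suc n) ^ q) ^ (q - 1)"
      by (metis mult_minus1 power_mult_distrib)
    also have "\<dots> = (lc (Suc n) ^ (q - 1)) ^ q"
      unfolding minus_one_power by (simp add: mult.commute flip: power_mult)
    finally have l: "lc (Suc (Suc n)) ^ (q - 1) * \<rho> (Suc n) ^ (q - 1) = (lc (Suc n) ^ (q - 1)) ^ q" .
    have "?P (Suc n) = D_coeff (Suc n) * \<rho> (Suc n) * \<rho> (Suc n) ^ (q - 1)"
      by (simp only: power_q_Suc[of "\<rho> (Suc n)", symmetric] mult.assoc)
    also have "\<dots> = ?P n ^ q * \<rho> (Suc n) ^ (q - 1)"
      unfolding D_coeff_Suc by (simp only: power_mult_distrib)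
    finally have "- (lc (Suc (Suc n)) ^ (q - 1)) * ?P (Suc n)
        = (- (lc (Suc n) ^ (q - 1)) * ?P n) ^ q"
      by (simp only: power_mult_distrib frob_minus l[symmetric]) (simp only: mult_minus_left mult_minus_right mult_ac)
    then show ?case
      unfolding Suc by simp
  qed
  have final: "x * (1 - y * w) = z" if "x * (y + p) = z * p" "- w * p = 1" for x y w z p :: 'c
  proof -
    have "x * (1 - y * w) = - w * (x * (y + p))"
      using that(2) by (simp add: algebra_simps) (metis mult.left_commute mult.right_neutral mult_minus_right)
    also have "\<dots> = z"
      unfolding that(1) using that(2) by (simp add: mult.left_commute)
    finally show ?thesis .
  qed
  show "alpha \<eta> (Suc (Suc n)) * (1 - ?G n * lc (Suc n) ^ (q - 1)) = alpha \<eta> (Suc n)"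
    by (rule final[OF eq1' lcP])
qed

end

section \<open>Valued fields\<close>

lemma ex_power_gt:
  fixes b x c :: real
  assumes "b > 1" "c > 0"
  shows "\<exists>n. x < c * b ^ n"
proof -
  obtain n where "x / c < b ^ n"
    using real_arch_pow[OF assms(1)] by blast
  then show ?thesis
    using assms by (auto simp: field_simps)
qed

definition vabs :: "'a::valued_field \<Rightarrow> real" where
  "vabs x = dist x 0"

lemma dist_eq_vabs: "dist x y = vabs (x - y)"
  using dist_add_right[of "x - y" y 0] by (simp add: vabs_def)

lemma vabs_zero [simp]: "vabs 0 = 0"
  by (simp add: vabs_def)

lemma vabs_nonneg [simp]: "0 \<le> vabs x"
  by (simp add: vabs_def)

lemma vabs_eq_0_iff [simp]: "vabs x = 0 \<longleftrightarrow> x = 0"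
  by (simp add: vabs_def)

lemma vabs_pos_iff [simp]: "0 < vabs x \<longleftrightarrow> x \<noteq> 0"
  by (simp add: vabs_def)

lemma vabs_mult: "vabs (x * y) = vabs x * vabs y"
  by (simp add: vabs_def dist_mult_0)

lemma vabs_one [simp]: "vabs 1 = 1"
proof -
  have "vabs (1 :: 'a) * vabs (1 :: 'a) = vabs (1 :: 'a)" "vabs (1 :: 'a) \<noteq> 0"
    using vabs_mult[of 1 "1 :: 'a"] by simp_all
  then show ?thesis
    by simp
qed

lemma vabs_minus [simp]: "vabs (- x) = vabs x"
  using dist_add_right[of "- x" x x] dist_add_right[of 0 x 0] by (metis add.left_neutral dist_add_right dist_commute minus_add_cancel vabs_def ab_left_minus)

lemma vabs_minus_commute: "vabs (x - y) = vabs (y - x)"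
  by (metis minus_diff_eq vabs_minus)

lemma vabs_add_le: "vabs (x + y) \<le> max (vabs x) (vabs y)"
proof -
  have "dist (x + y) 0 \<le> max (dist (x + y) y) (dist y 0)"
    by (rule dist_ultra)
  then show ?thesis
    by (simp add: dist_eq_vabs)
qed

lemma vabs_diff_le: "vabs (x - y) \<le> max (vabs x) (vabs y)"
  using vabs_add_le[of x "- y"] by simp

lemma vabs_add_eq:
  assumes "vabs y < vabs x"
  shows "vabs (x + y) = vabs x"
  using vabs_add_le[of x y] vabs_diff_le[of "x + y" y] assms by (auto simp: max_def split: if_splits)

lemma vabs_power: "vabs (x ^ n) = vabs x ^ n"
  by (induction n) (simp_all add: vabs_mult)

lemma vabs_inverse: "vabs (inverse x) = inverse (vabs x)"
proof (cases "x = 0")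
  case False
  then have "vabs x * vabs (inverse x) = 1"
    by (simp flip: vabs_mult)
  then show ?thesis
    by (metis inverse_unique)
qed simp

lemma vabs_divide: "vabs (x / y) = vabs x / vabs y"
  by (simp add: divide_inverse vabs_mult vabs_inverse)

lemma vabs_prod: "vabs (prod f A) = (\<Prod>x\<in>A. vabs (f x))"
  by (induction A rule: infinite_finite_induct) (simp_all add: vabs_mult)

lemma vabs_sum_le:
  assumes "\<And>x. x \<in> A \<Longrightarrow> vabs (f x) \<le> B" "0 \<le> B"
  shows "vabs (sum f A) \<le> B"
  using assms
proof (induction A rule: infinite_finite_induct)
  case (insert x A)
  then have "max (vabs (f x)) (vabs (sum f A)) \<le> B"
    by simp
  then show ?case
    using vabs_add_le[of "f x" "sum f A"] insert.hyps by (metis order.trans sum.insert)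
qed simp_all

text \<open>A further factor changes the product by \<open>f x\<close> times a quantity of absolute
  value at most 1, and ultrametric errors do not accumulate.\<close>

lemma vabs_prod_one_minus:
  assumes "\<And>x. x \<in> A \<Longrightarrow> vabs (f x) \<le> B" "0 \<le> B" "B \<le> 1"
  shows "vabs ((\<Prod>x\<in>A. 1 - f x) - 1) \<le> B"
  using assms
proof (induction A rule: infinite_finite_induct)
  case (insert x A)
  let ?P = "\<Prod>x\<in>A. 1 - f x"
  have IH: "vabs (?P - 1) \<le> B"
    using insert by simp
  have "vabs ?P \<le> 1"
    using vabs_add_le[of "?P - 1" 1] IH insert.prems by simp
  moreover have "vabs (f x) \<le> B"
    using insert by simp
  ultimately have "vabs (f x * ?P) \<le> B"
    using mult_mono[of "vabs (f x)" B "vabs ?P" 1] insert.prems by (simp add: vabs_mult)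
  then have "vabs ((?P - 1) - f x * ?P) \<le> B"
    using vabs_diff_le[of "?P - 1" "f x * ?P"] IH by linarith
  moreover have "(\<Prod>x\<in>insert x A. 1 - f x) - 1 = (?P - 1) - f x * ?P"
    using insert by (simp add: algebra_simps)
  ultimately show ?case
    by (simp only:)
qed simp_all

instance valued_field \<subseteq> topological_comm_monoid_mult
proof
  fix a b :: 'a
  have d: "dist (x * y) (a * b) \<le> dist x a * dist y b + vabs b * dist x a + vabs a * dist y b" for x y :: 'a
  proof -
    have "x * y - a * b = ((x - a) * (y - b) + b * (x - a)) + a * (y - b)"
      by (simp add: algebra_simps)
    have "vabs (x * y - a * b) \<le> max (max (vabs ((x - a) * (y - b))) (vabs (b * (x - a)))) (vabs (a * (y - b)))"
      unfolding \<open>x * y - a * b = _\<close> by (rule order.trans[OF vabs_add_le]) (intro max.mono vabs_add_le order.refl)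
    also have "\<dots> \<le> vabs ((x - a) * (y - b)) + vabs (b * (x - a)) + vabs (a * (y - b))"
      by simp
    finally show ?thesis
      by (simp add: dist_eq_vabs vabs_mult)
  qed
  show "((\<lambda>x. fst x * snd x) \<longlongrightarrow> a * b) (nhds a \<times>\<^sub>F nhds b)"
    unfolding nhds_prod[symmetric]
  proof (rule metric_tendsto_imp_tendsto)
    show "((\<lambda>x. dist (fst x) a * dist (snd x) b + vabs b * dist (fst x) a + vabs a * dist (snd x) b) \<longlongrightarrow> 0) (nhds (a, b))"
      by (rule tendsto_eq_intros filterlim_ident | simp)+
  next
    show "\<forall>\<^sub>F x in nhds (a, b). dist (fst x * snd x) (a * b)
        \<le> dist (dist (fst x) a * dist (snd x) b + vabs b * dist (fst x) a + vabs a * dist (snd x) b) 0"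
      using d by (intro always_eventually) (simp add: dist_real_def)
  qed
qed

section \<open>Limits, infinite sums and infinite products in complete valued fields\<close>

lemma tendsto_vabs: "(f \<longlongrightarrow> l) F \<Longrightarrow> ((\<lambda>x. vabs (f x)) \<longlongrightarrow> vabs l) F"
  unfolding vabs_def by (intro tendsto_dist tendsto_const)

lemma tendsto_power_valued:
  fixes l :: "'a::valued_field"
  shows "(f \<longlongrightarrow> l) F \<Longrightarrow> ((\<lambda>x. f x ^ n) \<longlongrightarrow> l ^ n) F"
  by (induction n) (auto intro: tendsto_mult)

lemma tendsto_vabs_zero_iff: "(f \<longlongrightarrow> 0) F \<longleftrightarrow> ((\<lambda>x. vabs (f x)) \<longlongrightarrow> 0) F"
  unfolding vabs_def by (rule tendsto_dist_iff)

text \<open>By the ultrametric inequality, a difference over many steps is at most the largest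
  single increment.\<close>

lemma convergent_of_increments:
  fixes a :: "nat \<Rightarrow> 'a::{valued_field,complete_space}"
  assumes "(\<lambda>n. vabs (a (Suc n) - a n)) \<longlonglongrightarrow> 0"
  shows "convergent a"
proof (rule Cauchy_convergent, rule metric_CauchyI)
  fix e :: real
  assume e: "0 < e"
  obtain N where N: "vabs (a (Suc n) - a n) < e" if "n \<ge> N" for n
    using assms e by (auto simp: LIMSEQ_def dist_real_def)
  have "vabs (a n - a N) < e" if "n \<ge> N" for n
    using that
  proof (induction n rule: dec_induct)
    case base
    show ?case using e by simp
  next
    case (step n)
    have "vabs (a (Suc n) - a N) \<le> max (vabs (a (Suc n) - a n)) (vabs (a n - a N))"
      using vabs_add_le[of "a (Suc n) - a n" "a n - a N"] by simp
    then show ?case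
      using N[OF step(1)] step by simp
  qed
  then have "vabs (a m - a n) < e" if "m \<ge> N" "n \<ge> N" for m n
    using vabs_diff_le[of "a m - a N" "a n - a N"] that by (simp add: order.strict_trans1)
  then show "\<exists>M. \<forall>m\<ge>M. \<forall>n\<ge>M. dist (a m) (a n) < e"
    by (auto simp: dist_eq_vabs)
qed

text \<open>The common core for sums and products: a limit over all finite subsets may be computed
  along one exhaustion, here by degree.\<close>

lemma finite_subsets_limit:
  fixes \<phi> :: "'i set \<Rightarrow> 'a::complete_space" and B :: "nat \<Rightarrow> 'i set"
  assumes B: "\<And>n. finite (B n)" "\<And>n. B n \<subseteq> A" "incseq B"
    and tail: "\<And>e. e > 0 \<Longrightarrow> \<exists>N. \<forall>F. finite F \<and> B N \<subseteq> F \<and> F \<subseteq> A \<longrightarrow> dist (\<phi> F) (\<phi> (B N)) < e"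
  shows "\<exists>s. (\<phi> \<longlongrightarrow> s) (finite_subsets_at_top A) \<and> (\<lambda>n. \<phi> (B n)) \<longlonglongrightarrow> s"
proof -
  have "Cauchy (\<lambda>n. \<phi> (B n))"
  proof (rule metric_CauchyI)
    fix e :: real
    assume "0 < e"
    then obtain N where N: "\<And>F. finite F \<Longrightarrow> B N \<subseteq> F \<Longrightarrow> F \<subseteq> A \<Longrightarrow> dist (\<phi> F) (\<phi> (B N)) < e / 2"
      using tail[of "e / 2"] by auto
    have "dist (\<phi> (B n)) (\<phi> (B N)) < e / 2" if "n \<ge> N" for n
      using B that by (intro N) (auto simp: incseq_def)
    then show "\<exists>M. \<forall>m\<ge>M. \<forall>n\<ge>M. dist (\<phi> (B m)) (\<phi> (B n)) < e"
      using dist_triangle_half_r by (metis dist_commute)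
  qed
  then obtain s where s: "(\<lambda>n. \<phi> (B n)) \<longlonglongrightarrow> s"
    using Cauchy_convergent convergent_def by blast
  have "(\<phi> \<longlongrightarrow> s) (finite_subsets_at_top A)"
  proof (rule tendstoI)
    fix e :: real
    assume e: "0 < e"
    then obtain N where N: "\<And>F. finite F \<Longrightarrow> B N \<subseteq> F \<Longrightarrow> F \<subseteq> A \<Longrightarrow> dist (\<phi> F) (\<phi> (B N)) < e / 3"
      using tail[of "e / 3"] by auto
    obtain M where M: "\<And>n. n \<ge> M \<Longrightarrow> dist (\<phi> (B n)) s < e / 3"
      using s e by (metis LIMSEQ_def divide_pos_pos zero_less_numeral)
    define n where "n = max M N"
    have "dist (\<phi> F) s < e" if "finite F" "B n \<subseteq> F" "F \<subseteq> A" for F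
    proof -
      have sub: "B N \<subseteq> B n"
        using B by (auto simp: n_def incseq_def)
      have "dist (\<phi> F) (\<phi> (B N)) < e / 3"
        by (rule N) (use that sub in auto)
      moreover have "dist (\<phi> (B n)) (\<phi> (B N)) < e / 3"
        by (rule N) (use sub B in auto)
      moreover have "dist (\<phi> (B n)) s < e / 3"
        by (rule M) (simp add: n_def)
      ultimately show ?thesis
        using dist_triangle[of "\<phi> F" s "\<phi> (B N)"] dist_triangle[of "\<phi> (B N)" s "\<phi> (B n)"]
          dist_commute[of "\<phi> (B N)" "\<phi> (B n)"] by linarith
    qed
    then show "\<forall>\<^sub>F F in finite_subsets_at_top A. dist (\<phi> F) s < e"
      unfolding eventually_finite_subsets_at_top
      by (intro exI[of _ "B n"]) (simp add: B)
  qed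
  with s show ?thesis
    by blast
qed

lemma infsum_limit:
  fixes f :: "'i \<Rightarrow> 'a::{valued_field,complete_space}"
  assumes B: "\<And>n. finite (B n)" "\<And>n. B n \<subseteq> A" "incseq B"
    and tail: "\<And>e. e > 0 \<Longrightarrow> \<exists>N. \<forall>x\<in>A - B N. vabs (f x) < e"
  shows "(\<lambda>n. \<Sum>x\<in>B n. f x) \<longlonglongrightarrow> (\<Sum>\<^sub>\<infinity>x\<in>A. f x)"
proof -
  have "\<exists>N. \<forall>F. finite F \<and> B N \<subseteq> F \<and> F \<subseteq> A \<longrightarrow> dist (sum f F) (sum f (B N)) < e" if "e > 0" for e
  proof -
    from that have "e / 2 > 0"
      by simp
    from tail[OF this] obtain N where N: "\<forall>x\<in>A - B N. vabs (f x) < e / 2"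
      by blast
    have "dist (sum f F) (sum f (B N)) < e" if F: "finite F" "B N \<subseteq> F" "F \<subseteq> A" for F
    proof -
      have "sum f F - sum f (B N) = sum f (F - B N)"
        using F by (simp add: sum_diff)
      moreover have "vabs (sum f (F - B N)) \<le> e / 2"
        using F N \<open>e > 0\<close> by (intro vabs_sum_le) (auto intro: less_imp_le)
      ultimately show ?thesis
        using \<open>e > 0\<close> by (simp add: dist_eq_vabs)
    qed
    then show ?thesis
      by blast
  qed
  from finite_subsets_limit[OF B this] obtain s
    where s: "(sum f \<longlongrightarrow> s) (finite_subsets_at_top A)" "(\<lambda>n. sum f (B n)) \<longlonglongrightarrow> s"
    by blast
  then have "infsum f A = s"
    by (intro infsumI) (simp add: has_sum_def)
  with s show ?thesis
    by simp
qed

lemma infprod_limit: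
  fixes f :: "'i \<Rightarrow> 'a::{valued_field,complete_space}"
  assumes B: "\<And>n. finite (B n)" "\<And>n. B n \<subseteq> A" "incseq B"
    and tail: "\<And>e. e > 0 \<Longrightarrow> \<exists>N. \<forall>x\<in>A - B N. vabs (f x) < e"
  shows "(\<lambda>n. \<Prod>x\<in>B n. 1 - f x) \<longlonglongrightarrow> Lim (finite_subsets_at_top A) (\<lambda>F. \<Prod>x\<in>F. 1 - f x)"
proof -
  let ?P = "\<lambda>F. \<Prod>x\<in>F. 1 - f x"
  obtain N0 where N0: "\<And>x. x \<in> A - B N0 \<Longrightarrow> vabs (f x) < 1"
    using tail[of 1] by auto
  \<comment> \<open>\<open>K\<close> bounds the partial products over all \<open>B N\<close> with
    \<open>N \<ge> N0\<close>, because the factors outside \<open>B N0\<close> have absolute value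
    at most 1. The summand 1 makes it positive.\<close>
  define K where "K = vabs (?P (B N0)) + 1"
  have K: "K > 0"
    by (simp add: K_def add_nonneg_pos)
  have near: "vabs (?P F - ?P G) \<le> vabs (?P G) * e"
    if "finite F" "G \<subseteq> F" "F \<subseteq> A" "\<And>x. x \<in> A - G \<Longrightarrow> vabs (f x) \<le> e" "0 \<le> e" "e \<le> 1" for F G e
  proof -
    have "?P F - ?P G = ?P G * (?P (F - G) - 1)"
      using that(1,2) by (simp add: prod.subset_diff[of G F] algebra_simps)
    moreover have "vabs (?P (F - G) - 1) \<le> e"
      using that by (intro vabs_prod_one_minus) auto
    ultimately show ?thesis
      by (simp add: vabs_mult mult_left_mono)
  qed
  have "\<exists>N. \<forall>F. finite F \<and> B N \<subseteq> F \<and> F \<subseteq> A \<longrightarrow> dist (?P F) (?P (B N)) < e" if "e > 0" for e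
  proof -
    define d where "d = min 1 (e / (2 * K))"
    have d: "0 < d" "d \<le> 1" "K * d < e"
      using that K by (auto simp: d_def min_def field_simps)
    obtain N1 where N1: "\<And>x. x \<in> A - B N1 \<Longrightarrow> vabs (f x) < d"
      using tail[OF d(1)] by auto
    define N where "N = max N0 N1"
    have sub: "B N0 \<subseteq> B N" "B N1 \<subseteq> B N"
      using B(3) by (auto simp: N_def incseq_def)
    have "vabs (?P (B N)) \<le> K"
    proof -
      have "vabs (?P (B N) - ?P (B N0)) \<le> vabs (?P (B N0)) * 1"
        using B sub N0 by (intro near) (auto intro: less_imp_le)
      then show ?thesis
        using vabs_add_le[of "?P (B N) - ?P (B N0)" "?P (B N0)"] by (simp add: K_def)
    qed
    then have "vabs (?P (B N)) * d \<le> K * d"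
      using d by (intro mult_right_mono) auto
    moreover have "vabs (?P F - ?P (B N)) \<le> vabs (?P (B N)) * d" if "finite F" "B N \<subseteq> F" "F \<subseteq> A" for F
    proof (rule near[OF that])
      show "vabs (f x) \<le> d" if "x \<in> A - B N" for x
        using that sub N1[of x] by (metis Diff_iff less_imp_le subsetD)
    qed (use d in auto)
    ultimately have "dist (?P F) (?P (B N)) < e" if "finite F" "B N \<subseteq> F" "F \<subseteq> A" for F
      using that d(3) unfolding dist_eq_vabs by fastforce
    then show ?thesis
      by blast
  qed
  from finite_subsets_limit[of B A ?P, OF B this] obtain s
    where s: "(?P \<longlongrightarrow> s) (finite_subsets_at_top A)" "(\<lambda>n. ?P (B n)) \<longlonglongrightarrow> s"
    by blast
  then have "Lim (finite_subsets_at_top A) ?P = s"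
    by (intro tendsto_Lim) simp_all
  with s show ?thesis
    by simp
qed

section \<open>The absolute value on A inside C_infinity\<close>

context C_infinity
begin

abbreviation emb :: "'f \<Rightarrow> 'c" where "emb x \<equiv> \<iota> (fls_const x)"
abbreviation \<theta> :: 'c where "\<theta> \<equiv> theta \<iota>"

lemma hom_zero: "\<iota> 0 = 0"
  using hom_add[of 0 0] by (metis add.right_neutral add_left_cancel)

lemma hom_minus: "\<iota> (- x) = - \<iota> x"
  using hom_add[of x "- x"] by (simp add: hom_zero eq_neg_iff_add_eq_0 add.commute)

lemma hom_diff: "\<iota> (x - y) = \<iota> x - \<iota> y"
  using hom_add[of x "- y"] by (simp add: hom_minus)

lemma vabs_hom: "x \<noteq> 0 \<Longrightarrow> vabs (\<iota> x) = real CARD('f) powi (- fls_subdegree x)"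
  using dist_hom by (simp add: vabs_def)

lemma vabs_theta: "vabs \<theta> = real CARD('f)"
  by (simp add: theta_def vabs_hom)

lemma card_gt_1: "real CARD('f) > 1"
  using card_ge_2[where 'f='f] by simp

lemma theta_nonzero: "\<theta> \<noteq> 0"
  using vabs_theta card_gt_1 by (metis not_one_less_zero vabs_zero)

lemma vabs_emb: "vabs (emb x) = (if x = 0 then 0 else 1)"
  by (simp add: vabs_hom hom_zero)

lemma of_A_pCons: "of_A \<iota> (pCons x a) = emb x + \<theta> * of_A \<iota> a"
  by (simp add: of_A_def theta_def map_poly_pCons hom_add hom_mult)

lemma of_A_0: "of_A \<iota> 0 = 0"
  by (simp add: of_A_def hom_zero)

lemma of_A_add: "of_A \<iota> (a + b) = of_A \<iota> a + of_A \<iota> b"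
proof (induction a b rule: poly_induct2)
  case (pCons x a y b)
  have "emb (x + y) = emb x + emb y"
    by (metis fls_plus_const hom_add)
  then show ?case
    by (simp add: of_A_pCons pCons algebra_simps)
qed (simp add: of_A_0)

lemma of_A_minus: "of_A \<iota> (- c) = - of_A \<iota> c"
  using of_A_add[of c "- c"] by (simp add: of_A_0 eq_neg_iff_add_eq_0 add.commute)

lemma of_A_smult: "of_A \<iota> (smult x a) = emb x * of_A \<iota> a"
proof (induction a)
  case (pCons y a)
  have "emb (x * y) = emb x * emb y"
    by (metis fls_const_mult_const hom_mult)
  then show ?case
    using pCons by (simp add: of_A_pCons algebra_simps)
qed (simp add: of_A_0)

lemma of_A_monom: "of_A \<iota> (monom 1 n) = \<theta> ^ n"
  by (induction n) (simp_all add: monom_0 monom_Suc of_A_pCons of_A_0 hom_zero hom_one)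

lemma vabs_of_A: "a \<noteq> 0 \<Longrightarrow> vabs (of_A \<iota> a) = real CARD('f) ^ degree a"
proof (induction a)
  case (pCons x a)
  show ?case
  proof (cases "a = 0")
    case True
    with pCons.hyps show ?thesis
      by (simp add: of_A_pCons of_A_0 vabs_emb)
  next
    case False
    have v: "vabs (\<theta> * of_A \<iota> a) = real CARD('f) ^ Suc (degree a)"
      using pCons.IH[OF False] by (simp add: vabs_mult vabs_theta)
    have "vabs (emb x) \<le> 1" "1 < real CARD('f) ^ Suc (degree a)"
      using card_gt_1 one_less_power[of "real CARD('f)" "Suc (degree a)"] by (simp_all add: vabs_emb)
    then show ?thesis
      using False vabs_add_eq[of "emb x" "\<theta> * of_A \<iota> a"] v by (simp add: of_A_pCons add.commute)
  qed
qed simp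

lemma of_A_eq_0_iff: "of_A \<iota> a = 0 \<longleftrightarrow> a = 0"
proof
  assume "of_A \<iota> a = 0"
  then show "a = 0"
    using vabs_of_A[of a] card_gt_1 by (metis less_irrefl not_one_less_zero power_eq_0_iff vabs_zero)
qed (simp add: of_A_0)

lemma of_A_range: "of_A \<iota> a \<in> range \<iota>"
  by (simp add: of_A_def)

sublocale fq: fq_embedding emb "CARD('f)"
  by unfold_locales (simp_all add: hom_one flip: fls_plus_const fls_const_mult_const hom_add hom_mult)

end

section \<open>The exponential of the period lattice\<close>

locale lattice_of_period = C_infinity \<iota>
  for \<iota> :: "'f::{finite,field} fls \<Rightarrow> 'c::{valued_field,alg_closed_field,complete_space}" +
  fixes \<omega> :: 'c
  assumes omega_nonzero: "\<omega> \<noteq> 0"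
begin

sublocale L: fq_module_lattice emb "CARD('f)" "\<lambda>c. \<omega> * of_A \<iota> c" \<theta> 0
proof
  show "fq.fq_linear (\<lambda>c. \<omega> * of_A \<iota> c)"
    by (simp add: fq.fq_linear_def of_A_add of_A_smult algebra_simps)
  show "\<omega> * of_A \<iota> a \<noteq> 0" if "a \<noteq> 0" for a
    using that omega_nonzero by (simp add: of_A_eq_0_iff)
  show "\<omega> * of_A \<iota> (monom 1 (Suc n))
      = \<theta> * (\<omega> * of_A \<iota> (monom 1 n)) + 0 * (\<omega> * of_A \<iota> (monom 1 n)) ^ CARD('f)" for n
    by (simp add: of_A_monom)
qed

abbreviation E :: "'c \<Rightarrow> 'c" where "E \<equiv> lattice_exp (lattice \<iota> \<omega>)"

lemma vabs_period: "c \<noteq> 0 \<Longrightarrow> vabs (\<omega> * of_A \<iota> c) = vabs \<omega> * real CARD('f) ^ degree c"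
  by (simp add: vabs_mult vabs_of_A)

lemma vabs_period_ge:
  assumes "c \<notin> polys_below N"
  shows "vabs \<omega> * real CARD('f) ^ N \<le> vabs (\<omega> * of_A \<iota> c)"
  using assms card_gt_1 by (auto simp: polys_below_degree vabs_period intro!: mult_left_mono power_increasing)

lemma inj_period: "inj (\<lambda>c. \<omega> * of_A \<iota> c)"
proof (rule injI)
  fix a b
  assume "\<omega> * of_A \<iota> a = \<omega> * of_A \<iota> b"
  moreover have "of_A \<iota> a = of_A \<iota> (a - b) + of_A \<iota> b"
    by (simp flip: of_A_add)
  ultimately have "of_A \<iota> (a - b) = 0"
    using omega_nonzero by simp
  then show "a = b"
    by (simp add: of_A_eq_0_iff)
qed

text \<open>Exhausting the lattice by degree turns the infinite product into a limit of the
  polynomials \<open>fq_exp n\<close>, through which the identities of finite level reach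
  \<open>E\<close>.\<close>

lemma E_limit: "(\<lambda>n. L.fq_exp n z) \<longlonglongrightarrow> E z"
proof -
  let ?V = "\<lambda>c. \<omega> * of_A \<iota> c" and ?A = "lattice \<iota> \<omega> - {0}"
  define B where "B = (\<lambda>n. ?V ` (polys_below n - {0}))"
  have "(\<lambda>n. \<Prod>x\<in>B n. 1 - z / x) \<longlonglongrightarrow> Lim (finite_subsets_at_top ?A) (\<lambda>F. \<Prod>x\<in>F. 1 - z / x)"
  proof (rule infprod_limit)
    show "finite (B n)" for n
      by (simp add: B_def finite_polys_below)
    show "B n \<subseteq> ?A" for n
      by (auto simp: B_def lattice_def of_A_eq_0_iff omega_nonzero)
    show "incseq B"
      using polys_below_mono by (fastforce simp: incseq_def B_def)
    show "\<exists>N. \<forall>x\<in>?A - B N. vabs (z / x) < e" if "e > 0" for e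
    proof -
      obtain N where N: "vabs z / e < vabs \<omega> * real CARD('f) ^ N"
        using ex_power_gt[OF card_gt_1, of "vabs \<omega>"] omega_nonzero by auto
      have "vabs (z / x) < e" if x: "x \<in> ?A - B N" for x
      proof -
        obtain c where c: "x = ?V c"
          using x by (auto simp: lattice_def)
        have "x \<noteq> 0"
          using that by simp
        have "c \<notin> polys_below N"
        proof
          assume "c \<in> polys_below N"
          then have "x \<in> B N"
            using c \<open>x \<noteq> 0\<close> by (auto simp: B_def of_A_0 intro!: imageI)
          with that show False
            by simp
        qed
        with c have "vabs z / e < vabs x"
          using N vabs_period_ge[of c N] by simp
        then show ?thesis
          using \<open>x \<noteq> 0\<close> \<open>e > 0\<close> by (simp add: vabs_divide field_simps)
      qed
      then show ?thesis
        by blast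
    qed
  qed
  then have "(\<lambda>n. z * (\<Prod>x\<in>B n. 1 - z / x)) \<longlonglongrightarrow> E z"
    unfolding lattice_exp_def by (rule tendsto_mult_left)
  moreover have "z * (\<Prod>x\<in>B n. 1 - z / x) = L.fq_exp n z" for n
  proof -
    have "(\<Prod>x\<in>B n. 1 - z / x) = (\<Prod>c\<in>polys_below n - {0}. 1 - z / ?V c)"
      unfolding B_def by (subst prod.reindex) (auto intro: inj_on_subset[OF inj_period])
    also have "\<dots> = (\<Prod>c\<in>polys_below n. 1 - z / ?V c)"
      by (rule prod.mono_neutral_left) (auto simp: finite_polys_below of_A_0)
    also have "\<dots> = (\<Prod>c\<in>polys_below n. 1 + z / ?V c)"
    proof (rule prod.reindex_bij_witness[of _ uminus uminus])
      fix c
      show "1 + z / ?V (- c) = 1 - z / ?V c"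
        by (simp add: of_A_minus)
    qed (auto simp: polys_below_def)
    finally show ?thesis
      by (simp add: L.fq_exp_prod_normalized)
  qed
  ultimately show ?thesis
    by simp
qed

lemma E_add: "E (x + y) = E x + E y"
  by (rule LIMSEQ_unique[OF E_limit]) (simp add: L.fq_exp_add tendsto_add E_limit)

lemma E_scale: "E (emb x * y) = emb x * E y"
  by (rule LIMSEQ_unique[OF E_limit]) (simp add: L.fq_exp_scale tendsto_mult_left E_limit)

lemma E_minus: "E (- y) = - E y"
  using E_scale[of "-1" y] by (simp add: hom_minus hom_one)

lemma E_diff: "E (x - y) = E x - E y"
  using E_add[of x "- y"] by (simp add: E_minus)

text \<open>In the normalized product each factor has absolute value at least 1, since
  \<open>monom 1 n\<close> has larger degree than every \<open>c\<close> involved. The growth of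
  \<open>r\<close> makes \<open>S\<close> converge.\<close>

lemma vabs_r_ge: "vabs \<omega> * real CARD('f) ^ n \<le> vabs (L.r n)"
proof -
  let ?V = "\<lambda>c. \<omega> * of_A \<iota> c"
  have "1 \<le> vabs (1 + ?V (monom 1 n) / ?V c)" if "c \<in> polys_below n" for c
  proof (cases "c = 0")
    case False
    then have deg: "degree c < n"
      using that by (simp add: polys_below_degree)
    have V: "?V c \<noteq> 0"
      using L.V_nonzero[OF False] .
    have "vabs (?V c) < vabs (?V (monom 1 n))"
      using False deg card_gt_1 omega_nonzero by (simp add: vabs_period degree_monom_eq)
    moreover from this have "vabs (?V (monom 1 n) + ?V c) = vabs (?V (monom 1 n))"
      by (rule vabs_add_eq)
    moreover have "1 + ?V (monom 1 n) / ?V c = (?V (monom 1 n) + ?V c) / ?V c"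
      using V by (simp add: field_simps)
    ultimately show ?thesis
      using V by (simp add: vabs_divide)
  qed (simp add: of_A_0)
  then have "1 \<le> vabs (\<Prod>c\<in>polys_below n. 1 + ?V (monom 1 n) / ?V c)"
    unfolding vabs_prod by (intro prod_ge_1)
  then have "vabs (?V (monom 1 n)) * 1 \<le> vabs (L.r n)"
    unfolding L.fq_exp_prod_normalized by (subst vabs_mult) (intro mult_left_mono vabs_nonneg)
  then show ?thesis
    by (simp add: vabs_period degree_monom_eq)
qed

lemma S_convergent: "convergent L.S"
proof (rule convergent_of_increments)
  let ?q = "CARD('f)"
  have "(\<lambda>n. (1 / vabs \<omega>) * (1 / real ?q) ^ n) \<longlonglongrightarrow> (1 / vabs \<omega>) * 0"
    using card_gt_1 by (intro tendsto_mult_left LIMSEQ_power_zero) simp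
  then have "(\<lambda>n. ((1 / vabs \<omega>) * (1 / real ?q) ^ n) ^ (?q - 1)) \<longlonglongrightarrow> ((1 / vabs \<omega>) * 0) ^ (?q - 1)"
    by (rule tendsto_power)
  then have lim: "(\<lambda>n. ((1 / vabs \<omega>) * (1 / real ?q) ^ n) ^ (?q - 1)) \<longlonglongrightarrow> 0"
    using card_gt_1 by (simp add: zero_power)
  have "vabs (L.S (Suc n) - L.S n) \<le> ((1 / vabs \<omega>) * (1 / real ?q) ^ n) ^ (?q - 1)" for n
  proof -
    have "1 / vabs (L.r n) \<le> 1 / (vabs \<omega> * real ?q ^ n)"
      using vabs_r_ge[of n] omega_nonzero card_gt_1 L.r_nonzero[of n]
      by (intro divide_left_mono mult_pos_pos) auto
    also have "\<dots> = (1 / vabs \<omega>) * (1 / real ?q) ^ n"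
      by (simp add: power_divide)
    finally have "(1 / vabs (L.r n)) ^ (?q - 1) \<le> ((1 / vabs \<omega>) * (1 / real ?q) ^ n) ^ (?q - 1)"
      by (intro power_mono) auto
    then show ?thesis
      by (simp add: L.S_Suc vabs_divide vabs_power power_divide)
  qed
  then show "(\<lambda>n. vabs (L.S (Suc n) - L.S n)) \<longlonglongrightarrow> 0"
    by (intro tendsto_sandwich[OF _ _ tendsto_const lim]) (auto intro: always_eventually)
qed

text \<open>The limit of \<open>fq_exp_shift\<close> with \<gamma> = 0. The limit \<kappa> of
  \<open>g_coeff\<close> is still unknown; it is found later from the zeros.\<close>

lemma E_theta_mult: "\<exists>\<kappa>. \<forall>y. E (\<theta> * y) = \<theta> * E y + \<kappa> * E y ^ CARD('f)"
proof -
  obtain s where s: "L.S \<longlonglongrightarrow> s"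
    using S_convergent convergent_def by blast
  define \<kappa> where "\<kappa> = 0 - \<theta> ^ CARD('f) * s + \<theta> * s"
  have g: "L.g_coeff \<longlonglongrightarrow> \<kappa>"
    unfolding L.g_coeff_def[abs_def] \<kappa>_def
    by (intro tendsto_add tendsto_diff tendsto_mult tendsto_const s LIMSEQ_Suc)
  have "E (\<theta> * y) = \<theta> * E y + \<kappa> * E y ^ CARD('f)" for y
  proof (rule LIMSEQ_unique[OF LIMSEQ_Suc[OF E_limit]])
    have "L.fq_exp (Suc n) (\<theta> * y) = \<theta> * L.fq_exp n y + L.g_coeff n * L.fq_exp n y ^ CARD('f)" for n
      using L.fq_exp_shift[of n y] by (simp add: L.phi_def L.D_coeff_eq_0)
    then show "(\<lambda>n. L.fq_exp (Suc n) (\<theta> * y)) \<longlonglongrightarrow> \<theta> * E y + \<kappa> * E y ^ CARD('f)"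
      by (simp only:) (intro tendsto_add tendsto_mult tendsto_const tendsto_power_valued E_limit g)
  qed
  then show ?thesis
    by blast
qed

text \<open>The initial condition for \<open>functional_equation_unique\<close>. Nonzero periods
  have absolute value at least that of \<omega>, which bounds how far each factor is from 1.\<close>

lemma E_near_0:
  assumes "vabs y \<le> vabs \<omega>"
  shows "vabs (E y - y) \<le> 1 / vabs \<omega> * vabs y ^ 2"
proof (rule tendsto_upperbound)
  show "(\<lambda>n. vabs (L.fq_exp n y - y)) \<longlonglongrightarrow> vabs (E y - y)"
    by (intro tendsto_vabs tendsto_diff E_limit tendsto_const)
  have "vabs (L.fq_exp n y - y) \<le> 1 / vabs \<omega> * vabs y ^ 2" for n
  proof -
    let ?V = "\<lambda>c. \<omega> * of_A \<iota> c"
    have "vabs ((\<Prod>c\<in>polys_below n. 1 - - (y / ?V c)) - 1) \<le> vabs y / vabs \<omega>"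
    proof (rule vabs_prod_one_minus)
      show "vabs (- (y / ?V c)) \<le> vabs y / vabs \<omega>" for c
      proof (cases "c = 0")
        case False
        have "vabs \<omega> \<le> vabs (?V c)"
          using False card_gt_1 mult_left_mono[of 1 "real CARD('f) ^ degree c" "vabs \<omega>"]
          by (simp add: vabs_period)
        then show ?thesis
          using omega_nonzero L.V_nonzero[OF False] by (simp add: vabs_divide divide_left_mono)
      qed (simp add: of_A_0)
    qed (use assms omega_nonzero in auto)
    then have "vabs y * vabs ((\<Prod>c\<in>polys_below n. 1 + y / ?V c) - 1) \<le> vabs y * (vabs y / vabs \<omega>)"
      by (intro mult_left_mono) auto
    then show ?thesis
      by (simp add: L.fq_exp_prod_normalized power2_eq_square right_diff_distrib flip: vabs_mult)
  qed
  then show "\<forall>\<^sub>F n in sequentially. vabs (L.fq_exp n y - y) \<le> 1 / vabs \<omega> * vabs y ^ 2"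
    by simp
qed simp

lemma E_period: "E (\<omega> * of_A \<iota> a) = 0"
proof (rule LIMSEQ_unique[OF E_limit])
  have "L.fq_exp n (\<omega> * of_A \<iota> a) = 0" if "degree a < n" for n
  proof -
    have "- a \<in> polys_below n"
      using that by (simp add: polys_below_degree)
    moreover have "\<omega> * of_A \<iota> a + \<omega> * of_A \<iota> (- a) = 0"
      by (simp add: of_A_minus)
    ultimately have "(\<Prod>c\<in>polys_below n. \<omega> * of_A \<iota> a + \<omega> * of_A \<iota> c) = 0"
      by (intro prod_zero finite_polys_below) blast
    then show ?thesis
      unfolding L.fq_exp_prod by simp
  qed
  then show "(\<lambda>n. L.fq_exp n (\<omega> * of_A \<iota> a)) \<longlonglongrightarrow> 0"
    by (intro tendsto_eventually) (auto simp: eventually_sequentially intro!: exI[of _ "Suc (degree a)"])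
qed

text \<open>If no period is closer to \<open>y\<close> than 0, each factor 1 + y/V(c) has absolute
  value at least 1 and at least that of y/V(c). The second bound is used for the nonzero
  \<open>c\<close> of degree below \<open>k\<close>, the first for the others.\<close>

lemma E_lower_bound_reduced:
  obtains C where "C > 0"
    and "\<And>y. (\<And>a. vabs y \<le> vabs (y - \<omega> * of_A \<iota> a)) \<Longrightarrow> C * vabs y ^ (CARD('f) ^ k) \<le> vabs (E y)"
proof -
  let ?V = "\<lambda>c. \<omega> * of_A \<iota> c" and ?P = "polys_below k - {0} :: 'f poly set"
  define C where "C = (\<Prod>c\<in>?P. 1 / vabs (?V c))"
  have "C > 0"
    using L.V_nonzero unfolding C_def by (intro prod_pos) auto
  moreover have "C * vabs y ^ (CARD('f) ^ k) \<le> vabs (E y)" if y: "\<And>a. vabs y \<le> vabs (y - ?V a)" for y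
  proof (rule tendsto_lowerbound)
    show "(\<lambda>n. vabs (L.fq_exp n y)) \<longlonglongrightarrow> vabs (E y)"
      by (intro tendsto_vabs E_limit)
    have "C * vabs y ^ (CARD('f) ^ k) \<le> vabs (L.fq_exp n y)" if "k \<le> n" for n
    proof -
      have factor: "vabs y / vabs (?V c) \<le> vabs (1 + y / ?V c)" for c
      proof (cases "c = 0")
        case False
        then have V: "?V c \<noteq> 0"
          by (rule L.V_nonzero)
        have "vabs y \<le> vabs (y + ?V c)"
          using y[of "- c"] by (simp add: of_A_minus)
        moreover have "1 + y / ?V c = (y + ?V c) / ?V c"
          using V by (simp add: field_simps)
        ultimately show ?thesis
          by (simp only: vabs_divide) (simp add: divide_right_mono)
      qed (simp add: of_A_0)
      have factor1: "1 \<le> vabs (1 + y / ?V c)" for c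
      proof (cases "vabs (y / ?V c) < 1")
        case True
        then show ?thesis
          using vabs_add_eq[of "y / ?V c" 1] by simp
      next
        case False
        then show ?thesis
          using factor[of c] by (simp add: vabs_divide)
      qed
      \<comment> \<open>The successor accounts for the factor \<open>y\<close> in front of the
        product.\<close>
      have card: "CARD('f) ^ k = Suc (card ?P)"
        using card_polys_below[of k, where 'f='f] zero_in_polys_below finite_polys_below
        by (metis card.remove)
      have "C * vabs y ^ (CARD('f) ^ k) = vabs y * (\<Prod>c\<in>?P. vabs y / vabs (?V c))"
        by (simp add: card C_def prod_dividef)
      also have "\<dots> \<le> vabs y * (\<Prod>c\<in>?P. vabs (1 + y / ?V c))"
        by (intro mult_left_mono prod_mono) (auto simp: factor)
      also have "\<dots> \<le> vabs y * (\<Prod>c\<in>polys_below n. vabs (1 + y / ?V c))"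
        using polys_below_mono[OF that] factor1 finite_polys_below
        by (intro mult_left_mono prod_mono2) (auto intro: order.trans[OF zero_le_one])
      also have "\<dots> = vabs (L.fq_exp n y)"
        by (simp add: L.fq_exp_prod_normalized vabs_mult vabs_prod)
      finally show ?thesis .
    qed
    then show "\<forall>\<^sub>F n in sequentially. C * vabs y ^ (CARD('f) ^ k) \<le> vabs (L.fq_exp n y)"
      by (auto simp: eventually_sequentially)
  qed simp
  ultimately show ?thesis
    using that by blast
qed

text \<open>Periods of large degree are farther from \<open>y\<close> than 0 is, so the minimum is
  taken over a finite set.\<close>

lemma nearest_period: "\<exists>a. \<forall>b. vabs (y - \<omega> * of_A \<iota> a) \<le> vabs (y - \<omega> * of_A \<iota> b)"
proof -
  let ?d = "\<lambda>b. vabs (y - \<omega> * of_A \<iota> b)"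
  obtain N where N: "vabs y < vabs \<omega> * real CARD('f) ^ N"
    using ex_power_gt[OF card_gt_1, of "vabs \<omega>"] omega_nonzero by auto
  define a where "a = arg_min_on ?d (polys_below N)"
  have a: "?d a \<le> ?d b" if "b \<in> polys_below N" for b
    using arg_min_least[OF finite_polys_below _ that, of ?d] that unfolding a_def by blast
  have "?d a \<le> ?d b" for b
  proof (cases "b \<in> polys_below N")
    case False
    then have lt: "vabs y < vabs (\<omega> * of_A \<iota> b)"
      using vabs_period_ge[of b N] N by simp
    have "?d a \<le> vabs y"
      using a[OF zero_in_polys_below] by (simp add: of_A_0)
    also have "\<dots> \<le> ?d b"
      using vabs_add_eq[of y "- (\<omega> * of_A \<iota> b)"] lt by (simp add: vabs_minus_commute)
    finally show ?thesis .
  qed (rule a)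
  then show ?thesis
    by blast
qed

lemma E_lower_bound:
  obtains C where "C > 0" and "\<And>y. \<exists>a. C * vabs (y - \<omega> * of_A \<iota> a) ^ (CARD('f) ^ k) \<le> vabs (E y)"
proof -
  obtain C where C: "C > 0"
    "\<And>y. (\<And>a. vabs y \<le> vabs (y - \<omega> * of_A \<iota> a)) \<Longrightarrow> C * vabs y ^ (CARD('f) ^ k) \<le> vabs (E y)"
    using E_lower_bound_reduced by blast
  have "\<exists>a. C * vabs (y - \<omega> * of_A \<iota> a) ^ (CARD('f) ^ k) \<le> vabs (E y)" for y
  proof -
    obtain a where a: "\<And>b. vabs (y - \<omega> * of_A \<iota> a) \<le> vabs (y - \<omega> * of_A \<iota> b)"
      using nearest_period by blast
    have "vabs (y - \<omega> * of_A \<iota> a) \<le> vabs (y - \<omega> * of_A \<iota> a - \<omega> * of_A \<iota> b)" for b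
      using a[of "a + b"] by (simp add: of_A_add algebra_simps)
    from C(2)[OF this] show ?thesis
      by (auto simp: E_diff E_period)
  qed
  with C(1) show ?thesis
    using that by blast
qed

text \<open>With exponent q^0 = 1, \<open>E_lower_bound\<close> controls the distance to some period
  by the value of \<open>E\<close>.\<close>

lemma E_eq_0_iff: "E y = 0 \<longleftrightarrow> y \<in> lattice \<iota> \<omega>"
proof
  assume "E y = 0"
  obtain C where "C > 0" and C: "\<And>y. \<exists>a. C * vabs (y - \<omega> * of_A \<iota> a) ^ (CARD('f) ^ 0) \<le> vabs (E y)"
    using E_lower_bound by blast
  then obtain a where "C * vabs (y - \<omega> * of_A \<iota> a) \<le> 0"
    using \<open>E y = 0\<close> by (metis power_0 power_one_right vabs_zero)
  then have "vabs (y - \<omega> * of_A \<iota> a) = 0"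
    using \<open>C > 0\<close> by (metis order.antisym mult_le_0_iff not_less vabs_nonneg)
  then show "y \<in> lattice \<iota> \<omega>"
    by (auto simp: lattice_def)
next
  assume "y \<in> lattice \<iota> \<omega>"
  then obtain a where "y = \<omega> * of_A \<iota> a"
    by (auto simp: lattice_def)
  then show "E y = 0"
    by (simp add: E_period)
qed

end

section \<open>The Carlitz exponential\<close>

context C_infinity
begin

lemma vabs_carlitz_D: "vabs (carlitz_D \<iota> n) = (real CARD('f) ^ n) ^ (CARD('f) ^ n)"
proof -
  let ?q = "CARD('f)"
  have "vabs (\<theta> ^ (?q ^ n) - \<theta> ^ (?q ^ i)) = real ?q ^ (?q ^ n)" if "i < n" for i
  proof -
    have "?q ^ i < ?q ^ n"
      using that card_ge_2[where 'f='f] by simp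
    then have "vabs (- (\<theta> ^ (?q ^ i))) < vabs (\<theta> ^ (?q ^ n))"
      using card_gt_1 by (simp add: vabs_power vabs_theta)
    from vabs_add_eq[OF this] show ?thesis
      by (simp add: vabs_power vabs_theta)
  qed
  then show ?thesis
    by (simp add: carlitz_D_def vabs_prod mult.commute flip: power_mult)
qed

lemma carlitz_D_nonzero: "carlitz_D \<iota> n \<noteq> 0"
  using vabs_carlitz_D[of n] card_gt_1 by (metis less_irrefl not_one_less_zero power_eq_0_iff vabs_zero)

lemma vabs_carlitz_D_ge_1: "1 \<le> vabs (carlitz_D \<iota> n)"
  using card_gt_1 by (simp add: vabs_carlitz_D one_le_power)

text \<open>The factor \<open>i = 0\<close> is the bracket; the others are the q-th powers of the
  previous factors.\<close>

lemma carlitz_D_Suc: "carlitz_D \<iota> (Suc n) = bracket \<iota> (Suc n) * carlitz_D \<iota> n ^ CARD('f)"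
proof -
  let ?q = "CARD('f)"
  have "\<theta> ^ (?q ^ Suc n) - \<theta> ^ (?q ^ Suc i) = (\<theta> ^ (?q ^ n) - \<theta> ^ (?q ^ i)) ^ ?q" for i
    by (simp add: fq.frob_diff mult.commute flip: power_mult)
  then show ?thesis
    unfolding carlitz_D_def bracket_def
    by (subst prod.lessThan_Suc_shift) (simp add: prod_power_distrib)
qed

definition carlitz_term :: "'c \<Rightarrow> nat \<Rightarrow> 'c" where
  "carlitz_term z n = z ^ (CARD('f) ^ n) / carlitz_D \<iota> n"

lemma vabs_carlitz_term: "vabs (carlitz_term z n) = (vabs z / real CARD('f) ^ n) ^ (CARD('f) ^ n)"
  by (simp add: carlitz_term_def vabs_divide vabs_power vabs_carlitz_D power_divide)

lemma carlitz_exp_limit: "(\<lambda>n. \<Sum>i<n. carlitz_term z i) \<longlonglongrightarrow> carlitz_exp \<iota> z"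
proof -
  let ?q = "CARD('f)"
  have "(\<lambda>n. vabs z * (1 / real ?q) ^ n) \<longlonglongrightarrow> vabs z * 0"
    using card_gt_1 by (intro tendsto_mult_left LIMSEQ_power_zero) simp
  then have lim: "(\<lambda>n. vabs z / real ?q ^ n) \<longlonglongrightarrow> 0"
    by (simp add: power_divide)
  then have "\<forall>\<^sub>F n in sequentially. vabs z / real ?q ^ n < 1"
    by (rule order_tendstoD) simp
  then have "\<forall>\<^sub>F n in sequentially. vabs (carlitz_term z n) \<le> vabs z / real ?q ^ n"
  proof eventually_elim
    case (elim n)
    have "(vabs z / real ?q ^ n) ^ (?q ^ n) \<le> (vabs z / real ?q ^ n) ^ 1"
      using elim card_gt_1 by (intro power_decreasing) auto
    then show ?case
      by (simp add: vabs_carlitz_term)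
  qed
  then have "(\<lambda>n. vabs (carlitz_term z n)) \<longlonglongrightarrow> 0"
    by (intro tendsto_sandwich[OF _ _ tendsto_const lim]) (auto intro: always_eventually)
  then have "convergent (\<lambda>n. \<Sum>i<n. carlitz_term z i)"
    by (intro convergent_of_increments) simp
  then obtain s where s: "(\<lambda>n. \<Sum>i<n. carlitz_term z i) \<longlonglongrightarrow> s"
    by (auto simp: convergent_def)
  then have "carlitz_term z sums s"
    by (simp add: sums_def)
  then have "s = carlitz_exp \<iota> z"
    using sums_unique by (metis (no_types) carlitz_exp_def carlitz_term_def suminf_cong)
  with s show ?thesis
    by simp
qed

text \<open>Since \<theta>^(q^(n+1)) = \<theta> + [n+1], the bracket cancels against the one in
  \<open>carlitz_D_Suc\<close>.\<close>

lemma carlitz_term_theta: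
  "carlitz_term (\<theta> * z) (Suc n) = \<theta> * carlitz_term z (Suc n) + carlitz_term z n ^ CARD('f)"
proof -
  let ?q = "CARD('f)"
  have B: "bracket \<iota> (Suc n) \<noteq> 0"
    using carlitz_D_nonzero[of "Suc n"] by (simp add: carlitz_D_Suc)
  have "carlitz_term (\<theta> * z) (Suc n) = (\<theta> + bracket \<iota> (Suc n)) * z ^ (?q ^ Suc n) / carlitz_D \<iota> (Suc n)"
    by (simp add: carlitz_term_def bracket_def power_mult_distrib)
  also have "\<dots> = \<theta> * carlitz_term z (Suc n) + bracket \<iota> (Suc n) * z ^ (?q ^ Suc n) / carlitz_D \<iota> (Suc n)"
    by (simp add: carlitz_term_def distrib_right add_divide_distrib)
  also have "bracket \<iota> (Suc n) * z ^ (?q ^ Suc n) / carlitz_D \<iota> (Suc n) = carlitz_term z n ^ ?q"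
    using B by (simp add: carlitz_D_Suc carlitz_term_def power_divide mult.commute flip: power_mult)
  finally show ?thesis .
qed

lemma carlitz_exp_theta: "carlitz_exp \<iota> (\<theta> * z) = \<theta> * carlitz_exp \<iota> z + carlitz_exp \<iota> z ^ CARD('f)"
proof (rule LIMSEQ_unique[OF LIMSEQ_Suc[OF carlitz_exp_limit]])
  let ?q = "CARD('f)"
  have "(\<Sum>i<Suc n. carlitz_term (\<theta> * z) i)
      = \<theta> * (\<Sum>i<Suc n. carlitz_term z i) + (\<Sum>i<n. carlitz_term z i) ^ ?q" for n
  proof (induction n)
    case 0
    show ?case
      using fq.q_pos by (simp add: carlitz_term_def zero_power)
  next
    case (Suc n)
    then show ?case
      unfolding sum.lessThan_Suc[of _ "Suc n"] carlitz_term_theta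
      by (simp add: fq.frob_add algebra_simps)
  qed
  then show "(\<lambda>n. \<Sum>i<Suc n. carlitz_term (\<theta> * z) i) \<longlonglongrightarrow> \<theta> * carlitz_exp \<iota> z + carlitz_exp \<iota> z ^ ?q"
    by (simp only:) (intro tendsto_add tendsto_mult tendsto_const tendsto_power_valued carlitz_exp_limit
        LIMSEQ_Suc[OF carlitz_exp_limit])
qed

lemma carlitz_exp_near_0:
  assumes "vabs z \<le> 1"
  shows "vabs (carlitz_exp \<iota> z - z) \<le> vabs z ^ 2"
proof (rule tendsto_upperbound)
  show "(\<lambda>n. vabs ((\<Sum>i<Suc n. carlitz_term z i) - z)) \<longlonglongrightarrow> vabs (carlitz_exp \<iota> z - z)"
    by (intro tendsto_vabs tendsto_diff tendsto_const LIMSEQ_Suc[OF carlitz_exp_limit])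
  have "vabs ((\<Sum>i<Suc n. carlitz_term z i) - z) \<le> vabs z ^ 2" for n
  proof -
    have "vabs (carlitz_term z (Suc i)) \<le> vabs z ^ 2" for i
    proof -
      have "2 ^ 1 \<le> CARD('f) ^ Suc i"
        using card_ge_2[where 'f='f] by (intro order.trans[OF power_mono[of 2 "CARD('f)" 1] power_increasing]) auto
      then have "vabs z ^ (CARD('f) ^ Suc i) \<le> vabs z ^ 2"
        using assms by (intro power_decreasing) auto
      moreover have "vabs (carlitz_term z (Suc i)) \<le> vabs z ^ (CARD('f) ^ Suc i) / 1"
        unfolding carlitz_term_def vabs_divide vabs_power using vabs_carlitz_D_ge_1[of "Suc i"]
        by (intro divide_left_mono) auto
      ultimately show ?thesis
        by simp
    qed
    then have "vabs (\<Sum>i<n. carlitz_term z (Suc i)) \<le> vabs z ^ 2"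
      by (intro vabs_sum_le) auto
    moreover have "carlitz_term z 0 = z"
      by (simp add: carlitz_term_def carlitz_D_def)
    ultimately show ?thesis
      by (subst sum.lessThan_Suc_shift) simp
  qed
  then show "\<forall>\<^sub>F n in sequentially. vabs ((\<Sum>i<Suc n. carlitz_term z i) - z) \<le> vabs z ^ 2"
    by simp
qed simp

text \<open>The difference \<open>D\<close> satisfies the same equation. Near 0, multiplication by
  \<theta> enlarges \<open>D\<close> at most by the factor q, while \<open>D\<close> at y/\<theta>^n
  is of order q^(-2n). So \<open>D\<close> vanishes near 0, and the equation spreads this to every
  point.\<close>

lemma functional_equation_unique:
  assumes G1: "\<And>y. G1 (\<theta> * y) = \<theta> * G1 y + \<kappa> * G1 y ^ CARD('f)"
    and G2: "\<And>y. G2 (\<theta> * y) = \<theta> * G2 y + \<kappa> * G2 y ^ CARD('f)"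
    and d: "d > 0" and C: "C > 0"
    and near1: "\<And>y. vabs y \<le> d \<Longrightarrow> vabs (G1 y - y) \<le> C * vabs y ^ 2"
    and near2: "\<And>y. vabs y \<le> d \<Longrightarrow> vabs (G2 y - y) \<le> C * vabs y ^ 2"
  shows "G1 y = G2 y"
proof -
  let ?q = "CARD('f)"
  define D where "D = (\<lambda>y. G1 y - G2 y)"
  have D_theta: "D (\<theta> * y) = \<theta> * D y + \<kappa> * D y ^ ?q" for y
    unfolding D_def G1 G2 fq.frob_diff by (simp add: right_diff_distrib)
  have D_near: "vabs (D y) \<le> C * vabs y ^ 2" if "vabs y \<le> d" for y
  proof -
    have "D y = (G1 y - y) - (G2 y - y)"
      by (simp add: D_def)
    then have "vabs (D y) \<le> max (vabs (G1 y - y)) (vabs (G2 y - y))"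
      by (simp only: vabs_diff_le)
    then show ?thesis
      using near1[OF that] near2[OF that] by linarith
  qed
  \<comment> \<open>For arguments of absolute value at most \<open>e\<close>, both \<open>D\<close>
    and \<kappa>D have absolute value at most 1, so the term \<kappa>D^q does not outweigh
    \<theta>D.\<close>
  define e where "e = min d (min 1 (1 / ((1 + vabs \<kappa>) * C)))"
  have K: "1 + vabs \<kappa> > 0"
    by (simp add: add_pos_nonneg)
  define M where "M = (1 + vabs \<kappa>) * C"
  have M: "M > 0"
    using K C by (simp add: M_def)
  then have e: "e > 0" "e \<le> d" "e \<le> 1" and "e \<le> 1 / M"
    using d by (auto simp: e_def M_def[symmetric])
  with M have e4: "(1 + vabs \<kappa>) * C * e \<le> 1"
    unfolding M_def[symmetric] by (simp add: pos_le_divide_eq mult.commute)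
  have D_small: "(1 + vabs \<kappa>) * vabs (D y) \<le> 1" if "vabs y \<le> e" for y
  proof -
    have "vabs y ^ 2 \<le> e * 1"
      unfolding power2_eq_square using that e by (intro mult_mono) auto
    then have "C * vabs y ^ 2 \<le> C * e"
      using C by simp
    then have "vabs (D y) \<le> C * e"
      using D_near[of y] that e by linarith
    then have "(1 + vabs \<kappa>) * vabs (D y) \<le> (1 + vabs \<kappa>) * (C * e)"
      using K by (intro mult_left_mono) auto
    then show ?thesis
      using e4 by (simp add: mult.assoc)
  qed
  have D_step: "vabs (D (\<theta> * y)) \<le> real ?q * vabs (D y)" if "vabs y \<le> e" for y
  proof -
    have "vabs (D y) \<le> 1" "vabs \<kappa> * vabs (D y) \<le> 1"
      using D_small[OF that] vabs_nonneg[of "D y"] vabs_nonneg[of \<kappa>]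
      by (auto simp: distrib_right add_increasing2 intro: order.trans[rotated] mult_nonneg_nonneg)
    have "vabs (D y) ^ (?q - 1) \<le> vabs (D y) ^ 1"
      using \<open>vabs (D y) \<le> 1\<close> card_ge_2[where 'f='f] by (intro power_decreasing) auto
    then have "vabs \<kappa> * vabs (D y) ^ (?q - 1) \<le> vabs \<kappa> * vabs (D y)"
      by (intro mult_left_mono) auto
    then have "vabs \<kappa> * vabs (D y) ^ (?q - 1) \<le> real ?q"
      using \<open>vabs \<kappa> * vabs (D y) \<le> 1\<close> card_gt_1 by linarith
    then have "vabs \<kappa> * vabs (D y) ^ (?q - 1) * vabs (D y) \<le> real ?q * vabs (D y)"
      by (intro mult_right_mono) auto
    then have "vabs (\<kappa> * D y ^ ?q) \<le> real ?q * vabs (D y)"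
      by (simp add: fq.power_q_minus_one[of "D y"] vabs_mult vabs_power mult.assoc)
    moreover have "vabs (\<theta> * D y) = real ?q * vabs (D y)"
      by (simp add: vabs_mult vabs_theta)
    ultimately show ?thesis
      using vabs_add_le[of "\<theta> * D y" "\<kappa> * D y ^ ?q"] by (simp add: D_theta)
  qed
  have div_le: "vabs (y / \<theta> ^ n) \<le> vabs y" for y n
    using card_gt_1 mult_left_mono[OF one_le_power[of "real ?q" n], of "vabs y"]
    by (simp add: vabs_divide vabs_power vabs_theta divide_le_eq)
  have D_iter: "vabs (D y) \<le> real ?q ^ n * vabs (D (y / \<theta> ^ n))" if "vabs y \<le> e" for y n
  proof (induction n)
    case (Suc n)
    have "vabs (D (\<theta> * (y / \<theta> ^ Suc n))) \<le> real ?q * vabs (D (y / \<theta> ^ Suc n))"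
      using div_le[of y "Suc n"] that by (intro D_step) linarith
    moreover have "\<theta> * (y / \<theta> ^ Suc n) = y / \<theta> ^ n"
      using theta_nonzero by simp
    ultimately have "real ?q ^ n * vabs (D (y / \<theta> ^ n)) \<le> real ?q ^ n * (real ?q * vabs (D (y / \<theta> ^ Suc n)))"
      by (intro mult_left_mono) simp_all
    with Suc have "vabs (D y) \<le> real ?q ^ n * (real ?q * vabs (D (y / \<theta> ^ Suc n)))"
      by (rule order.trans)
    then show ?case
      by (simp add: mult_ac)
  qed simp
  have D_0: "D y = 0" if y: "vabs y \<le> e" for y
  proof (rule ccontr)
    assume "D y \<noteq> 0"
    then have "vabs (D y) > 0"
      by simp
    from ex_power_gt[OF card_gt_1 this] obtain n where n: "C * vabs y ^ 2 < vabs (D y) * real ?q ^ n"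
      by blast
    have "vabs (D y) \<le> real ?q ^ n * vabs (D (y / \<theta> ^ n))"
      by (rule D_iter[OF y])
    also have "\<dots> \<le> real ?q ^ n * (C * vabs (y / \<theta> ^ n) ^ 2)"
      using div_le[of y n] y e by (intro mult_left_mono D_near) auto
    also have "\<dots> = C * vabs y ^ 2 / real ?q ^ n"
      using card_gt_1 by (simp add: vabs_divide vabs_power vabs_theta power_divide power2_eq_square field_simps)
    finally have "vabs (D y) * real ?q ^ n \<le> C * vabs y ^ 2"
      using card_gt_1 by (simp add: field_simps)
    with n show False
      by simp
  qed
  obtain n where n: "vabs y < e * real ?q ^ n"
    using ex_power_gt[OF card_gt_1 e(1)] by blast
  have "D (\<theta> ^ k * (y / \<theta> ^ n)) = 0" for k
  proof (induction k)
    case 0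
    have "vabs (y / \<theta> ^ n) \<le> e"
      using n card_gt_1 by (simp add: vabs_divide vabs_power vabs_theta divide_le_eq)
    then show ?case
      by (simp add: D_0)
  next
    case (Suc k)
    then show ?case
      using D_theta[of "\<theta> ^ k * (y / \<theta> ^ n)"] fq.q_pos by (simp add: zero_power mult.assoc)
  qed
  from this[of n] show ?thesis
    using theta_nonzero by (simp add: D_def)
qed

end

text \<open>After scaling by \<open>l\<close> with \<open>l\<^sup>q\<^sup>-\<^sup>1 = \<kappa>\<close>, the Carlitz exponential satisfies the functional equation
  of the exponential of the lattice. Comparing zeros, \<open>l\<close> is a unit of \<open>A\<close>.\<close>

lemma (in lattice_of_period) E_theta:
  assumes period: "carlitz_period \<iota> \<omega>"
  shows "E (\<theta> * y) = \<theta> * E y + E y ^ CARD('f)"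
proof -
  let ?q = "CARD('f)"
  obtain \<kappa> where \<kappa>: "\<And>y. E (\<theta> * y) = \<theta> * E y + \<kappa> * E y ^ ?q"
    using E_theta_mult by blast
  \<comment> \<open>Otherwise \<omega>/\<theta> would be a zero of \<open>E\<close>, hence a period,
    and \<theta> would be invertible in A.\<close>
  have "\<kappa> \<noteq> 0"
  proof
    assume "\<kappa> = 0"
    have "\<theta> * E (\<omega> / \<theta>) = E \<omega>"
      using \<kappa>[of "\<omega> / \<theta>"] theta_nonzero \<open>\<kappa> = 0\<close> by simp
    also have "E \<omega> = 0"
      using E_period[of "monom 1 0"] by (simp only: of_A_monom power_0 mult_1_right)
    finally have "\<omega> / \<theta> \<in> lattice \<iota> \<omega>"
      using theta_nonzero by (simp flip: E_eq_0_iff)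
    then obtain a where "\<omega> / \<theta> = \<omega> * of_A \<iota> a"
      by (auto simp: lattice_def)
    then have a: "\<theta> * of_A \<iota> a = 1"
      using omega_nonzero theta_nonzero by (simp add: field_simps)
    then have "a \<noteq> 0"
      by (auto simp: of_A_0)
    then have "real ?q ^ Suc (degree a) = 1"
      using arg_cong[OF a, of vabs] by (simp add: vabs_mult vabs_theta vabs_of_A)
    moreover have "real ?q ^ Suc (degree a) > 1"
      using card_gt_1 by (intro one_less_power) auto
    ultimately show False
      by simp
  qed
  obtain l where l: "l ^ (?q - 1) = \<kappa>"
    using nth_root_exists[of "?q - 1" \<kappa>] card_ge_2[where 'f='f] by auto
  have "l \<noteq> 0"
    using l \<open>\<kappa> \<noteq> 0\<close> card_ge_2[where 'f='f] by (auto simp: zero_power)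
  define C where "C = max (1 / vabs \<omega>) (vabs l)"
  define d where "d = min (vabs \<omega>) (1 / vabs l)"
  have E_eq: "E y = carlitz_exp \<iota> (l * y) / l" for y
  proof (rule functional_equation_unique[where ?G1.0 = E and \<kappa> = \<kappa> and C = C and d = d])
    show "E (\<theta> * y) = \<theta> * E y + \<kappa> * E y ^ ?q" for y
      by (rule \<kappa>)
    show "carlitz_exp \<iota> (l * (\<theta> * y)) / l = \<theta> * (carlitz_exp \<iota> (l * y) / l) + \<kappa> * (carlitz_exp \<iota> (l * y) / l) ^ ?q" for y
    proof -
      have "l ^ ?q = \<kappa> * l"
        by (simp only: fq.power_q_minus_one[of l] l)
      then have "\<kappa> * (carlitz_exp \<iota> (l * y) / l) ^ ?q = carlitz_exp \<iota> (l * y) ^ ?q / l"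
        using \<open>\<kappa> \<noteq> 0\<close> by (simp add: power_divide)
      then show ?thesis
        using carlitz_exp_theta[of "l * y"] by (simp add: mult.left_commute add_divide_distrib)
    qed
    show "d > 0"
      using omega_nonzero \<open>l \<noteq> 0\<close> by (simp add: d_def)
    show "C > 0"
      using \<open>l \<noteq> 0\<close> by (simp add: C_def less_max_iff_disj)
    show "vabs (E y - y) \<le> C * vabs y ^ 2" if "vabs y \<le> d" for y
    proof -
      have "vabs (E y - y) \<le> 1 / vabs \<omega> * vabs y ^ 2"
        using that by (intro E_near_0) (simp add: d_def)
      also have "\<dots> \<le> C * vabs y ^ 2"
        by (intro mult_right_mono) (auto simp: C_def)
      finally show ?thesis .
    qed
    show "vabs (carlitz_exp \<iota> (l * y) / l - y) \<le> C * vabs y ^ 2" if "vabs y \<le> d" for y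
    proof -
      have "vabs (l * y) \<le> 1"
        using that \<open>l \<noteq> 0\<close> by (simp add: d_def vabs_mult pos_le_divide_eq mult.commute)
      then have "vabs (carlitz_exp \<iota> (l * y) - l * y) / vabs l \<le> vabs (l * y) ^ 2 / vabs l"
        by (intro divide_right_mono carlitz_exp_near_0) auto
      moreover have "carlitz_exp \<iota> (l * y) / l - y = (carlitz_exp \<iota> (l * y) - l * y) / l"
        using \<open>l \<noteq> 0\<close> by (simp add: field_simps)
      ultimately have "vabs (carlitz_exp \<iota> (l * y) / l - y) \<le> vabs l * vabs y ^ 2"
        using \<open>l \<noteq> 0\<close> by (simp add: vabs_divide vabs_mult power_mult_distrib power2_eq_square mult_ac)
      also have "\<dots> \<le> C * vabs y ^ 2"
        by (intro mult_right_mono) (auto simp: C_def)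
      finally show ?thesis .
    qed
  qed
  have zeros: "l * y \<in> lattice \<iota> \<omega> \<longleftrightarrow> y \<in> lattice \<iota> \<omega>" for y
  proof -
    have "l * y \<in> lattice \<iota> \<omega> \<longleftrightarrow> carlitz_exp \<iota> (l * y) = 0"
      using period by (auto simp: carlitz_period_def)
    also have "\<dots> \<longleftrightarrow> E y = 0"
      using E_eq[of y] \<open>l \<noteq> 0\<close> by simp
    finally show ?thesis
      by (simp only: E_eq_0_iff)
  qed
  \<comment> \<open>By \<open>zeros\<close> at \<omega> and \<omega>/l, both \<open>l\<close> and
    \<open>1 / l\<close> lie in A. Their degrees add up to 0, so \<open>l\<close> is a constant and
    \<open>l ^ (q - 1) = 1\<close>.\<close>
  have "\<omega> \<in> lattice \<iota> \<omega>"
    using of_A_monom[of 0] by (auto simp: lattice_def intro!: image_eqI[where x = "monom 1 0"])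
  then have "l * \<omega> \<in> lattice \<iota> \<omega>" "\<omega> / l \<in> lattice \<iota> \<omega>"
    using zeros[of \<omega>] zeros[of "\<omega> / l"] \<open>l \<noteq> 0\<close> by auto
  then obtain a b where "l * \<omega> = \<omega> * of_A \<iota> a" "\<omega> / l = \<omega> * of_A \<iota> b"
    unfolding lattice_def by blast
  then have a: "l = of_A \<iota> a" and b: "1 / l = of_A \<iota> b"
    using omega_nonzero \<open>l \<noteq> 0\<close> by (auto simp: field_simps)
  have "a \<noteq> 0" "b \<noteq> 0"
    using a b \<open>l \<noteq> 0\<close> by (auto simp: of_A_0)
  then have "vabs l = real ?q ^ degree a" "vabs (1 / l) = real ?q ^ degree b"
    unfolding b by (simp_all add: a vabs_of_A)
  then have "real ?q ^ (degree a + degree b) = vabs (l * (1 / l))"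
    by (simp only: vabs_mult power_add)
  then have "real ?q ^ (degree a + degree b) = 1"
    using \<open>l \<noteq> 0\<close> by simp
  then have "degree a = 0"
    using card_gt_1 one_less_power[of "real ?q" "degree a + degree b"] by fastforce
  then obtain x where "a = [:x:]"
    by (metis degree_eq_zeroE)
  then have "l = emb x" "x \<noteq> 0"
    using a \<open>a \<noteq> 0\<close> by (auto simp: of_A_pCons of_A_0)
  then have "l ^ (?q - 1) = emb (x ^ (?q - 1))"
    by (simp only: fq.emb_power)
  then have "\<kappa> = 1"
    using l power_card_minus_one[OF \<open>x \<noteq> 0\<close>] by (simp add: hom_one)
  then show ?thesis
    using \<kappa>[of y] by simp
qed

section \<open>The forms at a point\<close>

text \<open>The image of K_infinity is closed: Laurent series approximating \<open>z\<close> with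
  errors tending to 0 have stabilizing coefficients, and the series of the stable coefficients would
  be \<open>z\<close>.\<close>

lemma (in C_infinity) distance_to_range:
  assumes z: "z \<in> Omega \<iota>"
  obtains \<delta> where "\<delta> > 0" "\<And>s. \<delta> \<le> vabs (z - \<iota> s)"
proof (rule ccontr)
  let ?q = "real CARD('f)"
  assume "\<not> thesis"
  then have "\<exists>s. vabs (z - \<iota> s) < (1 / ?q) ^ n" for n
    using that card_gt_1 by (metis divide_pos_pos less_trans not_less zero_less_one zero_less_power)
  then obtain s where s: "\<And>n. vabs (z - \<iota> (s n)) < (1 / ?q) ^ n"
    by metis
  have agree: "fls_nth (s m) k = fls_nth (s n) k" if "n \<le> m" "k \<le> int n" for m n k
  proof (rule ccontr)
    assume neq: "fls_nth (s m) k \<noteq> fls_nth (s n) k"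
    then have k: "fls_nth (s m - s n) k \<noteq> 0"
      by simp
    have "vabs (z - \<iota> (s m)) < (1 / ?q) ^ n"
      by (rule order.strict_trans2[OF s power_decreasing[OF that(1)]]) (use card_gt_1 in auto)
    moreover have "\<iota> (s m - s n) = (z - \<iota> (s n)) - (z - \<iota> (s m))"
      by (simp add: hom_diff)
    ultimately have "vabs (\<iota> (s m - s n)) < (1 / ?q) ^ n"
      using vabs_diff_le[of "z - \<iota> (s n)" "z - \<iota> (s m)"] s[of n] by simp
    moreover have "s m - s n \<noteq> 0"
      using k by auto
    ultimately have "?q powi (- fls_subdegree (s m - s n)) < ?q powi (- int n)"
      by (simp add: vabs_hom power_int_minus power_one_over inverse_eq_divide)
    then have "int n < fls_subdegree (s m - s n)"
      using card_gt_1 by (metis linorder_not_less neg_le_iff_le less_imp_le power_int_increasing)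
    then show False
      using k that(2) by (metis fls_eq0_below_subdegree le_less_trans)
  qed
  \<comment> \<open>By \<open>agree\<close>, the k-th coefficient is stable from index
    \<open>nat k\<close> on; for negative \<open>k\<close> this is index 0.\<close>
  define f where "f = (\<lambda>k. fls_nth (s (nat k)) k)"
  define t where "t = Abs_fls f"
  have t: "fls_nth t k = fls_nth (s (nat k)) k" for k
  proof -
    have "\<forall>k<min 0 (fls_subdegree (s 0)). f k = 0"
      by (auto simp: f_def)
    then show ?thesis
      unfolding t_def f_def by (rule nth_Abs_fls_lower_bound)
  qed
  have "vabs (z - \<iota> t) \<le> (1 / ?q) ^ n" for n
  proof -
    have "vabs (\<iota> (t - s n)) \<le> (1 / ?q) ^ n"
    proof (cases "t - s n = 0")
      case True
      then show ?thesis
        by (simp add: hom_zero)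
    next
      case False
      have "fls_nth (t - s n) k = 0" if "k < int n" for k
        using agree[of "nat k" n k] that by (simp add: t)
      then have "int n \<le> fls_subdegree (t - s n)"
        by (intro fls_subdegree_geI[OF False]) auto
      then have "?q powi (- fls_subdegree (t - s n)) \<le> ?q powi (- int n)"
        using card_gt_1 by (intro power_int_increasing) auto
      then show ?thesis
        using False by (simp add: vabs_hom power_int_minus power_one_over inverse_eq_divide)
    qed
    then have "vabs ((z - \<iota> (s n)) - \<iota> (t - s n)) \<le> (1 / ?q) ^ n"
      using vabs_diff_le[of "z - \<iota> (s n)" "\<iota> (t - s n)"] s[of n] by linarith
    then show ?thesis
      by (simp add: hom_diff)
  qed
  moreover have "(\<lambda>n. (1 / ?q) ^ n) \<longlonglongrightarrow> 0"
    using card_gt_1 by (intro LIMSEQ_power_zero) simp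
  ultimately have "vabs (z - \<iota> t) \<le> 0"
    by (intro LIMSEQ_le_const) auto
  then have "vabs (z - \<iota> t) = 0"
    by (intro order.antisym) auto
  then have "z = \<iota> t"
    by simp
  with z show False
    by (simp add: Omega_def)
qed

section \<open>Growth of the exponential along Az and convergence of the sums\<close>

locale point_of_Omega = lattice_of_period \<iota> \<omega>
  for \<iota> :: "'f::{finite,field} fls \<Rightarrow> 'c::{valued_field,alg_closed_field,complete_space}" and \<omega> +
  fixes z :: 'c
  assumes period: "carlitz_period \<iota> \<omega>" and Omega: "z \<in> Omega \<iota>"
begin

abbreviation W :: "'f poly \<Rightarrow> 'c" where "W c \<equiv> E (\<omega> * of_A \<iota> c * z)"

text \<open>For a period \<omega>a the quotient a/c lies in K_infinity, so \<omega>cz keeps a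
  distance proportional to the absolute value of \<open>c\<close> from all periods. By
  \<open>E_lower_bound\<close> with varying \<open>k\<close>, the values outgrow every power of that
  absolute value.\<close>

lemma W_lower_bound:
  obtains C where "C > 0"
    and "\<And>c. c \<noteq> 0 \<Longrightarrow> C * (real CARD('f) ^ degree c) ^ (CARD('f) ^ k) \<le> vabs (W c)"
proof -
  let ?q = "real CARD('f)" and ?M = "CARD('f) ^ k"
  obtain \<delta> where \<delta>: "\<delta> > 0" "\<And>s. \<delta> \<le> vabs (z - \<iota> s)"
    using distance_to_range[OF Omega] by blast
  obtain C where C: "C > 0" "\<And>y. \<exists>a. C * vabs (y - \<omega> * of_A \<iota> a) ^ ?M \<le> vabs (E y)"
    using E_lower_bound by blast
  have "C * (vabs \<omega> * \<delta>) ^ ?M * (?q ^ degree c) ^ ?M \<le> vabs (W c)" if "c \<noteq> 0" for c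
  proof -
    obtain a where a: "C * vabs (\<omega> * of_A \<iota> c * z - \<omega> * of_A \<iota> a) ^ ?M \<le> vabs (W c)"
      using C(2) by blast
    obtain s where s: "of_A \<iota> a = of_A \<iota> c * \<iota> s"
    proof -
      obtain a' c' where ac: "of_A \<iota> a = \<iota> a'" "of_A \<iota> c = \<iota> c'"
        using of_A_range by blast
      then have "c' \<noteq> 0"
        using of_A_eq_0_iff[of c] \<open>c \<noteq> 0\<close> by (auto simp: hom_zero)
      then have "of_A \<iota> a = of_A \<iota> c * \<iota> (a' / c')"
        unfolding ac hom_mult[symmetric] by simp
      then show ?thesis
        by (rule that)
    qed
    have "\<omega> * of_A \<iota> c * z - \<omega> * of_A \<iota> a = \<omega> * of_A \<iota> c * (z - \<iota> s)"
      by (simp add: s algebra_simps)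
    then have "vabs (\<omega> * of_A \<iota> c * z - \<omega> * of_A \<iota> a) = vabs \<omega> * ?q ^ degree c * vabs (z - \<iota> s)"
      using that by (simp add: vabs_mult vabs_of_A)
    also have "\<dots> \<ge> vabs \<omega> * ?q ^ degree c * \<delta>"
      using \<delta>(2) by (intro mult_left_mono) auto
    finally have "(vabs \<omega> * \<delta> * ?q ^ degree c) ^ ?M \<le> vabs (\<omega> * of_A \<iota> c * z - \<omega> * of_A \<iota> a) ^ ?M"
      using \<delta>(1) by (intro power_mono) (simp_all add: mult_ac)
    then have "C * (vabs \<omega> * \<delta> * ?q ^ degree c) ^ ?M \<le> vabs (W c)"
      using C(1) a by (meson less_imp_le mult_left_mono order.trans)
    then show ?thesis
      by (simp add: power_mult_distrib mult.assoc)
  qed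
  moreover have "C * (vabs \<omega> * \<delta>) ^ ?M > 0"
    using C(1) \<delta>(1) omega_nonzero by simp
  ultimately show ?thesis
    using that by blast
qed

sublocale M: carlitz_lattice emb "CARD('f)" W \<theta>
proof
  show "fq.fq_linear W"
    by (simp add: fq.fq_linear_def of_A_add of_A_smult E_add[symmetric] E_scale[symmetric] algebra_simps)
  show "W a \<noteq> 0" if a: "a \<noteq> 0" for a
  proof -
    obtain C where "C > 0" "C * (real CARD('f) ^ degree a) ^ (CARD('f) ^ 0) \<le> vabs (W a)"
      using W_lower_bound[of 0] a by metis
    moreover have "0 < C * (real CARD('f) ^ degree a) ^ (CARD('f) ^ 0)"
      using \<open>C > 0\<close> card_gt_1 by simp
    ultimately show ?thesis
      by (metis not_less vabs_zero)
  qed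
  show "W (monom 1 (Suc n)) = \<theta> * W (monom 1 n) + 1 * W (monom 1 n) ^ CARD('f)" for n
    using E_theta[OF period, of "\<omega> * of_A \<iota> (monom 1 n) * z"] by (simp add: of_A_monom mult_ac)
qed

lemma u_eq: "u \<iota> \<omega> c z = 1 / W c"
  by (simp add: u_def)

text \<open>The bound of \<open>W_lower_bound\<close> with exponent at least \<open>m + 1\<close>
  beats the numerator and leaves terms of size at most 1/(C q^(deg c)).\<close>

lemma sum_limit:
  assumes l: "1 \<le> l"
  shows "(\<lambda>n. \<Sum>c\<in>monic_below n. of_A \<iota> c ^ m * u \<iota> \<omega> c z ^ l)
    \<longlonglongrightarrow> (\<Sum>\<^sub>\<infinity>c\<in>A_plus. of_A \<iota> c ^ m * u \<iota> \<omega> c z ^ l)"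
proof (rule infsum_limit)
  let ?q = "real CARD('f)"
  show "\<exists>N. \<forall>c\<in>A_plus - monic_below N. vabs (of_A \<iota> c ^ m * u \<iota> \<omega> c z ^ l) < e" if "e > 0" for e
  proof -
    define M where "M = CARD('f) ^ m"
    have "Suc m \<le> 2 ^ m"
      by (rule Suc_leI) simp
    also have "\<dots> \<le> M"
      unfolding M_def using card_ge_2[where 'f='f] by (intro power_mono) auto
    finally have M: "Suc m \<le> M" .
    obtain C where C: "C > 0" "\<And>c. c \<noteq> 0 \<Longrightarrow> C * (?q ^ degree c) ^ M \<le> vabs (W c)"
      unfolding M_def using W_lower_bound[of m] by metis
    \<comment> \<open>The bound by 1 gives \<open>vabs (W c) \<ge> 1\<close>, so that the power
      \<open>l\<close> in the denominator can be lowered to 1.\<close>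
    obtain N where N: "max 1 (1 / e) < C * ?q ^ N"
      using ex_power_gt[OF card_gt_1 C(1)] by blast
    have "vabs (of_A \<iota> c ^ m * u \<iota> \<omega> c z ^ l) < e" if c: "c \<in> A_plus - monic_below N" for c
    proof -
      define x where "x = ?q ^ degree c"
      have "c \<noteq> 0" and deg: "N \<le> degree c"
        using c by (auto simp: A_plus_def monic_below_def)
      have x: "?q ^ N \<le> x" "1 \<le> x"
        using deg card_gt_1 by (simp_all add: x_def power_increasing one_le_power)
      then have Cx: "max 1 (1 / e) < C * x"
        using N mult_left_mono[OF x(1), of C] C(1) by linarith
      have "x ^ Suc m \<le> x ^ M"
        using M x by (intro power_increasing) auto
      then have "C * x ^ Suc m \<le> C * x ^ M"
        using C(1) by simp
      also have "\<dots> \<le> vabs (W c)"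
        using C(2)[OF \<open>c \<noteq> 0\<close>] by (simp add: x_def)
      finally have W: "C * x * x ^ m \<le> vabs (W c)"
        by (simp add: mult.assoc)
      have "1 * 1 \<le> C * x * x ^ m"
        using Cx x by (intro mult_mono one_le_power) auto
      then have W1: "1 \<le> vabs (W c)"
        using W by simp
      then have Wl: "vabs (W c) ^ 1 \<le> vabs (W c) ^ l"
        using l by (intro power_increasing) auto
      have "vabs (of_A \<iota> c ^ m * u \<iota> \<omega> c z ^ l) = x ^ m / vabs (W c) ^ l"
        using \<open>c \<noteq> 0\<close> by (simp add: u_eq vabs_mult vabs_power vabs_divide vabs_of_A x_def power_one_over)
      also have "\<dots> \<le> x ^ m / (C * x * x ^ m)"
        using Wl W W1 Cx x C(1) by (intro divide_left_mono mult_pos_pos) auto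
      also have "\<dots> = 1 / (C * x)"
        using x by simp
      also have "\<dots> < e"
        using Cx \<open>e > 0\<close> by (simp add: field_simps)
      finally show ?thesis .
    qed
    then show ?thesis
      by blast
  qed
  show "finite (monic_below n)" for n
    by (rule finite_monic_below)
  show "monic_below n \<subseteq> A_plus" for n
    by (auto simp: monic_below_def)
  show "incseq monic_below"
    by (auto simp: incseq_def monic_below_def)
qed

section \<open>The forms as limits of quantities of finite level\<close>

definition frob_power :: "nat \<Rightarrow> 'f poly \<Rightarrow> 'c" where
  "frob_power \<nu> c = of_A \<iota> c ^ (CARD('f) ^ \<nu>)"

lemma frob_power_Suc: "frob_power (Suc \<nu>) = (\<lambda>c. frob_power \<nu> c ^ CARD('f))"
  by (simp add: frob_power_def fun_eq_iff mult.commute flip: power_mult)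

lemma frob_power_linear: "fq.fq_linear (frob_power \<nu>)"
proof (induction \<nu>)
  case 0
  show ?case
    by (simp add: frob_power_def fq.fq_linear_def of_A_add of_A_smult)
next
  case (Suc \<nu>)
  then show ?case
    by (simp add: frob_power_Suc fq.fq_linear_def fq.frob_add power_mult_distrib fq.emb_power_q)
qed

lemma frob_power_monom:
  "frob_power \<nu> (monom 1 (Suc n)) = \<theta> ^ (CARD('f) ^ \<nu>) * frob_power \<nu> (monom 1 n)"
  "frob_power \<nu> (monom 1 0) = 1"
  by (simp_all only: frob_power_def of_A_monom) (simp_all add: power_mult_distrib)

lemma f_form_limit:
  assumes "1 \<le> l" "l \<le> CARD('f)"
  shows "(\<lambda>n. M.alpha (frob_power \<nu>) n ^ l) \<longlonglongrightarrow> f_form \<iota> \<omega> l \<nu> z"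
proof -
  have "of_A \<iota> c ^ (l * CARD('f) ^ \<nu>) * u \<iota> \<omega> c z ^ l = (frob_power \<nu> c / W c) ^ l" for c
    by (simp add: frob_power_def u_eq power_divide mult.commute flip: power_mult)
  then show ?thesis
    using sum_limit[OF assms(1), of "l * CARD('f) ^ \<nu>"] M.sum_monic_powers[OF assms frob_power_linear]
    by (simp add: f_form_def)
qed

lemma alpha_limit: "M.alpha (frob_power \<nu>) \<longlonglongrightarrow> f_form \<iota> \<omega> 1 \<nu> z"
  using f_form_limit[of 1 \<nu>] fq.q_pos by simp

text \<open>At finite level the l-th power relation is exact by \<open>sum_monic_powers\<close>. It
  reduces the theorem to \<open>l = 1\<close>.\<close>

lemma f_form_power:
  assumes "1 \<le> l" "l \<le> CARD('f)"
  shows "f_form \<iota> \<omega> l \<nu> z = f_form \<iota> \<omega> 1 \<nu> z ^ l"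
  using f_form_limit[OF assms] tendsto_power_valued[OF alpha_limit] by (rule LIMSEQ_unique)

lemma f_form_1_1: "f_form \<iota> \<omega> 1 1 z = h_form \<iota> \<omega> z"
  by (simp add: f_form_def h_form_def)

lemma S_limit: "M.S \<longlonglongrightarrow> (\<Sum>\<^sub>\<infinity>c\<in>A_plus. u \<iota> \<omega> c z ^ (CARD('f) - 1))"
proof -
  have "1 \<le> CARD('f) - 1"
    using fq.q_ge_2 by simp
  from sum_limit[OF this, of 0] show ?thesis
    by (simp only: power_0 mult_1 u_eq M.sum_monic_inverse_powers)
qed

lemma G_limit: "(\<lambda>n. 1 - (\<theta> ^ CARD('f) - \<theta>) * M.S (Suc n)) \<longlonglongrightarrow> g_form \<iota> \<omega> z"
  unfolding g_form_def by (intro tendsto_diff tendsto_mult tendsto_const LIMSEQ_Suc S_limit)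

lemma g_coeff_limit: "M.g_coeff \<longlonglongrightarrow> g_form \<iota> \<omega> z"
proof -
  let ?s = "\<Sum>\<^sub>\<infinity>c\<in>A_plus. u \<iota> \<omega> c z ^ (CARD('f) - 1)"
  have "M.g_coeff \<longlonglongrightarrow> 1 - \<theta> ^ CARD('f) * ?s + \<theta> * ?s"
    unfolding M.g_coeff_def[abs_def]
    by (intro tendsto_add tendsto_diff tendsto_mult tendsto_const LIMSEQ_Suc S_limit)
  then show ?thesis
    by (simp add: g_form_def algebra_simps)
qed

lemma frob_power_1_monom:
  "frob_power 1 (monom 1 (Suc n)) = \<theta> ^ CARD('f) * frob_power 1 (monom 1 n)"
  "frob_power 1 (monom 1 0) = 1"
  using frob_power_monom[of 1] by simp_all

lemma D_coeff_limit: "M.D_coeff \<longlonglongrightarrow> - (h_form \<iota> \<omega> z ^ (CARD('f) - 1))"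
proof -
  have "M.D_coeff = (\<lambda>n. - (M.alpha (frob_power 1) (Suc n) ^ (CARD('f) - 1)))"
    using M.D_coeff_eq(1)[of "frob_power 1", OF frob_power_1_monom] by (simp add: fun_eq_iff)
  then show ?thesis
    using alpha_limit[of 1] unfolding f_form_1_1
    by (simp only:) (intro tendsto_minus tendsto_power_valued LIMSEQ_Suc)
qed

text \<open>Since \<open>r n = lc n * P\<close>, the recursion divides the absolute value of
  \<open>lc\<close> by that of \<open>P ^ (q - 1)\<close>. Here \<open>P\<close> is a product of
  values at monic polynomials of degree \<open>n\<close>, each of absolute value at least 2 for
  large \<open>n\<close>.\<close>

lemma lc_limit: "M.lc \<longlonglongrightarrow> 0"
proof -
  let ?q = "real CARD('f)"
  obtain C where C: "C > 0" "\<And>c. c \<noteq> 0 \<Longrightarrow> C * (?q ^ degree c) ^ (CARD('f) ^ 0) \<le> vabs (W c)"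
    using W_lower_bound[of 0] by metis
  obtain N where N: "2 < C * ?q ^ N"
    using ex_power_gt[OF card_gt_1 C(1)] by blast
  have half: "vabs (M.lc (Suc n)) \<le> vabs (M.lc n) * (1 / 2)" if "N \<le> n" for n
  proof -
    define P where "P = (\<Prod>c\<in>polys_below n. M.v n + W c)"
    have large: "2 \<le> vabs (M.v n + W c)" if c: "c \<in> polys_below n" for c
    proof -
      have "monom 1 n + c \<noteq> 0"
        using monom_add_below(2)[OF c] by (metis leading_coeff_0_iff zero_neq_one)
      moreover have "degree (monom 1 n + c) = n"
        by (rule monom_add_below(1)[OF c])
      ultimately have "C * ?q ^ n \<le> vabs (W (monom 1 n + c))"
        using C(2)[of "monom 1 n + c"] by simp
      moreover have "C * ?q ^ N \<le> C * ?q ^ n"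
        using C(1) \<open>N \<le> n\<close> card_gt_1 by (intro mult_left_mono power_increasing) auto
      ultimately show ?thesis
        using N unfolding M.V_add by linarith
    qed
    have P: "2 \<le> vabs P"
    proof -
      have "1 \<le> (\<Prod>c\<in>polys_below n - {0}. vabs (M.v n + W c))"
      proof (rule prod_ge_1)
        fix c :: "'f poly"
        assume "c \<in> polys_below n - {0}"
        then have "2 \<le> vabs (M.v n + W c)"
          by (intro large) simp
        then show "1 \<le> vabs (M.v n + W c)"
          by linarith
      qed
      with large[OF zero_in_polys_below]
      have "2 * 1 \<le> vabs (M.v n + W 0) * (\<Prod>c\<in>polys_below n - {0}. vabs (M.v n + W c))"
        by (rule mult_mono) simp_all
      then show ?thesis
        unfolding P_def vabs_prod by (subst prod.remove[OF finite_polys_below zero_in_polys_below]) simp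
    qed
    have "M.r n = M.lc n * P"
      unfolding P_def by (rule M.fq_exp_prod)
    then have "vabs (M.lc (Suc n)) = vabs (M.lc n) ^ CARD('f) / (vabs (M.lc n) * vabs P) ^ (CARD('f) - 1)"
      by (simp add: M.lc.simps(2) vabs_divide vabs_power vabs_mult)
    also have "vabs (M.lc n) ^ CARD('f) = vabs (M.lc n) * vabs (M.lc n) ^ (CARD('f) - 1)"
      by (rule trans[OF power_minus_mult[OF fq.q_pos, symmetric] mult.commute])
    also have "vabs (M.lc n) * vabs (M.lc n) ^ (CARD('f) - 1) / (vabs (M.lc n) * vabs P) ^ (CARD('f) - 1)
        = vabs (M.lc n) * (1 / vabs P ^ (CARD('f) - 1))"
      using M.lc_nonzero[of n] by (simp add: power_mult_distrib)
    also have "\<dots> \<le> vabs (M.lc n) * (1 / 2)"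
    proof (intro mult_left_mono divide_left_mono)
      have "vabs P ^ 1 \<le> vabs P ^ (CARD('f) - 1)"
        using P fq.q_ge_2 by (intro power_increasing) auto
      then show "2 \<le> vabs P ^ (CARD('f) - 1)"
        using P by simp
      then show "0 < vabs P ^ (CARD('f) - 1) * 2"
        by simp
    qed auto
    finally show ?thesis .
  qed
  have bound: "vabs (M.lc (k + N)) \<le> vabs (M.lc N) * (1 / 2) ^ k" for k
  proof (induction k)
    case (Suc k)
    have "vabs (M.lc (Suc (k + N))) \<le> vabs (M.lc (k + N)) * (1 / 2)"
      by (rule half) simp
    then show ?case
      using Suc by simp
  qed simp
  have "(\<lambda>k. vabs (M.lc N) * (1 / 2) ^ k) \<longlonglongrightarrow> vabs (M.lc N) * 0"
    by (intro tendsto_mult_left LIMSEQ_power_zero) simp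
  then have lim: "(\<lambda>k. vabs (M.lc N) * (1 / 2) ^ k) \<longlonglongrightarrow> 0"
    by simp
  have "(\<lambda>k. vabs (M.lc (k + N))) \<longlonglongrightarrow> 0"
    by (intro tendsto_sandwich[OF _ _ tendsto_const lim]) (auto intro: always_eventually bound)
  then have "(\<lambda>k. M.lc (k + N)) \<longlonglongrightarrow> 0"
    by (simp only: tendsto_vabs_zero_iff)
  then show ?thesis
    by (rule LIMSEQ_offset)
qed

text \<open>By \<open>D_coeff_eq(2)\<close>, where \<open>S\<close> is bounded and \<open>lc\<close> tends to \<open>0\<close>, the absolute value of \<open>alpha\<close> is
  eventually constant.\<close>

lemma h_form_nonzero: "h_form \<iota> \<omega> z \<noteq> 0"
proof -
  let ?a = "M.alpha (frob_power 1)"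
  define w where "w = (\<lambda>n. (1 - (\<theta> ^ CARD('f) - \<theta>) * M.S (Suc n)) * M.lc (Suc n) ^ (CARD('f) - 1))"
  have "w \<longlonglongrightarrow> g_form \<iota> \<omega> z * 0 ^ (CARD('f) - 1)"
    unfolding w_def by (intro tendsto_mult G_limit tendsto_power_valued LIMSEQ_Suc lc_limit)
  then have "w \<longlonglongrightarrow> 0"
    using fq.q_ge_2 by (simp add: zero_power)
  then have "(\<lambda>n. vabs (w n)) \<longlonglongrightarrow> 0"
    by (simp only: tendsto_vabs_zero_iff)
  then have "\<forall>\<^sub>F n in sequentially. vabs (w n) < 1"
    by (rule order_tendstoD) simp
  then obtain N where N: "\<And>n. n \<ge> N \<Longrightarrow> vabs (w n) < 1"
    by (auto simp: eventually_sequentially)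
  have const: "vabs (?a (Suc (Suc n))) = vabs (?a (Suc n))" if "n \<ge> N" for n
  proof -
    have "vabs (1 - w n) = 1"
      using vabs_add_eq[of "- w n" 1] N[OF that] by simp
    then have "vabs (?a (Suc (Suc n)) * (1 - w n)) = vabs (?a (Suc (Suc n)))"
      by (simp add: vabs_mult)
    moreover have "?a (Suc (Suc n)) * (1 - w n) = ?a (Suc n)"
      unfolding w_def by (rule M.D_coeff_eq(2)[of "frob_power 1", OF frob_power_1_monom])
    ultimately show ?thesis
      by (simp only:)
  qed
  have "vabs (?a (Suc n)) = vabs (?a (Suc N))" if "n \<ge> N" for n
    using that
  proof (induction n rule: dec_induct)
    case (step n)
    then show ?case
      by (simp only: const)
  qed simp
  then have "(\<lambda>n. vabs (?a (Suc n))) \<longlonglongrightarrow> vabs (?a (Suc N))"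
    by (intro tendsto_eventually eventually_sequentiallyI[of N]) blast
  moreover have "(\<lambda>n. vabs (?a (Suc n))) \<longlonglongrightarrow> vabs (h_form \<iota> \<omega> z)"
    using alpha_limit[of 1] unfolding f_form_1_1 by (intro tendsto_vabs LIMSEQ_Suc)
  ultimately have "vabs (h_form \<iota> \<omega> z) = vabs (?a (Suc N))"
    by (metis LIMSEQ_unique)
  moreover have "?a (Suc N) \<noteq> 0"
    by (rule M.D_coeff_eq(3)[of "frob_power 1", OF frob_power_1_monom])
  ultimately show ?thesis
    by (metis vabs_eq_0_iff)
qed

text \<open>The limit of \<open>recurrence\<close> with t = \<theta>^(q^\<mu>), where \<theta>f - tf
  is minus the bracket times f. Solving for the leading term is possible by
  \<open>h_form_nonzero\<close>.\<close>

lemma f_form_recurrence: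
  "f_form \<iota> \<omega> 1 (Suc (Suc \<mu>)) z
    = g_form \<iota> \<omega> z ^ CARD('f) / h_form \<iota> \<omega> z ^ (CARD('f) - 1) * f_form \<iota> \<omega> 1 (Suc \<mu>) z ^ CARD('f)
      - bracket \<iota> \<mu> ^ (CARD('f)\<^sup>2) / h_form \<iota> \<omega> z ^ (CARD('f) - 1) * f_form \<iota> \<omega> 1 \<mu> z ^ (CARD('f)\<^sup>2)"
proof -
  let ?q = "CARD('f)"
  define f where "f = (\<lambda>\<nu>. f_form \<iota> \<omega> 1 \<nu> z)"
  let ?g = "g_form \<iota> \<omega> z" and ?h = "h_form \<iota> \<omega> z" and ?a = "\<lambda>\<nu>. M.alpha (frob_power \<nu>)"
  define t where "t = \<theta> ^ (?q ^ \<mu>)"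
  have lim: "?a \<nu> \<longlonglongrightarrow> f \<nu>" for \<nu>
    unfolding f_def by (rule alpha_limit)
  have rec: "- (?a (Suc (Suc \<mu>)) (Suc n) * M.D_coeff n)
      = ?a (Suc \<mu>) (Suc n) ^ ?q * M.g_coeff n ^ ?q + ((\<theta> * ?a \<mu> (Suc n) - t * ?a \<mu> n) ^ ?q) ^ ?q" for n
    using M.recurrence[of "frob_power \<mu>" t n] frob_power_monom[of \<mu>] unfolding frob_power_Suc t_def by simp
  have eq: "- (f (Suc (Suc \<mu>)) * - (?h ^ (?q - 1))) = f (Suc \<mu>) ^ ?q * ?g ^ ?q + ((\<theta> * f \<mu> - t * f \<mu>) ^ ?q) ^ ?q"
  proof (rule LIMSEQ_unique)
    show "(\<lambda>n. - (?a (Suc (Suc \<mu>)) (Suc n) * M.D_coeff n)) \<longlonglongrightarrow> - (f (Suc (Suc \<mu>)) * - (?h ^ (?q - 1)))"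
      by (intro tendsto_minus tendsto_mult LIMSEQ_Suc lim D_coeff_limit)
    show "(\<lambda>n. - (?a (Suc (Suc \<mu>)) (Suc n) * M.D_coeff n))
        \<longlonglongrightarrow> f (Suc \<mu>) ^ ?q * ?g ^ ?q + ((\<theta> * f \<mu> - t * f \<mu>) ^ ?q) ^ ?q"
      unfolding rec
      by (intro tendsto_add tendsto_mult tendsto_diff tendsto_power_valued tendsto_const LIMSEQ_Suc lim g_coeff_limit)
  qed
  have square: "x ^ (?q\<^sup>2) = (x ^ ?q) ^ ?q" for x :: 'c
    by (simp only: power2_eq_square power_mult)
  have diff: "\<theta> * f \<mu> - t * f \<mu> = - (bracket \<iota> \<mu> * f \<mu>)"
    by (simp add: bracket_def t_def algebra_simps)
  have "f (Suc (Suc \<mu>)) * ?h ^ (?q - 1)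
      = ?g ^ ?q * f (Suc \<mu>) ^ ?q - bracket \<iota> \<mu> ^ (?q\<^sup>2) * f \<mu> ^ (?q\<^sup>2)"
    using eq unfolding diff fq.frob_minus power_mult_distrib square
    by (simp only: mult_minus_right minus_minus mult.commute[of "?g ^ ?q"]) simp
  then have "f (Suc (Suc \<mu>)) = (?g ^ ?q * f (Suc \<mu>) ^ ?q - bracket \<iota> \<mu> ^ (?q\<^sup>2) * f \<mu> ^ (?q\<^sup>2)) / ?h ^ (?q - 1)"
    using h_form_nonzero by (simp add: eq_divide_eq)
  then show ?thesis
    by (simp add: f_def diff_divide_distrib)
qed

text \<open>The bracket [0] is 0, so only the first term of the recurrence remains, with f_{1,1} =
  h.\<close>

lemma f_form_2: "f_form \<iota> \<omega> 1 2 z = h_form \<iota> \<omega> z * g_form \<iota> \<omega> z ^ CARD('f)"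
proof -
  let ?h = "h_form \<iota> \<omega> z"
  have "bracket \<iota> 0 = 0"
    by (simp add: bracket_def)
  then have "f_form \<iota> \<omega> 1 2 z = g_form \<iota> \<omega> z ^ CARD('f) / ?h ^ (CARD('f) - 1) * ?h ^ CARD('f)"
    using f_form_recurrence[of 0] f_form_1_1 fq.q_pos by (simp add: numeral_2_eq_2 zero_power)
  also have "\<dots> = ?h * g_form \<iota> \<omega> z ^ CARD('f)"
    using h_form_nonzero by (simp add: fq.power_q_minus_one[of ?h, simplified])
  finally show ?thesis .
qed

end

theorem theorem4p7:
  fixes \<iota> :: "'f::{finite,field} fls \<Rightarrow> 'c::{valued_field,alg_closed_field,complete_space}"
    and \<omega> :: 'c and l :: nat
  assumes "C_infinity \<iota>"
    and "carlitz_period \<iota> \<omega>"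
    and "1 \<le> l" and "l \<le> CARD('f)"
  shows "(\<forall>z\<in>Omega \<iota>. f_form \<iota> \<omega> l 1 z = h_form \<iota> \<omega> z ^ l) \<and>
    (\<forall>z\<in>Omega \<iota>. f_form \<iota> \<omega> l 2 z = h_form \<iota> \<omega> z ^ l * g_form \<iota> \<omega> z ^ (l * CARD('f))) \<and>
    (\<forall>\<nu>\<ge>2. \<forall>z\<in>Omega \<iota>.
      f_form \<iota> \<omega> l \<nu> z =
        (g_form \<iota> \<omega> z ^ CARD('f) / h_form \<iota> \<omega> z ^ (CARD('f) - 1)
            * f_form \<iota> \<omega> 1 (\<nu> - 1) z ^ CARD('f)
         - bracket \<iota> (\<nu> - 2) ^ (CARD('f)\<^sup>2) / h_form \<iota> \<omega> z ^ (CARD('f) - 1)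
            * f_form \<iota> \<omega> 1 (\<nu> - 2) z ^ (CARD('f)\<^sup>2)) ^ l)"
proof (cases "\<omega> = 0")
  \<comment> \<open>Ruling out \<omega> = 0 would take a nonzero zero of the Carlitz exponential.
    Instead, all \<open>u\<close> are \<open>1 / 0 = 0\<close> here, so h and every f vanish and
    both sides of each equation are 0.\<close>
  case True
  then have "u \<iota> \<omega> c z = 0" for c z
    by (simp add: u_def lattice_exp_def)
  then have zero: "f_form \<iota> \<omega> k \<nu> z = 0" "h_form \<iota> \<omega> z = 0" if "k \<ge> 1" for k \<nu> z
    using that by (simp_all add: f_form_def h_form_def zero_power)
  then show ?thesis
    using assms by (simp add: zero_power)
next
  case False
  interpret C_infinity \<iota> by fact
  interpret lattice_of_period \<iota> \<omega> by unfold_locales (rule False)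
  have point: "point_of_Omega \<iota> \<omega> z" if "z \<in> Omega \<iota>" for z
    using that assms(2) by unfold_locales
  note power = point_of_Omega.f_form_power[OF point assms(3,4)]
  show ?thesis
  proof (intro conjI ballI allI impI)
    fix z
    assume z: "z \<in> Omega \<iota>"
    show "f_form \<iota> \<omega> l 1 z = h_form \<iota> \<omega> z ^ l"
      unfolding power[OF z] point_of_Omega.f_form_1_1[OF point[OF z]] ..
    show "f_form \<iota> \<omega> l 2 z = h_form \<iota> \<omega> z ^ l * g_form \<iota> \<omega> z ^ (l * CARD('f))"
      unfolding power[OF z] point_of_Omega.f_form_2[OF point[OF z]]
      by (simp add: power_mult_distrib mult.commute flip: power_mult)
    fix \<nu> :: nat
    assume "2 \<le> \<nu>"
    then obtain \<mu> where \<nu>: "\<nu> = Suc (Suc \<mu>)"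
      by (metis add_2_eq_Suc le_Suc_ex)
    show "f_form \<iota> \<omega> l \<nu> z =
        (g_form \<iota> \<omega> z ^ CARD('f) / h_form \<iota> \<omega> z ^ (CARD('f) - 1)
            * f_form \<iota> \<omega> 1 (\<nu> - 1) z ^ CARD('f)
         - bracket \<iota> (\<nu> - 2) ^ (CARD('f)\<^sup>2) / h_form \<iota> \<omega> z ^ (CARD('f) - 1)
            * f_form \<iota> \<omega> 1 (\<nu> - 2) z ^ (CARD('f)\<^sup>2)) ^ l"
      unfolding power[OF z] \<nu> point_of_Omega.f_form_recurrence[OF point[OF z]] by simp
  qed
qed

end
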